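(* Let $\alpha>-1$ and let $\sigma>0$. The following estimates hold uniformly in $x,y>0$. (i) If $x+y\le 1$, then $$K^{\alpha,\sigma}(x,y)\simeq \chi_{\{\sigma>\alpha+1\}}+\chi_{\{\sigma=\alpha+1\}}\log\frac{1}{x+y}+(x+y)^{-2\alpha-1}\begin{cases}|x-y|^{2\sigma-1}, & \sigma<1/2,\\ 1+\log\frac{x+y}{|x-y|}, & \sigma=1/2,\\ (x+y)^{2\sigma-1}, & \sigma>1/2.\end{cases}$$ (ii) If $x+y>1$, then $$K^{\alpha,\sigma}(x,y)\simeq\simeq (x+y)^{-2\alpha-1}\exp\big(-c|x-y|(x+y)\big)\begin{cases}|x-y|^{2\sigma-1}, & \sigma<1/2,\\ 1+\log^+\frac{1}{|x-y|(x+y)}, & \sigma=1/2,\\ (x+y)^{1-2\sigma}, & \sigma>1/2.\end{cases}$$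
   Context: For $\alpha>-1$, let $I_\alpha$ be the modified Bessel function of the first kind of order $\alpha$, and for $t,x,y>0$ let $$G_t^{\alpha}(x,y)=\frac{1}{\sinh 2t}\exp\Big(-\frac12\coth(2t)(x^2+y^2)\Big)(xy)^{-\alpha}I_\alpha\Big(\frac{xy}{\sinh 2t}\Big)$$ (the Laguerre heat kernel of convolution type). For $\sigma>0$ the potential kernel is $$K^{\alpha,\sigma}(x,y)=\frac{1}{\Gamma(\sigma)}\int_0^\infty G_t^\alpha(x,y)\,t^{\sigma-1}\,dt\in[0,\infty],\qquad x,y>0.$$ Notation: $\chi_{\{\cdot\}}$ equals $1$ if the condition holds and $0$ otherwise; $\log^+ s=\max(\log s,0)$. $X\simeq Y$ means $C^{-1}Y\le X\le CY$ with a constant $C>0$ depending only on $\alpha,\sigma$ (not on $x,y$). $X\simeq\simeq Y\exp(-cZ)$ means that there are positive constants $C,c_1,c_2$, depending only on $\alpha,\sigma$, such that $C^{-1}Y\exp(-c_1Z)\le X\le CY\exp(-c_2Z)$. All expressions are valued in $[0,\infty]$ with natural limiting interpretations, e.g. $0^{\beta}=\infty$ for $\beta<0$ and $\log\frac{1}{0}=\infty$. *)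

theory Defs
  imports "HOL-Analysis.Analysis"
begin

text \<open>Modified Bessel function of the first kind, for arguments \<open>z > 0\<close>. The reciprocal Gamma
  function makes the series correct also where \<open>Gamma\<close> has poles.\<close>

definition bessel_I :: "real \<Rightarrow> real \<Rightarrow> real" where
  "bessel_I \<alpha> z = (\<Sum>n. (z / 2) powr (2 * real n + \<alpha>) * rGamma (real n + \<alpha> + 1) / fact n)"

definition laguerre_heat_kernel :: "real \<Rightarrow> real \<Rightarrow> real \<Rightarrow> real \<Rightarrow> real" where
  "laguerre_heat_kernel \<alpha> t x y =
     1 / sinh (2 * t) * exp (- (1 / 2) * (cosh (2 * t) / sinh (2 * t)) * (x\<^sup>2 + y\<^sup>2))
       * (x * y) powr (- \<alpha>) * bessel_I \<alpha> (x * y / sinh (2 * t))"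

text \<open>The integrand is nonnegative for \<open>\<alpha> > -1\<close>, so \<open>ennreal\<close> does not truncate it.\<close>

definition potential_kernel :: "real \<Rightarrow> real \<Rightarrow> real \<Rightarrow> real \<Rightarrow> ereal" where
  "potential_kernel \<alpha> \<sigma> x y =
     enn2ereal (ennreal (1 / Gamma \<sigma>) *
       (\<integral>\<^sup>+ t \<in> {0<..}. ennreal (laguerre_heat_kernel \<alpha> t x y * t powr (\<sigma> - 1)) \<partial>lborel))"

text \<open>Powers and logarithms with their limiting values at \<open>0\<close> (and \<open>\<infinity>\<close>), unlike \<open>powr\<close> and \<open>ln\<close>,
  which are \<open>0\<close> at \<open>0\<close>. For \<open>ereal\<close>, division by \<open>0\<close> already gives \<open>\<infinity>\<close> for a positive numerator.\<close>

definition epowr :: "real \<Rightarrow> real \<Rightarrow> ereal" where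
  "epowr s \<beta> = (if s = 0 then (if \<beta> < 0 then \<infinity> else if \<beta> = 0 then 1 else 0) else ereal (s powr \<beta>))"

definition eln :: "ereal \<Rightarrow> ereal" where
  "eln s = (if s \<le> 0 then - \<infinity> else if s = \<infinity> then \<infinity> else ereal (ln (real_of_ereal s)))"

definition eln_plus :: "ereal \<Rightarrow> ereal" where
  "eln_plus s = max (eln s) 0"

text \<open>\<open>X \<simeq> Y\<close> and \<open>X \<simeq>\<simeq> Y exp (-c Z)\<close>, uniformly over \<open>S\<close>.\<close>

definition comparable_on :: "'a set \<Rightarrow> ('a \<Rightarrow> ereal) \<Rightarrow> ('a \<Rightarrow> ereal) \<Rightarrow> bool" where
  "comparable_on S X Y \<longleftrightarrow>
     (\<exists>C::real. C > 0 \<and> (\<forall>p\<in>S. ereal (inverse C) * Y p \<le> X p \<and> X p \<le> ereal C * Y p))"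

definition exp_comparable_on ::
    "'a set \<Rightarrow> ('a \<Rightarrow> ereal) \<Rightarrow> ('a \<Rightarrow> ereal) \<Rightarrow> ('a \<Rightarrow> real) \<Rightarrow> bool" where
  "exp_comparable_on S X Y Z \<longleftrightarrow>
     (\<exists>C c1 c2 :: real. C > 0 \<and> c1 > 0 \<and> c2 > 0 \<and>
        (\<forall>p\<in>S. ereal (inverse C) * Y p * ereal (exp (- c1 * Z p)) \<le> X p \<and>
               X p \<le> ereal C * Y p * ereal (exp (- c2 * Z p))))"

end

theory Submission imports Defs begin

text \<open>
  Write \<open>A = x + y\<close> and \<open>d = \<bar>x - y\<bar>\<close>. The kernel is comparable to an integral of explicit
  functions of \<open>t\<close>, and all three regimes of \<open>\<sigma>\<close> come from one scale-invariant integral.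

  The Bessel function satisfies \<open>I\<^sub>\<alpha>(z) \<simeq> z\<^sup>\<alpha> (1 + z) powr (-\<alpha> - 1/2) exp z\<close> uniformly in \<open>z > 0\<close>
  (\<open>bessel_I_comparable\<close>): its series has coefficients of the size of those of
  \<open>\<Sum>n. (2n + 1) powr (-\<alpha> - 1/2) z\<^sup>2\<^sup>n / (2n)!\<close>, and under the Poisson weights \<open>z\<^sup>k exp (-z) / k!\<close> the
  index \<open>k\<close> concentrates at \<open>z\<close>. The exponentials combine to
  \<open>exp (-(A\<^sup>2 tanh t + d\<^sup>2 / tanh t) / 4)\<close>. For \<open>t \<le> 1\<close> both \<open>sinh (2t)\<close> and \<open>tanh t\<close> are of order \<open>t\<close>,
  and \<open>A\<^sup>2 = 4xy + d\<^sup>2\<close> permits replacing \<open>xy\<close> by \<open>A\<^sup>2\<close> at the cost of a power of \<open>1 + d\<^sup>2 / t\<close>,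
  which the exponential absorbs. So the heat kernel lies between multiples of
  \<open>t powr (-1/2) (t + A\<^sup>2) powr (-\<alpha> - 1/2) exp (-c (A\<^sup>2 t + d\<^sup>2 / t))\<close> with two values of \<open>c\<close>
  (\<open>heat_kernel_small_time\<close>). For \<open>t \<ge> 1\<close> it is at most a multiple of
  \<open>exp (-2(\<alpha> + 1)t - c A\<^sup>2)\<close> (\<open>heat_kernel_large_time\<close>), which the other contributions absorb.

  The common building block is \<open>\<integral> t powr (\<sigma> - 3/2) exp (-c d\<^sup>2 / t) dt\<close> over \<open>0 < t \<le> a\<^sup>2\<close>. By scaling
  it is \<open>a powr (2\<sigma> - 1)\<close> times a function of \<open>r = d / a\<close>, and for \<open>r \<le> 1\<close> that function is of the size
  \<open>r powr (2\<sigma> - 1)\<close>, \<open>1 + log (1/r)\<close> or \<open>1\<close> according to the sign of \<open>\<sigma> - 1/2\<close>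
  (\<open>gauss_power_integral_upper\<close>, \<open>gauss_power_integral_lower\<close>).

  If \<open>A \<le> 1\<close>, then \<open>exp (-c A\<^sup>2 t)\<close> is harmless for \<open>t \<le> 1\<close>. Times below \<open>A\<^sup>2\<close> contribute the block with
  \<open>a = A\<close>; times between \<open>A\<^sup>2\<close> and \<open>1\<close> contribute \<open>\<integral> t powr (\<sigma> - \<alpha> - 2) dt\<close>, the source of the terms
  \<open>\<chi>\<close> and \<open>\<chi> log (1/A)\<close>.

  If \<open>A > 1\<close>, the inequality \<open>A\<^sup>2 t + d\<^sup>2 / t \<ge> 2 A d\<close> yields the exponential factor. Times below \<open>1/A\<^sup>2\<close>
  contribute the block with \<open>a = 1/A\<close>, hence \<open>r = A d\<close>, and later times are cut off by
  \<open>exp (-c A\<^sup>2 t)\<close>. When \<open>A d > 1\<close> the lower bound is attained already near \<open>t = d / A\<close>, the minimiser of the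
  exponent.

  On the diagonal with \<open>\<sigma> \<le> 1/2\<close> both sides are infinite, so the estimates are proved in \<open>ennreal\<close> and
  transported to \<open>ereal\<close> at the end.
\<close>

section \<open>Moments of the Poisson weights\<close>

text \<open>Let \<open>M\<^sub>m\<close> be the sum. Since \<open>(k + 1)\<^sup>m\<^sup>+\<^sup>1 = (k + 1)\<^sup>m + k (k + 1)\<^sup>m\<close> and
  \<open>k z\<^sup>k / k! = z z\<^sup>k\<^sup>-\<^sup>1 / (k - 1)!\<close>, one gets \<open>M\<^sub>m\<^sub>+\<^sub>1 \<le> M\<^sub>m + 2\<^sup>m z M\<^sub>m\<close>.\<close>
lemma poisson_moment:
  fixes m :: nat
  shows "\<exists>C>0. \<forall>z>0. summable (\<lambda>k. (real k + 1) ^ m * (z ^ k / fact k)) \<and>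
           (\<Sum>k. (real k + 1) ^ m * (z ^ k / fact k)) \<le> C * (1 + z) ^ m * exp z"
proof (induction m)
  case 0
  have "summable (\<lambda>k. z ^ k / fact k) \<and> (\<Sum>k. z ^ k / fact k) = exp z" for z :: real
    using summable_exp[of z] by (simp add: exp_def divide_inverse mult.commute)
  then show ?case by (intro exI[of _ 1]) auto
next
  case (Suc m)
  then obtain C where C: "C > 0" and
    IH: "\<And>z::real. z > 0 \<Longrightarrow> summable (\<lambda>k. (real k + 1) ^ m * (z ^ k / fact k))"
        "\<And>z::real. z > 0 \<Longrightarrow> (\<Sum>k. (real k + 1) ^ m * (z ^ k / fact k)) \<le> C * (1 + z) ^ m * exp z"
    by blast
  show ?case
  proof (intro exI[of _ "2 ^ m * C"] conjI allI impI)
    show "2 ^ m * C > 0" using C by simp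
  next
    fix z :: real assume z: "z > 0"
    define a where "a = (\<lambda>k. (real k + 1) ^ m * (z ^ k / fact k))"
    define b where "b = (\<lambda>k. (real k + 2) ^ m * (z ^ k / fact k))"
    define c where "c = (\<lambda>k. real k * (real k + 1) ^ m * (z ^ k / fact k))"
    have sa: "summable a" and la: "suminf a \<le> C * (1 + z) ^ m * exp z"
      using IH[OF z] by (simp_all add: a_def)
    have ba: "b k \<le> 2 ^ m * a k" for k
    proof -
      have "(real k + 2) ^ m \<le> (2 * (real k + 1)) ^ m" by (intro power_mono) auto
      then have "(real k + 2) ^ m \<le> 2 ^ m * (real k + 1) ^ m" by (simp only: power_mult_distrib)
      then show ?thesis unfolding a_def b_def using z
        by (simp only: mult.assoc[symmetric]) (intro mult_right_mono, auto)
    qed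
    have sb: "summable b"
      by (rule summable_comparison_test'[OF summable_mult[OF sa, of "2 ^ m"], of 0])
        (use ba z in \<open>auto simp: b_def\<close>)
    have lb: "suminf b \<le> 2 ^ m * suminf a"
      using suminf_le[OF ba sb summable_mult[OF sa]] by (simp add: suminf_mult[OF sa])
    have cS: "c (Suc k) = z * b k" for k
      by (simp add: c_def b_def field_simps del: of_nat_Suc) (simp add: algebra_simps)
    have sc: "summable c"
      using summable_mult[OF sb, of z] by (subst summable_Suc_iff[symmetric]) (simp add: cS)
    have lc: "suminf c = z * suminf b"
      using suminf_split_head[OF sc] by (simp add: cS suminf_mult[OF sb]) (simp add: c_def)
    have eq: "(real k + 1) ^ Suc m * (z ^ k / fact k) = a k + c k" for k
      by (simp add: a_def c_def algebra_simps add_divide_distrib)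
    have a0: "suminf a \<ge> 0" by (rule suminf_nonneg[OF sa]) (use z in \<open>auto simp: a_def\<close>)
    have "suminf a + suminf c \<le> suminf a + z * (2 ^ m * suminf a)"
      using lb lc z by simp
    also have "\<dots> \<le> 2 ^ m * (1 + z) * suminf a"
    proof -
      have "1 * suminf a \<le> 2 ^ m * suminf a" by (rule mult_right_mono[OF _ a0]) simp
      then show ?thesis by (simp add: algebra_simps)
    qed
    also have "\<dots> \<le> 2 ^ m * (1 + z) * (C * (1 + z) ^ m * exp z)"
      by (rule mult_left_mono[OF la]) (use z in simp)
    finally have fin: "suminf a + suminf c \<le> 2 ^ m * C * (1 + z) ^ Suc m * exp z"
      by (simp add: mult_ac)
    show "summable (\<lambda>k. (real k + 1) ^ Suc m * (z ^ k / fact k))"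
      unfolding eq using summable_add[OF sa sc] .
    show "(\<Sum>k. (real k + 1) ^ Suc m * (z ^ k / fact k)) \<le> 2 ^ m * C * (1 + z) ^ Suc m * exp z"
      unfolding eq using fin by (simp add: suminf_add[OF sa sc, symmetric])
  qed
qed

text \<open>Let \<open>N\<^sub>m\<close> be the sum. The factor \<open>z\<close> shifts the index, \<open>z z\<^sup>k / k! = (k + 1) z\<^sup>k\<^sup>+\<^sup>1 / (k + 1)!\<close>,
  and lowers the exponent by one, so \<open>(1 + z) N\<^sub>m\<^sub>+\<^sub>1 \<le> (1 + 2\<^sup>m) N\<^sub>m\<close>.\<close>
lemma poisson_negative_moment:
  fixes m :: nat
  shows "\<exists>C>0. \<forall>z>0. summable (\<lambda>k. (z ^ k / fact k) / (real k + 1) ^ m) \<and>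
           (\<Sum>k. (z ^ k / fact k) / (real k + 1) ^ m) \<le> C * exp z / (1 + z) ^ m"
proof (induction m)
  case 0
  have "summable (\<lambda>k. z ^ k / fact k) \<and> (\<Sum>k. z ^ k / fact k) = exp z" for z :: real
    using summable_exp[of z] by (simp add: exp_def divide_inverse mult.commute)
  then show ?case by (intro exI[of _ 1]) auto
next
  case (Suc m)
  then obtain C where C: "C > 0" and
    IH: "\<And>z::real. z > 0 \<Longrightarrow> summable (\<lambda>k. (z ^ k / fact k) / (real k + 1) ^ m)"
        "\<And>z::real. z > 0 \<Longrightarrow> (\<Sum>k. (z ^ k / fact k) / (real k + 1) ^ m) \<le> C * exp z / (1 + z) ^ m"
    by blast
  show ?case
  proof (intro exI[of _ "(1 + 2 ^ m) * C"] conjI allI impI)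
    show "(1 + 2 ^ m) * C > 0" using C by (simp add: add_pos_pos)
  next
    fix z :: real assume z: "z > 0"
    define a where "a = (\<lambda>k. (z ^ k / fact k) / (real k + 1) ^ m)"
    define b where "b = (\<lambda>k. (z ^ k / fact k) / (real k + 1) ^ Suc m)"
    have sa: "summable a" and la: "suminf a \<le> C * exp z / (1 + z) ^ m"
      using IH[OF z] by (simp_all add: a_def)
    have a0: "a k \<ge> 0" for k using z by (simp add: a_def)
    have ba: "b k \<le> a k" for k
      unfolding a_def b_def by (intro divide_left_mono power_increasing) (use z in auto)
    have sb: "summable b"
      by (rule summable_comparison_test'[OF sa, of 0]) (use ba z in \<open>auto simp: b_def\<close>)
    have sa': "summable (\<lambda>k. a (Suc k))" using sa by (simp add: summable_Suc_iff)
    have zb: "z * b k \<le> 2 ^ m * a (Suc k)" for k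
    proof -
      have "(real k + 2) ^ m \<le> (2 * (real k + 1)) ^ m" by (intro power_mono) auto
      then have *: "(real k + 2) ^ m \<le> 2 ^ m * (real k + 1) ^ m" by (simp only: power_mult_distrib)
      have "z * b k = (z ^ Suc k / fact (Suc k)) * (1 / (real k + 1) ^ m)"
        by (simp add: b_def field_simps)
      also have "\<dots> \<le> (z ^ Suc k / fact (Suc k)) * (2 ^ m / (real k + 2) ^ m)"
        by (intro mult_left_mono) (use z * in \<open>auto simp: field_simps\<close>)
      also have "\<dots> = 2 ^ m * a (Suc k)" by (simp add: a_def algebra_simps)
      finally show ?thesis .
    qed
    have "z * suminf b = (\<Sum>k. z * b k)" by (simp add: suminf_mult[OF sb])
    also have "\<dots> \<le> (\<Sum>k. 2 ^ m * a (Suc k))"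
      by (rule suminf_le[OF zb summable_mult[OF sb] summable_mult[OF sa']])
    also have "\<dots> = 2 ^ m * (suminf a - a 0)"
      by (simp add: suminf_mult[OF sa'] suminf_split_head[OF sa])
    also have "\<dots> \<le> 2 ^ m * suminf a" using a0[of 0] by simp
    finally have "(1 + z) * suminf b \<le> (1 + 2 ^ m) * suminf a"
      using suminf_le[OF ba sb sa] by (simp add: algebra_simps)
    also have "\<dots> \<le> (1 + 2 ^ m) * (C * exp z / (1 + z) ^ m)"
      by (rule mult_left_mono[OF la]) (simp add: add_nonneg_nonneg)
    finally have "suminf b \<le> (1 + 2 ^ m) * C * exp z / (1 + z) ^ Suc m"
      using z by (simp add: pos_le_divide_eq mult_ac)
    then show "(\<Sum>k. (z ^ k / fact k) / (real k + 1) ^ Suc m) \<le> (1 + 2 ^ m) * C * exp z / (1 + z) ^ Suc m"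
      by (simp add: b_def)
    show "summable (\<lambda>k. (z ^ k / fact k) / (real k + 1) ^ Suc m)" using sb by (simp add: b_def)
  qed
qed

lemma powr_le_power_add_inverse:
  fixes u p :: real
  assumes "u > 0" "\<bar>p\<bar> \<le> real m"
  shows "u powr p \<le> u ^ m + 1 / u ^ m"
proof (cases "u \<ge> 1")
  case True
  then have "u powr p \<le> u powr real m" using assms by (intro powr_mono) auto
  moreover have "1 / u ^ m \<ge> 0" using assms by simp
  ultimately show ?thesis using assms by (simp add: powr_realpow add_increasing2)
next
  case False
  then have "u powr p \<le> u powr (- real m)" using assms by (intro powr_mono') auto
  moreover have "u ^ m \<ge> 0" using assms by simp
  ultimately show ?thesis using assms by (simp add: powr_realpow powr_minus_divide add_increasing)
qed

text \<open>A real exponent is controlled by integer ones: for \<open>u = (k + 1) / (1 + z)\<close> and an integer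
  \<open>m \<ge> \<bar>p\<bar>\<close> one has \<open>u\<^sup>p \<le> u\<^sup>m + u\<^sup>-\<^sup>m\<close>. Only even \<open>k\<close> are summed because these are the powers of the
  Bessel series.\<close>
lemma even_poisson_moment_upper:
  fixes p :: real
  shows "\<exists>C>0. \<forall>z>0. summable (\<lambda>k. if even k then (real k + 1) powr p * (z ^ k / fact k) else 0) \<and>
           (\<Sum>k. if even k then (real k + 1) powr p * (z ^ k / fact k) else 0)
             \<le> C * (1 + z) powr p * exp z"
proof -
  define m where "m = nat \<lceil>\<bar>p\<bar>\<rceil>"
  have m: "\<bar>p\<bar> \<le> real m" by (simp add: m_def)
  obtain C1 where C1: "C1 > 0"
    "\<And>z::real. z > 0 \<Longrightarrow> summable (\<lambda>k. (real k + 1) ^ m * (z ^ k / fact k))"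
    "\<And>z::real. z > 0 \<Longrightarrow> (\<Sum>k. (real k + 1) ^ m * (z ^ k / fact k)) \<le> C1 * (1 + z) ^ m * exp z"
    using poisson_moment[of m] by blast
  obtain C2 where C2: "C2 > 0"
    "\<And>z::real. z > 0 \<Longrightarrow> summable (\<lambda>k. (z ^ k / fact k) / (real k + 1) ^ m)"
    "\<And>z::real. z > 0 \<Longrightarrow> (\<Sum>k. (z ^ k / fact k) / (real k + 1) ^ m) \<le> C2 * exp z / (1 + z) ^ m"
    using poisson_negative_moment[of m] by blast
  show ?thesis
  proof (intro exI[of _ "C1 + C2"] conjI allI impI)
    show "C1 + C2 > 0" using C1 C2 by simp
  next
    fix z :: real assume z: "z > 0"
    define f where "f = (\<lambda>k. if even k then (real k + 1) powr p * (z ^ k / fact k) else 0)"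
    define g where "g = (\<lambda>k. (real k + 1) ^ m * (z ^ k / fact k))"
    define h where "h = (\<lambda>k. (z ^ k / fact k) / (real k + 1) ^ m)"
    define P where "P = (1 + z) powr p"
    define Q where "Q = (1 + z) ^ m"
    have pos: "P > 0" "Q > 0" using z by (auto simp: P_def Q_def)
    have sg: "summable g" and lg: "suminf g \<le> C1 * Q * exp z"
      using C1 z by (simp_all add: g_def Q_def)
    have sh: "summable h" and lh: "suminf h \<le> C2 * exp z / Q"
      using C2 z by (simp_all add: h_def Q_def)
    have f0: "f k \<ge> 0" for k using z by (simp add: f_def)
    have le: "f k \<le> P / Q * g k + P * Q * h k" for k
    proof (cases "even k")
      case True
      have "((real k + 1) / (1 + z)) powr p
              \<le> ((real k + 1) / (1 + z)) ^ m + 1 / ((real k + 1) / (1 + z)) ^ m"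
        by (rule powr_le_power_add_inverse[OF _ m]) (use z in \<open>auto intro!: divide_pos_pos\<close>)
      then have "(real k + 1) powr p / P \<le> (real k + 1) ^ m / Q + Q / (real k + 1) ^ m"
        using z by (simp add: powr_divide power_divide P_def Q_def)
      then have "(real k + 1) powr p \<le> P * ((real k + 1) ^ m / Q + Q / (real k + 1) ^ m)"
        using pos by (simp add: field_simps)
      then have "(real k + 1) powr p * (z ^ k / fact k)
          \<le> P * ((real k + 1) ^ m / Q + Q / (real k + 1) ^ m) * (z ^ k / fact k)"
        by (rule mult_right_mono) (use z in simp)
      then show ?thesis using True by (simp add: f_def g_def h_def algebra_simps)
    next
      case False
      then show ?thesis using pos z by (simp add: f_def g_def h_def)
    qed
    note s = summable_add[OF summable_mult[OF sg, of "P / Q"] summable_mult[OF sh, of "P * Q"]]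
    have sf: "summable f"
      by (rule summable_comparison_test'[OF s, of 0]) (use le f0 in auto)
    have "suminf f \<le> P / Q * suminf g + P * Q * suminf h"
      by (rule sums_le[OF le summable_sums[OF sf]])
        (intro sums_add sums_mult summable_sums sg sh)
    also have "\<dots> \<le> P / Q * (C1 * Q * exp z) + P * Q * (C2 * exp z / Q)"
      by (intro add_mono mult_left_mono lg lh) (use pos in auto)
    also have "\<dots> = (C1 + C2) * P * exp z" using pos by (simp add: field_simps)
    finally show "(\<Sum>k. if even k then (real k + 1) powr p * (z ^ k / fact k) else 0)
        \<le> (C1 + C2) * (1 + z) powr p * exp z" unfolding f_def P_def .
    show "summable (\<lambda>k. if even k then (real k + 1) powr p * (z ^ k / fact k) else 0)"
      using sf unfolding f_def .
  qed
qed

text \<open>The upper bound for the exponent \<open>-p\<close> implies the lower bound for \<open>p\<close>: with \<open>u\<close> as above,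
  \<open>2 \<le> \<lambda> u\<^sup>p + u\<^sup>-\<^sup>p / \<lambda>\<close>. Summing over even \<open>k\<close> gives \<open>2 cosh z \<ge> exp z\<close> on the left, and \<open>\<lambda> = 2C\<close>
  makes the second term on the right at most half of it.\<close>
lemma even_poisson_moment_lower:
  fixes p :: real
  shows "\<exists>C>0. \<forall>z>0. (1 + z) powr p * exp z
           \<le> C * (\<Sum>k. if even k then (real k + 1) powr p * (z ^ k / fact k) else 0)"
proof -
  let ?f = "\<lambda>q z k. if even k then (real k + 1) powr q * (z ^ k / fact k) else 0"
  from even_poisson_moment_upper[of p] obtain C1 where
    *: "\<forall>z>0. summable (?f p z) \<and> suminf (?f p z) \<le> C1 * (1 + z) powr p * exp z"
    by (elim exE conjE) (rule that)
  have S1: "summable (?f p z)" if "z > 0" for z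
    using *[rule_format, OF that] by (rule conjunct1)
  from even_poisson_moment_upper[of "-p"] obtain C where C: "C > 0" and
    *: "\<forall>z>0. summable (?f (-p) z) \<and> suminf (?f (-p) z) \<le> C * (1 + z) powr (-p) * exp z"
    by (elim exE conjE) (rule that)
  have S2: "summable (?f (-p) z)" and B2: "suminf (?f (-p) z) \<le> C * (1 + z) powr (-p) * exp z"
    if "z > 0" for z
    using *[rule_format, OF that] by (rule conjunct1, rule conjunct2)
  show ?thesis
  proof (intro exI[of _ "4 * C"] conjI allI impI)
    show "4 * C > 0" using C by simp
  next
    fix z :: real assume z: "z > 0"
    define P where "P = (1 + z) powr p"
    have P: "P > 0" using z by (simp add: P_def)
    define f where "f = (\<lambda>k. if even k then (real k + 1) powr p * (z ^ k / fact k) else 0)"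
    define g where "g = (\<lambda>k. if even k then (real k + 1) powr (-p) * (z ^ k / fact k) else 0)"
    define h where "h = (\<lambda>k. if even k then z ^ k /\<^sub>R fact k else 0)"
    have sf: "summable f" and sg: "summable g" using S1[OF z] S2[OF z] unfolding f_def g_def .
    have lg: "suminf g \<le> C * exp z / P"
      using B2[OF z] unfolding g_def P_def powr_minus_divide by (simp only: times_divide_eq_right times_divide_eq_left mult_1_right mult_1_left)
    have h: "h sums cosh z" unfolding h_def by (rule cosh_converges)
    have le: "2 * h k \<le> 2 * C / P * f k + P / (2 * C) * g k" for k
    proof (cases "even k")
      case True
      define r where "r = (real k + 1) powr p"
      have r: "r > 0" by (simp add: r_def)
      \<comment> \<open>\<open>v = \<lambda> u\<^sup>p\<close> with \<open>\<lambda> = 2C\<close>\<close>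
      define v where "v = 2 * C * r / P"
      have v: "v > 0" using r P C by (simp add: v_def)
      have "(2 * v * 1) / v \<le> (v\<^sup>2 + 1\<^sup>2) / v"
        by (intro divide_right_mono sum_squares_bound) (use v in simp)
      then have "2 \<le> v + 1 / v"
        using v by (simp add: add_divide_distrib power2_eq_square)
      also have "\<dots> = 2 * C / P * r + P / (2 * C) * (1 / r)" by (simp add: v_def)
      finally have "2 * (z ^ k / fact k) \<le> (2 * C / P * r + P / (2 * C) * (1 / r)) * (z ^ k / fact k)"
        by (rule mult_right_mono) (use z in simp)
      also have "\<dots> = 2 * C / P * (r * (z ^ k / fact k)) + P / (2 * C) * ((1 / r) * (z ^ k / fact k))"
        by (simp only: distrib_right mult.assoc)
      also have "1 / r = (real k + 1) powr (-p)" by (simp add: r_def powr_minus_divide)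
      finally show ?thesis
        using True unfolding f_def g_def h_def r_def by (simp add: divide_inverse_commute[of "z ^ k"])
    qed (simp add: f_def g_def h_def)
    have "exp z \<le> 2 * cosh z" by (simp add: cosh_def)
    also have "\<dots> \<le> 2 * C / P * suminf f + P / (2 * C) * suminf g"
      by (rule sums_le[OF le sums_mult[OF h]])
        (intro sums_add sums_mult summable_sums sf sg)
    also have "\<dots> \<le> 2 * C / P * suminf f + P / (2 * C) * (C * exp z / P)"
      by (intro add_left_mono mult_left_mono lg) (use P C in auto)
    also have "\<dots> = 2 * C / P * suminf f + exp z / 2" using P C by simp
    finally have "exp z \<le> 4 * C / P * suminf f" by (simp add: field_simps)
    then have "P * exp z \<le> 4 * C * suminf f" using P by (simp add: field_simps)
    then show "(1 + z) powr p * exp z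
       \<le> 4 * C * (\<Sum>k. if even k then (real k + 1) powr p * (z ^ k / fact k) else 0)"
      unfolding P_def f_def .
  qed
qed

section \<open>Two-sided bounds for the Bessel function\<close>

lemma positive_convergent_comparable:
  fixes u :: "nat \<Rightarrow> real"
  assumes pos: "\<And>n. u n > 0" and lim: "u \<longlonglongrightarrow> L" and L: "L > 0"
  shows "\<exists>C>0. \<forall>n. 1 / C \<le> u n \<and> u n \<le> C"
proof -
  have "Bseq u" using lim by (intro convergent_imp_Bseq convergentI)
  then obtain K1 where K1: "K1 > 0" "\<And>n. norm (u n) \<le> K1" unfolding Bseq_def by blast
  have "(\<lambda>n. inverse (u n)) \<longlonglongrightarrow> inverse L" using lim L by (intro tendsto_inverse) auto
  then have "Bseq (\<lambda>n. inverse (u n))" by (intro convergent_imp_Bseq convergentI)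
  then obtain K2 where K2: "K2 > 0" "\<And>n. norm (inverse (u n)) \<le> K2" unfolding Bseq_def by blast
  show ?thesis
  proof (intro exI[of _ "max K1 K2"] conjI allI)
    fix n
    have n: "u n > 0" "inverse (u n) \<le> K2" "u n \<le> K1"
      using pos[of n] K1(2)[of n] K2(2)[of n] by auto
    then have "1 / K2 \<le> u n" using K2(1) by (simp add: field_simps)
    moreover have "1 / max K1 K2 \<le> 1 / K2" using K1 K2 by (intro divide_left_mono) auto
    ultimately show "1 / max K1 K2 \<le> u n" by linarith
    show "u n \<le> max K1 K2" using n by simp
  qed (use K1 in auto)
qed

text \<open>By the duplication formula \<open>(2n)! / (4\<^sup>n n!)\<close> is the Pochhammer symbol of \<open>1/2\<close>, and
  \<open>Gamma (n + \<alpha> + 1)\<close> is \<open>Gamma (\<alpha> + 1)\<close> times that of \<open>\<alpha> + 1\<close>. Their quotient grows like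
  \<open>n powr (-\<alpha> - 1/2)\<close> by Euler's limit formula for \<open>Gamma\<close>, so the sequence has a positive limit.\<close>
lemma bessel_coefficient_comparable:
  fixes \<alpha> :: real
  assumes "\<alpha> > -1"
  shows "\<exists>C>0. \<forall>n. 
     1 / C \<le> fact (2 * n) / (4 ^ n * fact n) * rGamma (real n + \<alpha> + 1) * (2 * real n + 1) powr (\<alpha> + 1 / 2) \<and>
     fact (2 * n) / (4 ^ n * fact n) * rGamma (real n + \<alpha> + 1) * (2 * real n + 1) powr (\<alpha> + 1 / 2) \<le> C"
proof -
  let ?a = "\<alpha> + 1"
  define u :: "nat \<Rightarrow> real" where "u = (\<lambda>n. 
     fact (2 * n) / (4 ^ n * fact n) * rGamma (real n + \<alpha> + 1) * (2 * real n + 1) powr (\<alpha> + 1 / 2))"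
  have Ga: "Gamma ?a > 0" by (rule Gamma_real_pos) (use assms in simp)
  have ni: "?a \<notin> \<int>\<^sub>\<le>\<^sub>0" using assms by (auto elim!: nonpos_Ints_cases)
  have pos: "u n > 0" for n
  proof -
    have "Gamma (real n + \<alpha> + 1) > 0" using assms by (intro Gamma_real_pos) linarith
    then show ?thesis by (simp add: u_def Gamma_def)
  qed
  have eq: "u n = Gamma_series' ?a n / Gamma_series' (1 / 2) n / Gamma ?a * (2 + 1 / real n) powr (\<alpha> + 1 / 2)"
    if n: "n > 0" for n
  proof -
    have p1: "pochhammer ?a n > 0" "pochhammer (1/2::real) n > 0"
      using assms by (auto intro!: pochhammer_pos)
    have "pochhammer ?a n = Gamma (?a + real n) / Gamma ?a" 
      by (rule pochhammer_Gamma[OF ni])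
    then have G: "rGamma (real n + \<alpha> + 1) = 1 / (pochhammer ?a n * Gamma ?a)"
      using Ga by (simp add: rGamma_inverse_Gamma inverse_eq_divide add_ac)
    have F: "fact (2 * n) / (4 ^ n * fact n) = pochhammer (1/2::real) n"
      by (simp add: fact_double power_mult)
    have E: "exp ((\<alpha> + 1) * ln (real n)) = real n powr (\<alpha> + 1 / 2) * exp (1/2 * ln (real n))"
      using n by (simp add: powr_def exp_add[symmetric] algebra_simps)
    have "2 * real n + 1 = (2 + 1 / real n) * real n" using n by (simp add: field_simps)
    then have W: "(2 * real n + 1) powr (\<alpha> + 1 / 2) = (2 + 1 / real n) powr (\<alpha> + 1 / 2) * real n powr (\<alpha> + 1 / 2)"
      using n by (simp add: powr_mult)
    show ?thesis
      unfolding u_def F G W Gamma_series'_def using n p1 by (simp add: E)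
  qed
  have "(\<lambda>n. 2 + 1 / real n) \<longlonglongrightarrow> 2"
    using tendsto_add[OF tendsto_const lim_1_over_n, of "2::real"] by simp
  then have "(\<lambda>n. Gamma_series' ?a n / Gamma_series' (1 / 2) n / Gamma ?a * (2 + 1 / real n) powr (\<alpha> + 1 / 2))
     \<longlonglongrightarrow> Gamma ?a / Gamma (1 / 2) / Gamma ?a * 2 powr (\<alpha> + 1 / 2)"
    using Ga
    by (intro tendsto_intros Gamma_series'_LIMSEQ) (auto simp: Gamma_one_half_real)
  moreover have "eventually (\<lambda>n. Gamma_series' ?a n / Gamma_series' (1 / 2) n / Gamma ?a * (2 + 1 / real n) powr (\<alpha> + 1 / 2) = u n) sequentially"
    using eventually_gt_at_top[of 0] by eventually_elim (simp add: eq)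
  ultimately have "u \<longlonglongrightarrow> Gamma ?a / Gamma (1 / 2) / Gamma ?a * 2 powr (\<alpha> + 1 / 2)"
    by (rule Lim_transform_eventually)
  moreover have "Gamma ?a / Gamma (1 / 2) / Gamma ?a * 2 powr (\<alpha> + 1 / 2) > 0"
    using Ga by (simp add: Gamma_one_half_real)
  ultimately show ?thesis
    using positive_convergent_comparable[of u] pos unfolding u_def by blast
qed

text \<open>The factor \<open>c n\<close> of the proof is the bounded coefficient above: the \<open>n\<close>-th term of the Bessel series is
  \<open>(z / 2)\<^sup>\<alpha> c\<^sub>n (2n + 1) powr (-\<alpha> - 1/2) z\<^sup>2\<^sup>n / (2n)!\<close>, an even Poisson moment up to \<open>c\<^sub>n\<close>.\<close>
lemma bessel_I_comparable:
  fixes \<alpha> :: real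
  assumes "\<alpha> > -1"
  shows "\<exists>C>0. \<forall>z>0. z powr \<alpha> * (1 + z) powr (- \<alpha> - 1 / 2) * exp z \<le> C * bessel_I \<alpha> z \<and>
           bessel_I \<alpha> z \<le> C * (z powr \<alpha> * (1 + z) powr (- \<alpha> - 1 / 2) * exp z)"
proof -
  define p where "p = - \<alpha> - 1 / 2"
  let ?f = "\<lambda>z k. if even k then (real k + 1) powr p * (z ^ k / fact k) else 0"
  obtain C where C: "C > 0" and
    coef: "\<And>n. 1 / C \<le> fact (2 * n) / (4 ^ n * fact n) * rGamma (real n + \<alpha> + 1) * (2 * real n + 1) powr (\<alpha> + 1 / 2)"
      "\<And>n. fact (2 * n) / (4 ^ n * fact n) * rGamma (real n + \<alpha> + 1) * (2 * real n + 1) powr (\<alpha> + 1 / 2) \<le> C"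
    using bessel_coefficient_comparable[OF assms] by blast
  from even_poisson_moment_upper[of p] obtain C1 where C1: "C1 > 0" and
    up: "\<forall>z>0. summable (?f z) \<and> suminf (?f z) \<le> C1 * (1 + z) powr p * exp z"
    by (elim exE conjE) (rule that)
  from even_poisson_moment_lower[of p] obtain C2 where C2: "C2 > 0" and
    low: "\<forall>z>0. (1 + z) powr p * exp z \<le> C2 * suminf (?f z)"
    by (elim exE conjE) (rule that)
  define K where "K = C1 * C * 2 powr (-\<alpha>) + C2 * C / 2 powr (-\<alpha>)"
  show ?thesis
  proof (intro exI[of _ K] conjI allI impI)
    show "K > 0" using C C1 C2 by (simp add: K_def add_pos_pos)
  next
    fix z :: real assume z: "z > 0"
    define t where "t = (\<lambda>n. (z / 2) powr (2 * real n + \<alpha>) * rGamma (real n + \<alpha> + 1) / fact n)"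
    define g where "g = (\<lambda>n. (2 * real n + 1) powr p * (z ^ (2 * n) / fact (2 * n)))"
    define c where "c = (\<lambda>n. fact (2 * n) / (4 ^ n * fact n) * rGamma (real n + \<alpha> + 1) * (2 * real n + 1) powr (\<alpha> + 1 / 2))"
    define w where "w = z powr \<alpha> * 2 powr (-\<alpha>)"
    have w: "w > 0" using z by (simp add: w_def)
    have sf: "summable (?f z)" using up[rule_format, OF z] by (rule conjunct1)
    have "(\<lambda>n. ?f z (2 * n)) sums suminf (?f z)"
      by (subst sums_mono_reindex[of "\<lambda>n. 2 * n"])
        (use sf in \<open>auto simp: strict_mono_def intro: summable_sums elim!: evenE\<close>)
    then have gs: "g sums suminf (?f z)" by (simp add: g_def)
    have tg: "t n = w * c n * g n" for n
    proof -
      have "(z / 2) powr (2 * real n + \<alpha>) = (z / 2) powr (real (2 * n)) * (z / 2) powr \<alpha>"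
        using z by (simp add: powr_add)
      also have "(z / 2) powr (real (2 * n)) = z ^ (2 * n) / 4 ^ n"
        using z by (subst powr_realpow) (simp_all add: power_divide power_mult)
      also have "(z / 2) powr \<alpha> = w"
        using z by (simp add: w_def powr_divide powr_minus_divide)
      finally have 1: "(z / 2) powr (2 * real n + \<alpha>) = z ^ (2 * n) / 4 ^ n * w" .
      have 2: "(2 * real n + 1) powr p = 1 / (2 * real n + 1) powr (\<alpha> + 1 / 2)"
        by (simp add: p_def powr_minus_divide[symmetric])
      have 3: "(2 * real n + 1) powr (\<alpha> + 1 / 2) > 0" by simp
      show ?thesis unfolding t_def c_def g_def 1 2
        using 3 by (simp add: field_simps)
    qed
    have g0: "g n \<ge> 0" for n using z by (simp add: g_def)
    have tu: "t n \<le> w * C * g n" for n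
      unfolding tg using w g0 coef by (intro mult_right_mono mult_left_mono) (auto simp: c_def)
    have tl: "w / C * g n \<le> t n" for n
    proof -
      have "w * (1 / C) * g n \<le> w * c n * g n"
        using w g0 coef by (intro mult_right_mono mult_left_mono) (auto simp: c_def)
      then show ?thesis by (simp add: tg)
    qed
    have t0: "t n \<ge> 0" for n
      using tl[of n] g0[of n] w C by (meson divide_nonneg_pos less_imp_le mult_nonneg_nonneg order_trans)
    have st: "summable t"
      by (rule summable_comparison_test'[OF summable_mult[OF sums_summable[OF gs], of "w * C"], of 0])
        (use tu t0 in auto)
    have B: "t sums bessel_I \<alpha> z" using summable_sums[OF st] by (simp add: bessel_I_def t_def)
    have b1: "bessel_I \<alpha> z \<le> w * C * suminf (?f z)"
      by (rule sums_le[OF tu B sums_mult[OF gs]])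
    have b2: "w / C * suminf (?f z) \<le> bessel_I \<alpha> z"
      by (rule sums_le[OF tl sums_mult[OF gs] B])
    have b0: "bessel_I \<alpha> z \<ge> 0" by (rule sums_le[OF t0 sums_zero B])
    define R where "R = (1 + z) powr p * exp z"
    have R: "R > 0" using z by (simp add: R_def)
    have "bessel_I \<alpha> z \<le> w * C * (C1 * R)"
      using b1 up[rule_format, OF z, THEN conjunct2] w C
      by (elim order_trans) (auto simp: R_def mult.assoc intro!: mult_left_mono)
    also have "\<dots> = C1 * C * 2 powr (-\<alpha>) * (z powr \<alpha> * R)" by (simp add: w_def mult_ac)
    also have "\<dots> \<le> K * (z powr \<alpha> * R)"
      using R C2 C by (intro mult_right_mono) (auto simp: K_def)
    finally show "bessel_I \<alpha> z \<le> K * (z powr \<alpha> * (1 + z) powr (- \<alpha> - 1 / 2) * exp z)"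
      by (simp add: R_def p_def mult.assoc)
    have "z powr \<alpha> * R \<le> z powr \<alpha> * (C2 * suminf (?f z))"
      using low[rule_format, OF z] by (intro mult_left_mono) (auto simp: R_def)
    also have "\<dots> = C2 * C / 2 powr (-\<alpha>) * (w / C * suminf (?f z))" using C by (simp add: w_def)
    also have "\<dots> \<le> C2 * C / 2 powr (-\<alpha>) * bessel_I \<alpha> z"
      by (rule mult_left_mono[OF b2]) (use C C2 in auto)
    also have "\<dots> \<le> K * bessel_I \<alpha> z"
      by (rule mult_right_mono[OF _ b0]) (use C C1 in \<open>auto simp: K_def\<close>)
    finally show "z powr \<alpha> * (1 + z) powr (- \<alpha> - 1 / 2) * exp z \<le> K * bessel_I \<alpha> z"
      by (simp add: R_def p_def mult.assoc)
  qed
qed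

section \<open>Two-sided bounds for the heat kernel\<close>

text \<open>The two hypotheses are symmetric because the exponent, later \<open>-\<alpha> - 1/2\<close>, has no fixed sign.\<close>
lemma powr_comparable:
  fixes u v k p :: real
  assumes "u > 0" "v > 0" "k > 0" "u \<le> k * v" "v \<le> k * u"
  shows "u powr p \<le> k powr \<bar>p\<bar> * v powr p"
proof (cases "p \<ge> 0")
  case True
  have "u powr p \<le> (k * v) powr p" using assms True by (intro powr_mono2) auto
  then show ?thesis using assms True by (simp add: powr_mult)
next
  case False
  have "(k * u) powr p \<le> v powr p" using assms False by (intro powr_mono2') auto
  then have "k powr p * u powr p \<le> v powr p" using assms by (simp add: powr_mult)
  then have "k powr (-p) * (k powr p * u powr p) \<le> k powr (-p) * v powr p"
    by (rule mult_left_mono) simp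
  moreover have "k powr (-p) * (k powr p * u powr p) = u powr p"
    using assms by (simp add: powr_minus)
  ultimately show ?thesis using False by simp
qed

lemma powr_le_exp:
  fixes q \<epsilon> :: real
  assumes "\<epsilon> > 0"
  shows "\<exists>C>0. \<forall>v\<ge>0. (1 + v) powr q \<le> C * exp (\<epsilon> * v)"
proof -
  \<comment> \<open>\<open>ln (1 + v)\<close> is bounded by the tangent to \<open>ln\<close> of slope \<open>\<delta>\<close>\<close>
  define \<delta> where "\<delta> = \<epsilon> / (\<bar>q\<bar> + 1)"
  have d: "\<delta> > 0" "\<bar>q\<bar> * \<delta> \<le> \<epsilon>" using assms by (auto simp: \<delta>_def field_simps)
  show ?thesis
  proof (intro exI[of _ "exp (\<epsilon> + \<bar>q\<bar> * (- 1 - ln \<delta>))"] conjI allI impI)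
    fix v :: real assume v: "v \<ge> 0"
    have "ln (\<delta> * (1 + v)) \<le> \<delta> * (1 + v) - 1"
      using d v by (intro ln_le_minus_one) simp
    then have l: "ln (1 + v) \<le> \<delta> * (1 + v) + (- 1 - ln \<delta>)"
      using d v by (simp add: ln_mult)
    have "q * ln (1 + v) \<le> \<bar>q\<bar> * ln (1 + v)" using v by (intro mult_right_mono) auto
    also have "\<dots> \<le> \<bar>q\<bar> * (\<delta> * (1 + v) + (- 1 - ln \<delta>))"
      by (rule mult_left_mono[OF l]) simp
    also have "\<dots> = (\<bar>q\<bar> * \<delta>) * (1 + v) + \<bar>q\<bar> * (- 1 - ln \<delta>)" by (simp add: algebra_simps)
    also have "\<dots> \<le> \<epsilon> * (1 + v) + \<bar>q\<bar> * (- 1 - ln \<delta>)"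
      using d v by (intro add_right_mono mult_right_mono) auto
    finally have "q * ln (1 + v) \<le> (\<epsilon> + \<bar>q\<bar> * (- 1 - ln \<delta>)) + \<epsilon> * v"
      by (simp add: algebra_simps)
    then show "(1 + v) powr q \<le> exp (\<epsilon> + \<bar>q\<bar> * (- 1 - ln \<delta>)) * exp (\<epsilon> * v)"
      using v by (simp add: powr_def exp_add[symmetric])
  qed simp
qed

lemma sinh_cosh_tanh_bounds:
  fixes t :: real
  assumes "0 < t" "t \<le> 1"
  shows "t \<le> sinh (2 * t)" "sinh (2 * t) \<le> 8 * t" "t / 2 \<le> tanh t" "tanh t \<le> t"
proof -
  have "exp t \<le> exp 1" using assms by simp
  then have "exp t \<le> 3" using exp_le by linarith
  moreover have "exp (- t) \<le> 1" using assms by simp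
  ultimately have "exp t + exp (- t) \<le> 3 + 1" by (rule add_mono)
  then have c: "cosh t \<le> 2" by (simp add: cosh_field_def)
  have "\<exists>z>0. z < t \<and> sinh t - sinh 0 = (t - 0) * cosh z"
    using assms by (intro MVT2) (auto intro!: derivative_eq_intros)
  then obtain z where z: "0 < z" "z < t" "sinh t = t * cosh z" by auto
  have cz: "1 \<le> cosh z" "cosh z \<le> cosh t"
    using z by (auto simp: cosh_real_ge_1 cosh_real_nonneg_le_iff)
  have s: "t \<le> sinh t" "sinh t \<le> 2 * t"
    using z cz c assms by auto
  have c1: "1 \<le> cosh t" by (rule cosh_real_ge_1)
  have d: "sinh (2 * t) = 2 * (sinh t * cosh t)" by (simp add: sinh_double)
  have "sinh t * 1 \<le> sinh t * cosh t" by (rule mult_left_mono) (use c1 assms in auto)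
  moreover have "sinh t * cosh t \<le> (2 * t) * 2" by (rule mult_mono) (use s c assms in auto)
  ultimately show "t \<le> sinh (2 * t)" "sinh (2 * t) \<le> 8 * t"
    unfolding d using s assms by linarith+
  have "sinh t / 2 \<le> sinh t / cosh t" using s c c1 assms by (intro divide_left_mono) auto
  then show "t / 2 \<le> tanh t" using s by (simp add: tanh_def)
  have "\<exists>z>0. z < t \<and> tanh t - tanh 0 = (t - 0) * (1 - tanh z ^ 2)"
    using assms by (intro MVT2) (auto intro!: derivative_eq_intros)
  then obtain w where "tanh t = t * (1 - tanh w ^ 2)" by auto
  then show "tanh t \<le> t" using assms by simp
qed

text \<open>Half-angle formulas, \<open>2 cosh (2t) / sinh (2t) = tanh t + 1 / tanh t\<close> and
  \<open>2 / sinh (2t) = 1 / tanh t - tanh t\<close>, separate \<open>x + y\<close> from \<open>x - y\<close>.\<close>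
lemma heat_kernel_exponent:
  fixes t x y :: real
  assumes "t > 0"
  shows "x * y / sinh (2 * t) - 1 / 2 * (cosh (2 * t) / sinh (2 * t)) * (x\<^sup>2 + y\<^sup>2)
           = - (1 / 4) * ((x + y)\<^sup>2 * tanh t + (x - y)\<^sup>2 / tanh t)"
proof -
  define s c where "s = sinh t" and "c = cosh t"
  have s: "s > 0" and c: "c > 0" using assms by (auto simp: s_def c_def)
  have one: "c\<^sup>2 = s\<^sup>2 + 1" using hyperbolic_pythagoras[of t] by (simp add: s_def c_def)
  have "x * y / sinh (2 * t) - 1 / 2 * (cosh (2 * t) / sinh (2 * t)) * (x\<^sup>2 + y\<^sup>2)
      = (2 * (x * y) - (c\<^sup>2 + s\<^sup>2) * (x\<^sup>2 + y\<^sup>2)) / (4 * (s * c))"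
    using s c by (simp add: sinh_double cosh_double s_def[symmetric] c_def[symmetric] diff_divide_distrib)
  also have "2 * (x * y) - (c\<^sup>2 + s\<^sup>2) * (x\<^sup>2 + y\<^sup>2) = - ((x + y)\<^sup>2 * s\<^sup>2 + (x - y)\<^sup>2 * c\<^sup>2)"
    unfolding one by (simp add: power2_eq_square algebra_simps)
  also have "\<dots> / (4 * (s * c)) = - (1 / 4) * ((x + y)\<^sup>2 * tanh t + (x - y)\<^sup>2 / tanh t)"
    using s c by (simp add: tanh_def s_def[symmetric] c_def[symmetric] field_simps power2_eq_square)
  finally show ?thesis .
qed

lemma heat_kernel_comparable:
  fixes \<alpha> :: real
  assumes "\<alpha> > -1"
  shows "\<exists>C>0. \<forall>t>0. \<forall>x>0. \<forall>y>0.
     sinh (2 * t) powr (- 1 / 2) * (sinh (2 * t) + x * y) powr (- \<alpha> - 1 / 2)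
       * exp (- (1 / 4) * ((x + y)\<^sup>2 * tanh t + (x - y)\<^sup>2 / tanh t)) \<le> C * laguerre_heat_kernel \<alpha> t x y \<and>
     laguerre_heat_kernel \<alpha> t x y \<le> C * (sinh (2 * t) powr (- 1 / 2) * (sinh (2 * t) + x * y) powr (- \<alpha> - 1 / 2)
       * exp (- (1 / 4) * ((x + y)\<^sup>2 * tanh t + (x - y)\<^sup>2 / tanh t)))"
proof -
  obtain C where C: "C > 0" and
    lo: "\<And>z. z > 0 \<Longrightarrow> z powr \<alpha> * (1 + z) powr (- \<alpha> - 1 / 2) * exp z \<le> C * bessel_I \<alpha> z" and
    up: "\<And>z. z > 0 \<Longrightarrow> bessel_I \<alpha> z \<le> C * (z powr \<alpha> * (1 + z) powr (- \<alpha> - 1 / 2) * exp z)"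
    using bessel_I_comparable[OF assms] by blast
  show ?thesis
  proof (intro exI[of _ C] conjI allI impI)
    fix t x y :: real assume t: "t > 0" and x: "x > 0" and y: "y > 0"
    define S where "S = sinh (2 * t)"
    have S: "S > 0" using t by (simp add: S_def)
    define z where "z = x * y / S"
    have z: "z > 0" using x y S by (simp add: z_def)
    define m where "m = 1 / S * exp (- (1 / 2) * (cosh (2 * t) / S) * (x\<^sup>2 + y\<^sup>2)) * (x * y) powr (- \<alpha>)"
    have m: "m > 0" using x y S by (simp add: m_def)
    have G: "laguerre_heat_kernel \<alpha> t x y = m * bessel_I \<alpha> z"
      by (simp add: laguerre_heat_kernel_def m_def z_def S_def)
    have p1: "(x * y) powr (- \<alpha>) * z powr \<alpha> = S powr (- \<alpha>)"
      using x y S by (simp add: z_def powr_divide powr_minus field_simps)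
    have p2: "(1 + z) powr (- \<alpha> - 1 / 2) = (S + x * y) powr (- \<alpha> - 1 / 2) * S powr (\<alpha> + 1 / 2)"
    proof -
      have "1 + z = (S + x * y) / S" using S by (simp add: z_def field_simps)
      then have "(1 + z) powr (- \<alpha> - 1 / 2) = (S + x * y) powr (- \<alpha> - 1 / 2) / S powr (- \<alpha> - 1 / 2)"
        using x y S by (simp add: powr_divide)
      also have "\<dots> = (S + x * y) powr (- \<alpha> - 1 / 2) * S powr (- (- \<alpha> - 1 / 2))"
        by (simp only: powr_minus divide_inverse)
      finally show ?thesis by (simp add: add.commute)
    qed
    have p3: "1 / S * S powr (- \<alpha>) * S powr (\<alpha> + 1 / 2) = S powr (- 1 / 2)"
    proof -
      have "1 / S = S powr (- 1)" using S by (simp add: powr_minus_divide)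
      then show ?thesis by (simp only: powr_add[symmetric]) simp
    qed
    have ex: "exp (- (1 / 2) * (cosh (2 * t) / S) * (x\<^sup>2 + y\<^sup>2)) * exp z
        = exp (- (1 / 4) * ((x + y)\<^sup>2 * tanh t + (x - y)\<^sup>2 / tanh t))"
      unfolding heat_kernel_exponent[OF t, symmetric] by (simp add: exp_add[symmetric] z_def S_def)
    have M: "m * (z powr \<alpha> * (1 + z) powr (- \<alpha> - 1 / 2) * exp z) =
       S powr (- 1 / 2) * (S + x * y) powr (- \<alpha> - 1 / 2)
         * exp (- (1 / 4) * ((x + y)\<^sup>2 * tanh t + (x - y)\<^sup>2 / tanh t))"
    proof -
      have "m * (z powr \<alpha> * (1 + z) powr (- \<alpha> - 1 / 2) * exp z) =
        (1 / S * ((x * y) powr (- \<alpha>) * z powr \<alpha>) * S powr (\<alpha> + 1 / 2)) * (S + x * y) powr (- \<alpha> - 1 / 2)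
          * (exp (- (1 / 2) * (cosh (2 * t) / S) * (x\<^sup>2 + y\<^sup>2)) * exp z)"
        unfolding m_def p2 by (simp only: mult_ac)
      then show ?thesis unfolding p1 p3 ex .
    qed
    have "m * (z powr \<alpha> * (1 + z) powr (- \<alpha> - 1 / 2) * exp z) \<le> m * (C * bessel_I \<alpha> z)"
      using lo[OF z] m by (intro mult_left_mono) auto
    then show "sinh (2 * t) powr (- 1 / 2) * (sinh (2 * t) + x * y) powr (- \<alpha> - 1 / 2)
       * exp (- (1 / 4) * ((x + y)\<^sup>2 * tanh t + (x - y)\<^sup>2 / tanh t)) \<le> C * laguerre_heat_kernel \<alpha> t x y"
      unfolding M G S_def by (simp only: mult.left_commute)
    have "m * bessel_I \<alpha> z \<le> m * (C * (z powr \<alpha> * (1 + z) powr (- \<alpha> - 1 / 2) * exp z))"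
      using up[OF z] m by (intro mult_left_mono) auto
    then show "laguerre_heat_kernel \<alpha> t x y \<le> C * (sinh (2 * t) powr (- 1 / 2) * (sinh (2 * t) + x * y) powr (- \<alpha> - 1 / 2)
       * exp (- (1 / 4) * ((x + y)\<^sup>2 * tanh t + (x - y)\<^sup>2 / tanh t)))"
      unfolding G mult.left_commute[of m C] M S_def .
  qed (use C in simp)
qed

text \<open>The product \<open>xy\<close> in the kernel is not comparable to \<open>(x + y)\<^sup>2\<close> when one variable is much smaller than the
  other, but then \<open>\<bar>x - y\<bar>\<close> is comparable to \<open>x + y\<close>. Quantitatively, \<open>(x + y)\<^sup>2 = 4xy + (x - y)\<^sup>2\<close> gives
  \<open>t + (x + y)\<^sup>2 \<le> 4 (t + xy) (1 + (x - y)\<^sup>2 / t)\<close>, and a power of the last factor is paid for by a small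
  part of the exponential, whence the different constants in the two exponents.\<close>
lemma heat_kernel_small_time:
  fixes \<alpha> :: real
  assumes "\<alpha> > -1"
  shows "\<exists>C>0. \<forall>t x y. 0 < t \<longrightarrow> t \<le> 1 \<longrightarrow> 0 < x \<longrightarrow> 0 < y \<longrightarrow>
     t powr (- 1 / 2) * (t + (x + y)\<^sup>2) powr (- \<alpha> - 1 / 2) * exp (- ((x + y)\<^sup>2 * t + (x - y)\<^sup>2 / t))
       \<le> C * laguerre_heat_kernel \<alpha> t x y \<and>
     laguerre_heat_kernel \<alpha> t x y
       \<le> C * (t powr (- 1 / 2) * (t + (x + y)\<^sup>2) powr (- \<alpha> - 1 / 2)
              * exp (- (1 / 16) * ((x + y)\<^sup>2 * t + (x - y)\<^sup>2 / t)))"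
proof -
  define \<beta> where "\<beta> = - \<alpha> - 1 / 2"
  obtain C where C: "C > 0" and
    K: "\<And>t x y. t > 0 \<Longrightarrow> x > 0 \<Longrightarrow> y > 0 \<Longrightarrow>
     sinh (2 * t) powr (- 1 / 2) * (sinh (2 * t) + x * y) powr \<beta>
       * exp (- (1 / 4) * ((x + y)\<^sup>2 * tanh t + (x - y)\<^sup>2 / tanh t)) \<le> C * laguerre_heat_kernel \<alpha> t x y"
       "\<And>t x y. t > 0 \<Longrightarrow> x > 0 \<Longrightarrow> y > 0 \<Longrightarrow>
     laguerre_heat_kernel \<alpha> t x y \<le> C * (sinh (2 * t) powr (- 1 / 2) * (sinh (2 * t) + x * y) powr \<beta>
       * exp (- (1 / 4) * ((x + y)\<^sup>2 * tanh t + (x - y)\<^sup>2 / tanh t)))"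
    using heat_kernel_comparable[OF assms] unfolding \<beta>_def by blast
  obtain D where D: "D > 0" "\<And>v. v \<ge> 0 \<Longrightarrow> (1 + v) powr \<bar>\<beta>\<bar> \<le> D * exp (1 / 16 * v)"
    using powr_le_exp[of "1 / 16" "\<bar>\<beta>\<bar>"] by auto
  define k where "k = (8::real) powr (1 / 2) * 8 powr \<bar>\<beta>\<bar> * D"
  have k: "k > 0" using D by (simp add: k_def)
  have main: "t powr (- 1 / 2) * (t + (x + y)\<^sup>2) powr \<beta> * exp (- ((x + y)\<^sup>2 * t + (x - y)\<^sup>2 / t))
       \<le> C * k * laguerre_heat_kernel \<alpha> t x y \<and>
     laguerre_heat_kernel \<alpha> t x y
       \<le> C * k * (t powr (- 1 / 2) * (t + (x + y)\<^sup>2) powr \<beta> * exp (- (1 / 16) * ((x + y)\<^sup>2 * t + (x - y)\<^sup>2 / t)))"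
    if t: "0 < t" "t \<le> 1" and xy: "0 < x" "0 < y" for t x y
  proof -
    define S A B where "S = sinh (2 * t)" and "A = (x + y)\<^sup>2" and "B = (x - y)\<^sup>2"
    have AB: "A = 4 * (x * y) + B" "A > 0" "B \<ge> 0"
      using xy unfolding A_def B_def
      by (simp add: power2_sum power2_diff, simp add: zero_less_power, simp)
    have xy0: "x * y > 0" using xy by simp
    have S: "t \<le> S" "S \<le> 8 * t" "S > 0"
      using sinh_cosh_tanh_bounds[OF t] t by (auto simp: S_def)
    have th: "t / 2 \<le> tanh t" "tanh t \<le> t" "tanh t > 0"
      using sinh_cosh_tanh_bounds[OF t] t by auto
    define Q e where "Q = A * t + B / t" and "e = 1 / 4 * (A * tanh t + B / tanh t)"
    have Q0: "Q \<ge> 0" using AB t by (simp add: Q_def)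
    have eb: "Q / 8 \<le> e" "e \<le> Q / 2"
    proof -
      define a b q where "a = A * tanh t" and "b = B / tanh t" and "q = B / t"
      have "A * (t / 2) \<le> a" unfolding a_def by (rule mult_left_mono) (use AB th in auto)
      moreover have "a \<le> A * t" unfolding a_def by (rule mult_left_mono) (use AB th in auto)
      moreover have "q \<le> b" unfolding b_def q_def by (rule divide_left_mono) (use AB th t in auto)
      moreover have "b \<le> B / (t / 2)" unfolding b_def by (rule divide_left_mono) (use AB th t in auto)
      moreover have "B / (t / 2) = 2 * q" by (simp add: q_def)
      moreover have "0 \<le> q" "0 \<le> A * t" using AB t by (auto simp: q_def)
      moreover have "e = 1 / 4 * (a + b)" by (simp add: e_def a_def b_def)
      ultimately show "Q / 8 \<le> e" "e \<le> Q / 2" unfolding Q_def q_def[symmetric] by auto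
    qed
    define v where "v = B / t"
    have v: "v \<ge> 0" "v \<le> Q" using AB t by (auto simp: v_def Q_def)
    have s1: "S powr (- 1 / 2) \<le> 8 powr (1 / 2) * t powr (- 1 / 2)"
      using powr_comparable[of S t 8 "- 1 / 2"] S t by simp
    have s2: "t powr (- 1 / 2) \<le> 8 powr (1 / 2) * S powr (- 1 / 2)"
      using powr_comparable[of t S 8 "- 1 / 2"] S t by simp
    have c1: "S + x * y \<le> 8 * (1 + v) * (t + A)"
    proof -
      have "S + x * y \<le> 8 * 1 * (t + A)" using S AB xy0 by simp
      also have "\<dots> \<le> 8 * (1 + v) * (t + A)"
        using v AB t by (intro mult_right_mono mult_left_mono) auto
      finally show ?thesis .
    qed
    \<comment> \<open>the step described above, from \<open>A = 4xy + B\<close> and \<open>B = v t\<close>, with the constant of the opposite inequality\<close>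
    have c2: "t + A \<le> 8 * (1 + v) * (S + x * y)"
    proof -
      have "v * t = B" using t by (simp add: v_def)
      moreover have "0 \<le> v * (x * y)" using v xy0 by simp
      ultimately have "t + A \<le> 8 * (1 + v) * (t + x * y)"
      proof -
        have "8 * (1 + v) * (t + x * y) = 8 * t + 8 * (x * y) + 8 * (v * t) + 8 * (v * (x * y))"
          by (simp add: algebra_simps)
        then show ?thesis using AB t xy0 \<open>v * t = B\<close> \<open>0 \<le> v * (x * y)\<close> by linarith
      qed
      also have "\<dots> \<le> 8 * (1 + v) * (S + x * y)"
        using v S by (intro mult_left_mono) auto
      finally show ?thesis .
    qed
    have pe: "(8 * (1 + v)) powr \<bar>\<beta>\<bar> \<le> 8 powr \<bar>\<beta>\<bar> * D * exp (Q / 16)"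
    proof -
      have "(1 + v) powr \<bar>\<beta>\<bar> \<le> (1 + Q) powr \<bar>\<beta>\<bar>" using v by (intro powr_mono2) auto
      also have "\<dots> \<le> D * exp (Q / 16)" using D(2)[OF Q0] by simp
      finally have "8 powr \<bar>\<beta>\<bar> * (1 + v) powr \<bar>\<beta>\<bar> \<le> 8 powr \<bar>\<beta>\<bar> * (D * exp (Q / 16))"
        by (rule mult_left_mono) simp
      then show ?thesis by (simp only: powr_mult mult.assoc)
    qed
    have q1: "(S + x * y) powr \<beta> \<le> 8 powr \<bar>\<beta>\<bar> * D * exp (Q / 16) * (t + A) powr \<beta>"
    proof -
      have "(S + x * y) powr \<beta> \<le> (8 * (1 + v)) powr \<bar>\<beta>\<bar> * (t + A) powr \<beta>"
        by (rule powr_comparable[OF _ _ _ c1 c2]) (use S xy0 t AB v in auto)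
      also have "\<dots> \<le> 8 powr \<bar>\<beta>\<bar> * D * exp (Q / 16) * (t + A) powr \<beta>"
        by (rule mult_right_mono[OF pe]) simp
      finally show ?thesis .
    qed
    have q2: "(t + A) powr \<beta> \<le> 8 powr \<bar>\<beta>\<bar> * D * exp (Q / 16) * (S + x * y) powr \<beta>"
    proof -
      have "(t + A) powr \<beta> \<le> (8 * (1 + v)) powr \<bar>\<beta>\<bar> * (S + x * y) powr \<beta>"
        by (rule powr_comparable[OF _ _ _ c2 c1]) (use S xy0 t AB v in auto)
      also have "\<dots> \<le> 8 powr \<bar>\<beta>\<bar> * D * exp (Q / 16) * (S + x * y) powr \<beta>"
        by (rule mult_right_mono[OF pe]) simp
      finally show ?thesis .
    qed
    have "S powr (- 1 / 2) * (S + x * y) powr \<beta> * exp (- e)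
        \<le> (8 powr (1 / 2) * t powr (- 1 / 2)) * (8 powr \<bar>\<beta>\<bar> * D * exp (Q / 16) * (t + A) powr \<beta>) * exp (- (Q / 8))"
      using eb D by (intro mult_mono s1 q1) auto
    also have "\<dots> = k * (t powr (- 1 / 2) * (t + A) powr \<beta> * (exp (Q / 16) * exp (- (Q / 8))))"
      by (simp add: k_def mult_ac)
    also have "exp (Q / 16) * exp (- (Q / 8)) = exp (- (1 / 16) * Q)"
      by (simp add: exp_add[symmetric])
    finally have u': "S powr (- 1 / 2) * (S + x * y) powr \<beta> * exp (- e)
        \<le> k * (t powr (- 1 / 2) * (t + A) powr \<beta> * exp (- (1 / 16) * Q))" .
    have l: "t powr (- 1 / 2) * (t + A) powr \<beta> * exp (- Q)
        \<le> (8 powr (1 / 2) * S powr (- 1 / 2)) * (8 powr \<bar>\<beta>\<bar> * D * exp (Q / 16) * (S + x * y) powr \<beta>) * exp (- Q)"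
      using D by (intro mult_mono s2 q2) auto
    also have "\<dots> = k * (S powr (- 1 / 2) * (S + x * y) powr \<beta> * (exp (Q / 16) * exp (- Q)))"
      by (simp add: k_def mult_ac)
    also have "\<dots> \<le> k * (S powr (- 1 / 2) * (S + x * y) powr \<beta> * exp (- e))"
      using k eb Q0 by (intro mult_left_mono) (auto simp: exp_add[symmetric])
    finally have l': "t powr (- 1 / 2) * (t + A) powr \<beta> * exp (- Q) \<le> k * (S powr (- 1 / 2) * (S + x * y) powr \<beta> * exp (- e))" .
    have ee: "- (1 / 4) * ((x + y)\<^sup>2 * tanh t + (x - y)\<^sup>2 / tanh t) = - e"
      by (simp add: e_def A_def B_def)
    note KK = K[OF t(1) xy, unfolded ee, folded S_def]
    have "t powr (- 1 / 2) * (t + A) powr \<beta> * exp (- Q) \<le> k * (C * laguerre_heat_kernel \<alpha> t x y)"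
      using l' mult_left_mono[OF KK(1), of k] k by linarith
    moreover have "laguerre_heat_kernel \<alpha> t x y \<le> C * (k * (t powr (- 1 / 2) * (t + A) powr \<beta> * exp (- (1 / 16) * Q)))"
      using KK(2) mult_left_mono[OF u', of C] C by linarith
    ultimately show ?thesis unfolding Q_def A_def B_def by (simp only: mult_ac simp_thms)
  qed
  show ?thesis
    by (intro exI[of _ "C * k"] conjI allI impI)
      (use C k main in \<open>simp_all add: \<beta>_def\<close>)
qed

text \<open>Here \<open>sinh (2t)\<close> is of order \<open>exp (2t)\<close>, and \<open>sinh (2t) + xy\<close> differs from \<open>exp (2t)\<close> by a factor of at most
  \<open>4 (1 + (x + y)\<^sup>2)\<close>, whose powers are absorbed by \<open>exp (-(x + y)\<^sup>2 tanh t / 4)\<close>. The powers of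
  \<open>exp (2t)\<close> multiply to \<open>exp (-2(\<alpha> + 1)t)\<close>, which decays because \<open>\<alpha> > -1\<close>.\<close>
lemma heat_kernel_large_time:
  fixes \<alpha> :: real
  assumes "\<alpha> > -1"
  shows "\<exists>C>0. \<forall>t x y. 1 \<le> t \<longrightarrow> 0 < x \<longrightarrow> 0 < y \<longrightarrow>
     laguerre_heat_kernel \<alpha> t x y \<le> C * (exp (- (2 * (\<alpha> + 1)) * t) * exp (- (1 / 16) * (x + y)\<^sup>2))"
proof -
  define \<beta> where "\<beta> = - \<alpha> - 1 / 2"
  obtain C where C: "C > 0" and
    K: "\<And>t x y. t > 0 \<Longrightarrow> x > 0 \<Longrightarrow> y > 0 \<Longrightarrow>
     laguerre_heat_kernel \<alpha> t x y \<le> C * (sinh (2 * t) powr (- 1 / 2) * (sinh (2 * t) + x * y) powr \<beta>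
       * exp (- (1 / 4) * ((x + y)\<^sup>2 * tanh t + (x - y)\<^sup>2 / tanh t)))"
    using heat_kernel_comparable[OF assms] unfolding \<beta>_def by blast
  obtain D where D: "D > 0" "\<And>v. v \<ge> 0 \<Longrightarrow> (1 + v) powr \<bar>\<beta>\<bar> \<le> D * exp (1 / 16 * v)"
    using powr_le_exp[of "1 / 16" "\<bar>\<beta>\<bar>"] by auto
  define k where "k = (4::real) powr (1 / 2) * 4 powr \<bar>\<beta>\<bar> * D"
  have k: "k > 0" using D by (simp add: k_def)
  have main: "laguerre_heat_kernel \<alpha> t x y \<le> C * k * (exp (- (2 * (\<alpha> + 1)) * t) * exp (- (1 / 16) * (x + y)\<^sup>2))"
    if t: "1 \<le> t" and xy: "0 < x" "0 < y" for t x y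
  proof -
    define S A E where "S = sinh (2 * t)" and "A = (x + y)\<^sup>2" and "E = exp (2 * t)"
    have A: "A \<ge> 0" "x * y \<le> A" using xy by (auto simp: A_def power2_eq_square algebra_simps)
    have xy0: "x * y > 0" using xy by simp
    have "1 + 2 * t \<le> E" unfolding E_def by (rule exp_ge_add_one_self)
    then have E: "E \<ge> 2" "E > 0" using t by linarith+
    define r where "r = 1 / E"
    have "S = (E - r) / 2" by (simp add: S_def E_def r_def sinh_field_def exp_minus inverse_eq_divide)
    moreover have "0 \<le> r" "r \<le> 1" using E by (auto simp: r_def)
    ultimately have S: "E \<le> 4 * S" "S \<le> E" "S > 0" using E by auto
    have th: "1 / 2 \<le> tanh t"
      using sinh_cosh_tanh_bounds(3)[of 1] tanh_real_le_iff[of 1 t] t by linarith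
    have s1: "S powr (- 1 / 2) \<le> 4 powr (1 / 2) * E powr (- 1 / 2)"
      using powr_comparable[of S E 4 "- 1 / 2"] S E by simp
    have c1: "S + x * y \<le> 4 * (1 + A) * E"
    proof -
      have "A * 1 \<le> A * E" using A E by (intro mult_left_mono) auto
      then have "S + x * y \<le> (1 + A) * E" using S A E by (simp add: algebra_simps)
      moreover have "0 \<le> (1 + A) * E" using A E by simp
      ultimately show ?thesis by linarith
    qed
    have c2: "E \<le> 4 * (1 + A) * (S + x * y)"
    proof -
      have "1 * S \<le> (1 + A) * (S + x * y)" using A S xy0 by (intro mult_mono) auto
      then show ?thesis using S by linarith
    qed
    have pe: "(4 * (1 + A)) powr \<bar>\<beta>\<bar> \<le> 4 powr \<bar>\<beta>\<bar> * D * exp (A / 16)"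
    proof -
      have "4 powr \<bar>\<beta>\<bar> * (1 + A) powr \<bar>\<beta>\<bar> \<le> 4 powr \<bar>\<beta>\<bar> * (D * exp (A / 16))"
        using D(2)[OF A(1)] by (intro mult_left_mono) auto
      then show ?thesis by (simp only: powr_mult mult.assoc)
    qed
    have q1: "(S + x * y) powr \<beta> \<le> 4 powr \<bar>\<beta>\<bar> * D * exp (A / 16) * E powr \<beta>"
    proof -
      have "(S + x * y) powr \<beta> \<le> (4 * (1 + A)) powr \<bar>\<beta>\<bar> * E powr \<beta>"
        by (rule powr_comparable[OF _ _ _ c1 c2]) (use S xy0 E A in auto)
      also have "\<dots> \<le> 4 powr \<bar>\<beta>\<bar> * D * exp (A / 16) * E powr \<beta>"
        by (rule mult_right_mono[OF pe]) simp
      finally show ?thesis .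
    qed
    define a b where "a = A * tanh t" and "b = (x - y)\<^sup>2 / tanh t"
    have "A * (1 / 2) \<le> a" unfolding a_def using A th by (intro mult_left_mono) auto
    moreover have "0 \<le> b" unfolding b_def by (rule divide_nonneg_nonneg) (use t in auto)
    ultimately have "- (1 / 4) * (a + b) \<le> - (A / 8)" by simp
    then have "- (1 / 4) * (A * tanh t + (x - y)\<^sup>2 / tanh t) \<le> - (A / 8)" unfolding a_def b_def .
    then have x1: "exp (- (1 / 4) * (A * tanh t + (x - y)\<^sup>2 / tanh t)) \<le> exp (- (A / 8))" by simp
    have "S powr (- 1 / 2) * (S + x * y) powr \<beta> * exp (- (1 / 4) * (A * tanh t + (x - y)\<^sup>2 / tanh t))
        \<le> (4 powr (1 / 2) * E powr (- 1 / 2)) * (4 powr \<bar>\<beta>\<bar> * D * exp (A / 16) * E powr \<beta>) * exp (- (A / 8))"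
      using D by (intro mult_mono s1 q1 x1) auto
    also have "\<dots> = k * ((E powr (- 1 / 2) * E powr \<beta>) * (exp (A / 16) * exp (- (A / 8))))"
      by (simp add: k_def mult_ac)
    also have "E powr (- 1 / 2) * E powr \<beta> = exp (- (2 * (\<alpha> + 1)) * t)"
      by (simp add: E_def exp_powr_real exp_add[symmetric] \<beta>_def algebra_simps)
    also have "exp (A / 16) * exp (- (A / 8)) = exp (- (1 / 16) * A)"
      by (simp add: exp_add[symmetric])
    finally have u: "S powr (- 1 / 2) * (S + x * y) powr \<beta> * exp (- (1 / 4) * (A * tanh t + (x - y)\<^sup>2 / tanh t))
        \<le> k * (exp (- (2 * (\<alpha> + 1)) * t) * exp (- (1 / 16) * A))" .
    have "laguerre_heat_kernel \<alpha> t x y \<le> C * (k * (exp (- (2 * (\<alpha> + 1)) * t) * exp (- (1 / 16) * A)))"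
      using K[of t x y] t xy mult_left_mono[OF u, of C] C unfolding S_def A_def by linarith
    then show ?thesis unfolding A_def by (simp only: mult_ac)
  qed
  show ?thesis
    by (intro exI[of _ "C * k"] conjI allI impI) (use C k main in simp_all)
qed

section \<open>Comparing integrals over sets of times\<close>

lemma set_nn_integral_cmult:
  fixes g :: "real \<Rightarrow> real"
  assumes [measurable]: "g \<in> borel_measurable borel" "X \<in> sets borel" and c: "c \<ge> 0"
  shows "(\<integral>\<^sup>+t\<in>X. ennreal (c * g t) \<partial>lborel) = ennreal c * (\<integral>\<^sup>+t\<in>X. ennreal (g t) \<partial>lborel)"
  using c by (simp add: ennreal_mult' mult.assoc nn_integral_cmult)

lemma set_nn_integral_mono_set:
  fixes f g :: "real \<Rightarrow> real"
  assumes "X \<subseteq> Y" "\<And>t. t \<in> X \<Longrightarrow> f t \<le> g t"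
  shows "(\<integral>\<^sup>+t\<in>X. ennreal (f t) \<partial>lborel) \<le> (\<integral>\<^sup>+t\<in>Y. ennreal (g t) \<partial>lborel)"
  by (rule nn_integral_mono) (use assms in \<open>auto simp: indicator_def intro: ennreal_leI\<close>)

text \<open>Measurability is asked of \<open>g\<close> only: \<open>f\<close> will be the heat kernel times a power of \<open>t\<close>, and pointwise
  bounds for it suffice.\<close>
lemma set_nn_integral_le_cmult:
  fixes f g :: "real \<Rightarrow> real"
  assumes "g \<in> borel_measurable borel" "X \<in> sets borel" "X \<subseteq> Y" "c > 0"
    and le: "\<And>t. t \<in> X \<Longrightarrow> g t \<le> c * f t"
  shows "(\<integral>\<^sup>+t\<in>X. ennreal (g t) \<partial>lborel) \<le> ennreal c * (\<integral>\<^sup>+t\<in>Y. ennreal (f t) \<partial>lborel)"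
proof -
  have "(\<integral>\<^sup>+t\<in>X. ennreal (g t) \<partial>lborel) = (\<integral>\<^sup>+t\<in>X. ennreal (c * (1 / c * g t)) \<partial>lborel)"
    using assms by simp
  also have "\<dots> = ennreal c * (\<integral>\<^sup>+t\<in>X. ennreal (1 / c * g t) \<partial>lborel)"
    using assms by (intro set_nn_integral_cmult) auto
  also have "\<dots> \<le> ennreal c * (\<integral>\<^sup>+t\<in>Y. ennreal (f t) \<partial>lborel)"
    by (intro mult_left_mono set_nn_integral_mono_set) (use assms in \<open>auto simp: field_simps\<close>)
  finally show ?thesis .
qed

text \<open>Again \<open>f\<close> stands for the heat kernel and \<open>X\<close>, \<open>Y\<close>, \<open>Z\<close> for the short, intermediate and long times; they
  may overlap, which allows closed intervals.\<close>
lemma set_nn_integral_le_cover: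
  fixes f g h k :: "real \<Rightarrow> real"
  assumes [measurable]: "g \<in> borel_measurable borel" "h \<in> borel_measurable borel" "k \<in> borel_measurable borel"
    "X \<in> sets borel" "Y \<in> sets borel" "Z \<in> sets borel"
    and sub: "U \<subseteq> X \<union> Y \<union> Z" and c: "a \<ge> 0" "b \<ge> 0" "c \<ge> 0"
    and le: "\<And>t. t \<in> U \<Longrightarrow> t \<in> X \<Longrightarrow> f t \<le> a * g t" "\<And>t. t \<in> U \<Longrightarrow> t \<in> Y \<Longrightarrow> f t \<le> b * h t"
      "\<And>t. t \<in> U \<Longrightarrow> t \<in> Z \<Longrightarrow> f t \<le> c * k t"
  shows "(\<integral>\<^sup>+t\<in>U. ennreal (f t) \<partial>lborel) \<le> ennreal a * (\<integral>\<^sup>+t\<in>X. ennreal (g t) \<partial>lborel)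
     + ennreal b * (\<integral>\<^sup>+t\<in>Y. ennreal (h t) \<partial>lborel) + ennreal c * (\<integral>\<^sup>+t\<in>Z. ennreal (k t) \<partial>lborel)"
proof -
  have "(\<integral>\<^sup>+t\<in>U. ennreal (f t) \<partial>lborel) \<le> (\<integral>\<^sup>+t. (ennreal (a * g t) * indicator X t
      + ennreal (b * h t) * indicator Y t) + ennreal (c * k t) * indicator Z t \<partial>lborel)"
  proof (rule nn_integral_mono)
    fix t :: real
    show "ennreal (f t) * indicator U t \<le> (ennreal (a * g t) * indicator X t
      + ennreal (b * h t) * indicator Y t) + ennreal (c * k t) * indicator Z t"
    proof (cases "t \<in> U")
      case True
      then consider "t \<in> X" | "t \<in> Y" | "t \<in> Z" using sub by auto
      then show ?thesis
      proof cases
        case 1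
        then have "ennreal (f t) \<le> ennreal (a * g t) * indicator X t"
          using le(1)[of t] True by (simp add: ennreal_leI)
        then show ?thesis using True by (simp add: add_increasing2)
      next
        case 2
        then have "ennreal (f t) \<le> ennreal (b * h t) * indicator Y t"
          using le(2)[of t] True by (simp add: ennreal_leI)
        then show ?thesis using True by (simp add: add_increasing add_increasing2)
      next
        case 3
        then have "ennreal (f t) \<le> ennreal (c * k t) * indicator Z t"
          using le(3)[of t] True by (simp add: ennreal_leI)
        then show ?thesis using True by (simp add: add_increasing)
      qed
    qed simp
  qed
  also have "\<dots> = (\<integral>\<^sup>+t\<in>X. ennreal (a * g t) \<partial>lborel) + (\<integral>\<^sup>+t\<in>Y. ennreal (b * h t) \<partial>lborel)
     + (\<integral>\<^sup>+t\<in>Z. ennreal (c * k t) \<partial>lborel)"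
    by (simp add: nn_integral_add)
  finally show ?thesis using c by (simp add: set_nn_integral_cmult)
qed

lemma set_nn_integral_ge_const:
  fixes f :: "real \<Rightarrow> real"
  assumes "{l..u} \<subseteq> X" "l \<le> u" "m \<ge> 0" "\<And>t. t \<in> {l..u} \<Longrightarrow> m \<le> f t"
  shows "ennreal (m * (u - l)) \<le> (\<integral>\<^sup>+t\<in>X. ennreal (f t) \<partial>lborel)"
proof -
  have "ennreal (m * (u - l)) = (\<integral>\<^sup>+t\<in>{l..u}. ennreal m \<partial>lborel)"
    using assms by (simp add: nn_integral_cmult_indicator ennreal_mult')
  also have "\<dots> \<le> (\<integral>\<^sup>+t\<in>X. ennreal (f t) \<partial>lborel)"
    by (rule set_nn_integral_mono_set) (use assms in auto)
  finally show ?thesis .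
qed

lemma set_nn_integral_has_integral:
  fixes f :: "real \<Rightarrow> real"
  assumes "\<And>x. x \<in> X \<Longrightarrow> 0 \<le> f x" "(f has_integral I) X"
  shows "(\<integral>\<^sup>+t\<in>X. ennreal (f t) \<partial>lborel) = ennreal I"
proof -
  have "(\<integral>\<^sup>+t\<in>X. ennreal (f t) \<partial>lborel) = (\<integral>\<^sup>+t. ennreal (indicator X t * f t) \<partial>lborel)"
    by (intro nn_integral_cong) (auto simp: indicator_def)
  then show ?thesis using nn_integral_has_integral_lebesgue[OF assms] by simp
qed

lemma set_nn_integral_powr_from_0:
  fixes p b :: real
  assumes "p > -1" "b \<ge> 0"
  shows "(\<integral>\<^sup>+t\<in>{0<..b}. ennreal (t powr p) \<partial>lborel) \<le> ennreal (b powr (p + 1) / (p + 1))"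
  unfolding set_nn_integral_has_integral[OF _ has_integral_powr_from_0[OF assms], simplified, symmetric]
  by (rule set_nn_integral_mono_set) auto

lemma set_nn_integral_powr_to_inf:
  fixes p a :: real
  assumes "p < -1" "a > 0"
  shows "(\<integral>\<^sup>+t\<in>{a..b}. ennreal (t powr p) \<partial>lborel) \<le> ennreal (a powr (p + 1) / (- p - 1))"
proof -
  have "(\<integral>\<^sup>+t\<in>{a..}. ennreal (t powr p) \<partial>lborel) = ennreal (- (a powr (p + 1)) / (p + 1))"
    by (rule set_nn_integral_has_integral[OF _ has_integral_powr_to_inf[OF assms]]) simp
  also have "- (a powr (p + 1)) / (p + 1) = a powr (p + 1) / (- p - 1)"
    by (simp add: divide_simps algebra_simps)
  finally have "(\<integral>\<^sup>+t\<in>{a..}. ennreal (t powr p) \<partial>lborel) = ennreal (a powr (p + 1) / (- p - 1))" .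
  moreover have "(\<integral>\<^sup>+t\<in>{a..b}. ennreal (t powr p) \<partial>lborel) \<le> (\<integral>\<^sup>+t\<in>{a..}. ennreal (t powr p) \<partial>lborel)"
    by (rule set_nn_integral_mono_set) auto
  ultimately show ?thesis by simp
qed

lemma set_nn_integral_powr_minus_one:
  fixes a b :: real
  assumes "0 < a" "a \<le> b"
  shows "(\<integral>\<^sup>+t\<in>{a..b}. ennreal (t powr (- 1)) \<partial>lborel) = ennreal (ln (b / a))"
proof -
  have "((\<lambda>t. t powr (- 1)) has_integral (ln b - ln a)) {a..b}"
  proof (rule fundamental_theorem_of_calculus)
    fix t assume "t \<in> {a..b}"
    then show "(ln has_vector_derivative t powr (- 1)) (at t within {a..b})"
      using assms by (auto intro!: derivative_eq_intros simp: has_real_derivative_iff_has_vector_derivative[symmetric] powr_minus_divide)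
  qed (use assms in auto)
  then have "(\<integral>\<^sup>+t\<in>{a..b}. ennreal (t powr (- 1)) \<partial>lborel) = ennreal (ln b - ln a)"
    by (intro set_nn_integral_has_integral) auto
  then show ?thesis using assms by (simp add: ln_div)
qed

lemma set_nn_integral_powr_exp_finite:
  fixes p \<delta> :: real
  assumes "\<delta> > 0"
  shows "\<exists>C>0. (\<integral>\<^sup>+t\<in>{1..}. ennreal (t powr p * exp (- \<delta> * t)) \<partial>lborel) \<le> ennreal C"
proof -
  obtain D where D: "D > 0" "\<And>v. v \<ge> 0 \<Longrightarrow> (1 + v) powr \<bar>p\<bar> \<le> D * exp (\<delta> / 2 * v)"
    using powr_le_exp[of "\<delta> / 2" "\<bar>p\<bar>"] assms by auto
  have "(\<integral>\<^sup>+t\<in>{1..}. ennreal (t powr p * exp (- \<delta> * t)) \<partial>lborel) \<le> (\<integral>\<^sup>+t\<in>{1..}. ennreal (D * exp (- (\<delta> / 2) * t)) \<partial>lborel)"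
  proof (rule set_nn_integral_mono_set)
    fix t :: real assume t: "t \<in> {1..}"
    have "t powr p \<le> t powr \<bar>p\<bar>" using t by (intro powr_mono) auto
    also have "\<dots> \<le> (1 + t) powr \<bar>p\<bar>" using t by (intro powr_mono2) auto
    also have "\<dots> \<le> D * exp (\<delta> / 2 * t)" using D(2)[of t] t by simp
    finally have "t powr p * exp (- \<delta> * t) \<le> D * exp (\<delta> / 2 * t) * exp (- \<delta> * t)"
      by (rule mult_right_mono) simp
    also have "\<dots> = D * exp (- (\<delta> / 2) * t)" by (simp add: mult.assoc exp_add[symmetric])
    finally show "t powr p * exp (- \<delta> * t) \<le> D * exp (- (\<delta> / 2) * t)" .
  qed simp
  also have "\<dots> = ennreal (D * (exp (- (\<delta> / 2) * 1) / (\<delta> / 2)))"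
    by (rule set_nn_integral_has_integral, use D assms in simp)
      (intro has_integral_mult_right has_integral_exp_minus_to_infinity, use assms in simp)
  finally show ?thesis
    by (intro exI[of _ "D * (exp (- (\<delta> / 2) * 1) / (\<delta> / 2))"]) (use D assms in simp)
qed

section \<open>The scale-invariant integral behind the three regimes\<close>

text \<open>The three regimes of the theorem in a dimensionless variable: \<open>r\<close> will be
  \<open>\<bar>x - y\<bar> / (x + y)\<close> if \<open>x + y \<le> 1\<close> and \<open>\<bar>x - y\<bar> (x + y)\<close> if \<open>x + y > 1\<close>. The values at \<open>0\<close> are
  the limits.\<close>
definition profile :: "real \<Rightarrow> real \<Rightarrow> ennreal" where
  "profile \<sigma> r =
     (if \<sigma> < 1 / 2 then (if r = 0 then \<infinity> else ennreal (r powr (2 * \<sigma> - 1)))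
      else if \<sigma> = 1 / 2 then (if r = 0 then \<infinity> else ennreal (1 + max 0 (ln (1 / r))))
      else 1)"

text \<open>The endpoint is \<open>a\<^sup>2\<close> so that \<open>a\<close> and \<open>d\<close> scale alike: substituting \<open>t = a\<^sup>2 s\<close> shows that the value is
  \<open>a powr (2\<sigma> - 1)\<close> times a function of \<open>d / a\<close>.\<close>
definition gauss_power_integral :: "real \<Rightarrow> real \<Rightarrow> real \<Rightarrow> real \<Rightarrow> ennreal" where
  "gauss_power_integral c \<sigma> a d =
     (\<integral>\<^sup>+t\<in>{0<..a\<^sup>2}. ennreal (t powr (\<sigma> - 3 / 2) * exp (- c * (d\<^sup>2 / t))) \<partial>lborel)"

lemma power2_powr: "a > 0 \<Longrightarrow> (a\<^sup>2) powr p = a powr (2 * p)" for a p :: real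
  by (simp add: powr_powr flip: powr_numeral)

lemma exp_minus_le_inverse: "u > 0 \<Longrightarrow> exp (- u) \<le> 1 / u" for u :: real
proof -
  assume u: "u > 0"
  have "u \<le> exp u" using exp_ge_add_one_self[of u] by linarith
  then have "1 / exp u \<le> 1 / u" using u by (intro divide_left_mono) auto
  then show ?thesis by (simp add: exp_minus inverse_eq_divide)
qed

lemma profile_ge_1:
  assumes "0 \<le> r" "r \<le> 1"
  shows "1 \<le> profile \<sigma> r"
proof -
  have "1 \<le> r powr (2 * \<sigma> - 1)" if "\<sigma> < 1 / 2" "r \<noteq> 0"
    using powr_mono2'[of "2 * \<sigma> - 1" r 1] assms that by simp
  then show ?thesis by (auto simp: profile_def)
qed

text \<open>A crude bound that is uniform in \<open>\<sigma> > 0\<close>; exponentials absorb what it loses.\<close>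
lemma profile_ge_inverse:
  assumes "\<sigma> > 0" "r \<ge> 0"
  shows "ennreal (1 / max 1 r) \<le> profile \<sigma> r"
proof (cases "r \<le> 1")
  case True
  then show ?thesis using profile_ge_1[of r \<sigma>] assms by (simp add: max_absorb1)
next
  case False
  have "1 / r \<le> 1" using False by simp
  moreover have "1 / r \<le> r powr (2 * \<sigma> - 1)"
    using powr_mono[of "- 1" "2 * \<sigma> - 1" r] assms False by (simp add: powr_minus_divide)
  moreover have "1 / r \<le> 1 + max 0 (ln (1 / r))" using \<open>1 / r \<le> 1\<close> by linarith
  ultimately show ?thesis using False assms
    by (auto simp: profile_def max_def intro!: ennreal_leI)
qed

text \<open>For \<open>\<sigma> > 1/2\<close> the power of \<open>t\<close> is integrable at \<open>0\<close> and the exponential may be dropped. For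
  \<open>\<sigma> \<le> 1/2\<close> it matters below \<open>e\<^sup>2\<close> with \<open>e = min a d\<close>: there \<open>exp (-u) \<le> 1/u\<close> adds one power of \<open>t\<close> and
  restores integrability, and above \<open>e\<^sup>2\<close> the power alone is integrated.\<close>
lemma gauss_power_integral_upper:
  fixes c \<sigma> :: real
  assumes "c > 0" "\<sigma> > 0"
  shows "\<exists>C>0. \<forall>a>0. \<forall>d\<ge>0. gauss_power_integral c \<sigma> a d
           \<le> ennreal (C * a powr (2 * \<sigma> - 1)) * profile \<sigma> (min 1 (d / a))"
proof (cases "\<sigma> > 1 / 2")
  case True
  show ?thesis
  proof (intro exI[of _ "1 / (\<sigma> - 1 / 2)"] conjI allI impI)
    fix a d :: real assume a: "a > 0" and d: "d \<ge> 0"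
    have "gauss_power_integral c \<sigma> a d \<le> (\<integral>\<^sup>+t\<in>{0<..a\<^sup>2}. ennreal (t powr (\<sigma> - 3 / 2)) \<partial>lborel)"
      unfolding gauss_power_integral_def
    proof (rule set_nn_integral_mono_set)
      fix t assume t: "t \<in> {0<..a\<^sup>2}"
      then have "exp (- c * (d\<^sup>2 / t)) \<le> 1" using assms by simp
      then show "t powr (\<sigma> - 3 / 2) * exp (- c * (d\<^sup>2 / t)) \<le> t powr (\<sigma> - 3 / 2)"
        by (rule mult_left_le) simp
    qed simp
    also have "\<dots> \<le> ennreal ((a\<^sup>2) powr (\<sigma> - 3 / 2 + 1) / (\<sigma> - 3 / 2 + 1))"
      by (rule set_nn_integral_powr_from_0) (use True in auto)
    also have "(a\<^sup>2) powr (\<sigma> - 3 / 2 + 1) / (\<sigma> - 3 / 2 + 1) = 1 / (\<sigma> - 1 / 2) * a powr (2 * \<sigma> - 1)"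
      using a by (simp add: power2_powr algebra_simps)
    finally show "gauss_power_integral c \<sigma> a d \<le> ennreal (1 / (\<sigma> - 1 / 2) * a powr (2 * \<sigma> - 1)) * profile \<sigma> (min 1 (d / a))"
      using True by (simp add: profile_def)
  qed (use True in simp)
next
  case False
  define C where "C = 1 / (c * (\<sigma> + 1 / 2)) + (if \<sigma> = 1 / 2 then 2 else 1 / (1 / 2 - \<sigma>))"
  have C: "C > 0" using assms False by (auto simp: C_def intro!: add_pos_pos)
  show ?thesis
  proof (intro exI[of _ C] conjI allI impI C)
    fix a d :: real assume a: "a > 0" and d: "d \<ge> 0"
    show "gauss_power_integral c \<sigma> a d \<le> ennreal (C * a powr (2 * \<sigma> - 1)) * profile \<sigma> (min 1 (d / a))"
    proof (cases "d = 0")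
      case True
      then show ?thesis using False a C by (auto simp: profile_def ennreal_mult_top ennreal_mult_eq_top_iff top_unique)
    next
      case d0: False
      \<comment> \<open>using \<open>e\<close> in place of \<open>d\<close> covers \<open>d > a\<close> as well, where the second interval is a point\<close>
      define e where "e = min a d"
      define r where "r = min 1 (d / a)"
      have e: "e > 0" "e \<le> a" "e \<le> d" using a d d0 by (auto simp: e_def)
      have er: "e = a * r" using a by (auto simp: e_def r_def min_def field_simps)
      have r: "r > 0" "r \<le> 1" using a d d0 by (auto simp: r_def)
      have "gauss_power_integral c \<sigma> a d \<le> ennreal (1 / (c * e\<^sup>2)) * (\<integral>\<^sup>+t\<in>{0<..e\<^sup>2}. ennreal (t powr (\<sigma> - 1 / 2)) \<partial>lborel)
         + ennreal 1 * (\<integral>\<^sup>+t\<in>{e\<^sup>2..a\<^sup>2}. ennreal (t powr (\<sigma> - 3 / 2)) \<partial>lborel)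
         + ennreal 0 * (\<integral>\<^sup>+t\<in>({}::real set). ennreal 0 \<partial>lborel)"
        unfolding gauss_power_integral_def
      proof (rule set_nn_integral_le_cover)
        fix t assume "t \<in> {0<..a\<^sup>2}"
        then have t: "t > 0" by simp
        have ed: "e\<^sup>2 \<le> d\<^sup>2" using e by (intro power_mono) auto
        {
          have u: "c * e\<^sup>2 / t > 0" using assms e t by simp
          have "c * e\<^sup>2 / t \<le> c * (d\<^sup>2 / t)"
            using ed t assms by (simp add: divide_right_mono)
          then have "exp (- c * (d\<^sup>2 / t)) \<le> exp (- (c * e\<^sup>2 / t))" by simp
          also have "\<dots> \<le> 1 / (c * e\<^sup>2 / t)" by (rule exp_minus_le_inverse[OF u])
          also have "\<dots> = 1 / (c * e\<^sup>2) * t" by simp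
          finally have "t powr (\<sigma> - 3 / 2) * exp (- c * (d\<^sup>2 / t)) \<le> t powr (\<sigma> - 3 / 2) * (1 / (c * e\<^sup>2) * t)"
            by (rule mult_left_mono) simp
          also have "\<dots> = 1 / (c * e\<^sup>2) * (t powr (\<sigma> - 3 / 2) * t powr 1)" using t by simp
          also have "t powr (\<sigma> - 3 / 2) * t powr 1 = t powr (\<sigma> - 1 / 2)"
            by (simp only: powr_add[symmetric]) simp
          finally show "t powr (\<sigma> - 3 / 2) * exp (- c * (d\<^sup>2 / t)) \<le> 1 / (c * e\<^sup>2) * t powr (\<sigma> - 1 / 2)" .
        }
        have "exp (- c * (d\<^sup>2 / t)) \<le> 1" using assms t by simp
        then have "t powr (\<sigma> - 3 / 2) * exp (- c * (d\<^sup>2 / t)) \<le> t powr (\<sigma> - 3 / 2)"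
          by (rule mult_left_le) simp
        then show "t powr (\<sigma> - 3 / 2) * exp (- c * (d\<^sup>2 / t)) \<le> 1 * t powr (\<sigma> - 3 / 2)" by simp
      qed (use assms e in auto)
      also have "\<dots> \<le> ennreal (1 / (c * e\<^sup>2)) * ennreal ((e\<^sup>2) powr (\<sigma> - 1 / 2 + 1) / (\<sigma> - 1 / 2 + 1))
         + (\<integral>\<^sup>+t\<in>{e\<^sup>2..a\<^sup>2}. ennreal (t powr (\<sigma> - 3 / 2)) \<partial>lborel)"
        unfolding ennreal_1 mult_1_left ennreal_0 mult_zero_left add_0_right
        by (intro add_right_mono mult_left_mono set_nn_integral_powr_from_0) (use assms in auto)
      also have "ennreal (1 / (c * e\<^sup>2)) * ennreal ((e\<^sup>2) powr (\<sigma> - 1 / 2 + 1) / (\<sigma> - 1 / 2 + 1))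
          = ennreal (e powr (2 * \<sigma> - 1) / (c * (\<sigma> + 1 / 2)))"
      proof -
        have "(e\<^sup>2) powr (\<sigma> - 1 / 2 + 1) = e powr (2 * \<sigma> - 1) * e\<^sup>2"
          using e powr_add[of e "2 * \<sigma> - 1" 2] by (simp add: power2_powr algebra_simps)
        then have "1 / (c * e\<^sup>2) * ((e\<^sup>2) powr (\<sigma> - 1 / 2 + 1) / (\<sigma> - 1 / 2 + 1)) = e powr (2 * \<sigma> - 1) / (c * (\<sigma> + 1 / 2))"
          using e assms by (simp add: algebra_simps)
        then show ?thesis using assms e by (subst ennreal_mult'[symmetric]) auto
      qed
      also have "\<dots> + (\<integral>\<^sup>+t\<in>{e\<^sup>2..a\<^sup>2}. ennreal (t powr (\<sigma> - 3 / 2)) \<partial>lborel)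
          \<le> ennreal (C * a powr (2 * \<sigma> - 1)) * profile \<sigma> r"
      proof (cases "\<sigma> = 1 / 2")
        case True
        have sp: "\<sigma> - 3 / 2 = - 1" using True by simp
        have ea: "e\<^sup>2 \<le> a\<^sup>2" using e by (intro power_mono) auto
        have "(\<integral>\<^sup>+t\<in>{e\<^sup>2..a\<^sup>2}. ennreal (t powr (\<sigma> - 3 / 2)) \<partial>lborel) = ennreal (ln (a\<^sup>2 / e\<^sup>2))"
          unfolding sp by (rule set_nn_integral_powr_minus_one) (use e ea in auto)
        also have "a\<^sup>2 / e\<^sup>2 = (1 / r) ^ 2" using a r by (simp add: er power_mult_distrib power_one_over)
        also have "ln ((1 / r) ^ 2) = 2 * ln (1 / r)" using r by (subst ln_realpow) auto
        finally have I: "(\<integral>\<^sup>+t\<in>{e\<^sup>2..a\<^sup>2}. ennreal (t powr (\<sigma> - 3 / 2)) \<partial>lborel) = ennreal (2 * ln (1 / r))" .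
        have l: "0 \<le> ln (1 / r)" using r by (intro ln_ge_zero) simp
        have "ennreal (1 / c) + ennreal (2 * ln (1 / r)) = ennreal (1 / c + 2 * ln (1 / r))"
          using assms l by (intro ennreal_plus[symmetric]) auto
        also have "\<dots> \<le> ennreal (C * (1 + max 0 (ln (1 / r))))"
        proof (rule ennreal_leI)
          have "0 \<le> 1 / c * ln (1 / r)" using l assms by (intro mult_nonneg_nonneg) auto
          moreover have "C = 1 / c + 2" by (simp add: C_def True)
          ultimately show "1 / c + 2 * ln (1 / r) \<le> C * (1 + max 0 (ln (1 / r)))"
            using l by (simp add: algebra_simps del: ln_div)
        qed
        also have "\<dots> = ennreal (C * a powr (2 * \<sigma> - 1)) * profile \<sigma> r"
          using r a C by (simp add: profile_def True ennreal_mult' del: ennreal_plus)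
        also have "1 / c = e powr (2 * \<sigma> - 1) / (c * (\<sigma> + 1 / 2))"
          using True e by (simp add: True)
        finally show ?thesis unfolding I .
      next
        case neq: False
        then have s: "\<sigma> < 1 / 2" using False by simp
        have "(\<integral>\<^sup>+t\<in>{e\<^sup>2..a\<^sup>2}. ennreal (t powr (\<sigma> - 3 / 2)) \<partial>lborel) \<le> ennreal ((e\<^sup>2) powr (\<sigma> - 3 / 2 + 1) / (- (\<sigma> - 3 / 2) - 1))"
          by (rule set_nn_integral_powr_to_inf) (use s e in auto)
        also have "(e\<^sup>2) powr (\<sigma> - 3 / 2 + 1) / (- (\<sigma> - 3 / 2) - 1) = e powr (2 * \<sigma> - 1) / (1 / 2 - \<sigma>)"
          using e by (simp add: power2_powr algebra_simps)
        finally have "ennreal (e powr (2 * \<sigma> - 1) / (c * (\<sigma> + 1 / 2))) + (\<integral>\<^sup>+t\<in>{e\<^sup>2..a\<^sup>2}. ennreal (t powr (\<sigma> - 3 / 2)) \<partial>lborel)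
           \<le> ennreal (e powr (2 * \<sigma> - 1) / (c * (\<sigma> + 1 / 2))) + ennreal (e powr (2 * \<sigma> - 1) / (1 / 2 - \<sigma>))"
          by (rule add_left_mono)
        also have "\<dots> = ennreal (C * e powr (2 * \<sigma> - 1))"
          using assms s by (subst ennreal_plus[symmetric]) (auto simp: C_def distrib_right)
        also have "\<dots> = ennreal (C * a powr (2 * \<sigma> - 1)) * profile \<sigma> r"
          using s r a C by (simp add: profile_def ennreal_mult'[symmetric] er powr_mult mult.assoc)
        finally show ?thesis .
      qed
      finally show ?thesis unfolding r_def .
    qed
  qed
qed

lemma gauss_power_integral_antimono:
  assumes "c > 0" "0 \<le> d" "d \<le> d'"
  shows "gauss_power_integral c \<sigma> a d' \<le> gauss_power_integral c \<sigma> a d"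
  unfolding gauss_power_integral_def
proof (rule set_nn_integral_mono_set)
  fix t assume "t \<in> {0<..a\<^sup>2}"
  then have "d\<^sup>2 / t \<le> d'\<^sup>2 / t" using assms by (intro divide_right_mono power_mono) auto
  then have "c * (d\<^sup>2 / t) \<le> c * (d'\<^sup>2 / t)" by (rule mult_left_mono) (use assms in simp)
  then show "t powr (\<sigma> - 3 / 2) * exp (- c * (d'\<^sup>2 / t)) \<le> t powr (\<sigma> - 3 / 2) * exp (- c * (d\<^sup>2 / t))"
    by (intro mult_left_mono) auto
qed simp

lemma powr_half_interval:
  fixes u t p :: real
  assumes "u > 0" "u / 2 \<le> t" "t \<le> u"
  shows "2 powr (- \<bar>p\<bar>) * u powr p \<le> t powr p"
proof -
  have "u powr p \<le> 2 powr \<bar>p\<bar> * t powr p"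
    by (rule powr_comparable) (use assms in auto)
  then have "2 powr (- \<bar>p\<bar>) * u powr p \<le> 2 powr (- \<bar>p\<bar>) * (2 powr \<bar>p\<bar> * t powr p)"
    by (rule mult_left_mono) simp
  also have "\<dots> = t powr p" by (simp add: powr_minus)
  finally show ?thesis .
qed

text \<open>Where \<open>t \<ge> d\<^sup>2 / 2\<close> the exponential is at least \<open>exp (-2c)\<close>. The dyadic block at \<open>d\<^sup>2\<close> suffices if
  \<open>\<sigma> < 1/2\<close>, the one at \<open>a\<^sup>2\<close> if \<open>\<sigma> > 1/2\<close>, and all the blocks between them, which count equally and
  produce the logarithm, are needed if \<open>\<sigma> = 1/2\<close>. Starting at \<open>d\<^sup>2 / 2\<close> rather than \<open>d\<^sup>2\<close> keeps the interval from
  degenerating at \<open>d = a\<close>.\<close>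
lemma gauss_power_integral_lower_pos:
  fixes c \<sigma> :: real
  assumes "c > 0" "\<sigma> > 0"
  shows "\<exists>C>0. \<forall>a>0. \<forall>d. 0 \<le> d \<longrightarrow> d \<le> a \<longrightarrow> d > 0 \<or> \<sigma> > 1 / 2 \<longrightarrow>
           ennreal (a powr (2 * \<sigma> - 1)) * profile \<sigma> (d / a) \<le> ennreal C * gauss_power_integral c \<sigma> a d"
proof -
  define p where "p = \<sigma> - 3 / 2"
  define m where "m = 2 powr (- \<bar>p\<bar>) * exp (- 2 * c)"
  have m: "m > 0" by (simp add: m_def)
  have low: "m * u powr p \<le> t powr p * exp (- c * (d\<^sup>2 / t))"
    if "u > 0" "d\<^sup>2 \<le> u" "u / 2 \<le> t" "t \<le> u" for u t d :: real
  proof -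
    have t: "t > 0" using that by simp
    have "d\<^sup>2 / t \<le> 2" using that t by (simp add: divide_le_eq)
    then have "c * (d\<^sup>2 / t) \<le> c * 2" by (rule mult_left_mono) (use assms in simp)
    then have "exp (- 2 * c) \<le> exp (- c * (d\<^sup>2 / t))" by simp
    moreover have "2 powr (- \<bar>p\<bar>) * u powr p \<le> t powr p"
      by (rule powr_half_interval) (use that in auto)
    ultimately have "(2 powr (- \<bar>p\<bar>) * u powr p) * exp (- 2 * c) \<le> t powr p * exp (- c * (d\<^sup>2 / t))"
      by (intro mult_mono) auto
    then show ?thesis by (simp add: m_def mult_ac)
  qed
  have block: "ennreal (m / 2 * b powr (2 * \<sigma> - 1)) \<le> gauss_power_integral c \<sigma> a d"
    if "0 < b" "b \<le> a" "0 \<le> d" "d \<le> b" for a b d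
  proof -
    have bb: "b\<^sup>2 \<le> a\<^sup>2" "d\<^sup>2 \<le> b\<^sup>2" using that by (auto intro!: power_mono)
    have "(b\<^sup>2) powr p * b\<^sup>2 = b powr (2 * \<sigma> - 1)"
      using that powr_add[of b "2 * p" 2] by (simp add: power2_powr p_def algebra_simps)
    then have "m / 2 * b powr (2 * \<sigma> - 1) = m * (b\<^sup>2) powr p * (b\<^sup>2 - b\<^sup>2 / 2)" by (simp add: field_simps)
    also have "ennreal \<dots> \<le> gauss_power_integral c \<sigma> a d"
      unfolding gauss_power_integral_def p_def[symmetric]
    proof (rule set_nn_integral_ge_const)
      show "{b\<^sup>2 / 2..b\<^sup>2} \<subseteq> {0<..a\<^sup>2}" 
      proof
        fix t assume "t \<in> {b\<^sup>2 / 2..b\<^sup>2}"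
        moreover have "0 < b\<^sup>2 / 2" using that by simp
        ultimately show "t \<in> {0<..a\<^sup>2}" using bb by (simp only: atLeastAtMost_iff greaterThanAtMost_iff) linarith
      qed
      show "m * (b\<^sup>2) powr p \<le> t powr p * exp (- c * (d\<^sup>2 / t))" if t: "t \<in> {b\<^sup>2 / 2..b\<^sup>2}" for t
        by (rule low) (use t bb \<open>0 < b\<close> in auto)
    qed (use m in auto)
    finally show ?thesis .
  qed
  consider "\<sigma> < 1 / 2" | "\<sigma> = 1 / 2" | "\<sigma> > 1 / 2" by linarith
  then show ?thesis
  proof cases
    case 1
    show ?thesis
    proof (intro exI[of _ "2 / m"] conjI allI impI)
      fix a d :: real assume a: "a > 0" and d: "0 \<le> d" "d \<le> a" "d > 0 \<or> \<sigma> > 1 / 2"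
      then have d0: "d > 0" using 1 by simp
      have "ennreal (a powr (2 * \<sigma> - 1)) * profile \<sigma> (d / a) = ennreal (a powr (2 * \<sigma> - 1) * (d / a) powr (2 * \<sigma> - 1))"
        using 1 a d0 by (simp add: profile_def ennreal_mult')
      also have "a powr (2 * \<sigma> - 1) * (d / a) powr (2 * \<sigma> - 1) = 2 / m * (m / 2 * d powr (2 * \<sigma> - 1))"
        using a d0 m by (simp add: powr_divide)
      also have "ennreal \<dots> = ennreal (2 / m) * ennreal (m / 2 * d powr (2 * \<sigma> - 1))"
        using m by (intro ennreal_mult') auto
      also have "\<dots> \<le> ennreal (2 / m) * gauss_power_integral c \<sigma> a d"
        by (intro mult_left_mono block) (use a d d0 in auto)
      finally show "ennreal (a powr (2 * \<sigma> - 1)) * profile \<sigma> (d / a) \<le> ennreal (2 / m) * gauss_power_integral c \<sigma> a d" .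
    qed (use m in auto)
  next
    case 3
    show ?thesis
    proof (intro exI[of _ "2 / m"] conjI allI impI)
      fix a d :: real assume a: "a > 0" and d: "0 \<le> d" "d \<le> a" "d > 0 \<or> \<sigma> > 1 / 2"
      have "ennreal (a powr (2 * \<sigma> - 1)) * profile \<sigma> (d / a) = ennreal (2 / m * (m / 2 * a powr (2 * \<sigma> - 1)))"
        using 3 m by (simp add: profile_def)
      also have "\<dots> = ennreal (2 / m) * ennreal (m / 2 * a powr (2 * \<sigma> - 1))"
        using m by (intro ennreal_mult') auto
      also have "\<dots> \<le> ennreal (2 / m) * gauss_power_integral c \<sigma> a d"
        by (intro mult_left_mono block) (use a d in auto)
      finally show "ennreal (a powr (2 * \<sigma> - 1)) * profile \<sigma> (d / a) \<le> ennreal (2 / m) * gauss_power_integral c \<sigma> a d" .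
    qed (use m in auto)
  next
    case 2
    define C where "C = exp (2 * c) / ln 2"
    have C: "C > 0" by (simp add: C_def)
    show ?thesis
    proof (intro exI[of _ C] conjI allI impI C)
      fix a d :: real assume a: "a > 0" and d: "0 \<le> d" "d \<le> a" "d > 0 \<or> \<sigma> > 1 / 2"
      then have d0: "d > 0" using 2 by simp
      have "d\<^sup>2 \<le> a\<^sup>2" using d by (intro power_mono) auto
      then have dd: "0 < d\<^sup>2 / 2" "d\<^sup>2 / 2 \<le> a\<^sup>2"
        using d0 zero_le_power2[of d] by (simp, linarith)
      define l where "l = ln (a / d)"
      have l: "l \<ge> 0" using d d0 by (simp add: l_def)
      have "a\<^sup>2 / (d\<^sup>2 / 2) = 2 * (a / d) ^ 2" by (simp add: power_divide)
      then have "ln (a\<^sup>2 / (d\<^sup>2 / 2)) = ln 2 + ln ((a / d) ^ 2)"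
        using a d0 by (simp only:) (rule ln_mult_pos, auto)
      also have "ln ((a / d) ^ 2) = 2 * l" unfolding l_def using a d0 by (subst ln_realpow) auto
      finally have L: "ln (a\<^sup>2 / (d\<^sup>2 / 2)) = ln 2 + 2 * l" .
      have l2: "(0::real) < ln 2" "ln 2 \<le> (1::real)" using ln_2_less_1 by auto
      have "ln 2 * (1 + l) \<le> ln 2 + 2 * l"
        using l l2 mult_right_mono[of "ln 2" 2 l] by (simp add: algebra_simps)
      then have "1 + l \<le> (1 / ln 2) * (ln 2 + 2 * l)" using l2 by (simp add: field_simps)
      then have "ennreal (1 + l) \<le> ennreal ((1 / ln 2) * (ln 2 + 2 * l))" by (rule ennreal_leI)
      also have "\<dots> = ennreal (1 / ln 2) * (\<integral>\<^sup>+t\<in>{d\<^sup>2 / 2..a\<^sup>2}. ennreal (t powr (- 1)) \<partial>lborel)"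
        using l2 l by (subst set_nn_integral_powr_minus_one[OF dd]) (subst L, intro ennreal_mult', simp)
      also have "\<dots> \<le> ennreal (1 / ln 2) * (ennreal (exp (2 * c)) * gauss_power_integral c \<sigma> a d)"
      proof (rule mult_left_mono)
        show "(\<integral>\<^sup>+t\<in>{d\<^sup>2 / 2..a\<^sup>2}. ennreal (t powr (- 1)) \<partial>lborel) \<le> ennreal (exp (2 * c)) * gauss_power_integral c \<sigma> a d"
          unfolding gauss_power_integral_def
        proof (rule set_nn_integral_le_cmult)
          fix t assume t: "t \<in> {d\<^sup>2 / 2..a\<^sup>2}"
          then have t0: "t > 0" using dd by (simp only: atLeastAtMost_iff) linarith
          have "d\<^sup>2 / t \<le> 2" using t t0 by (simp add: divide_le_eq)
          then have "c * (d\<^sup>2 / t) \<le> c * 2" by (rule mult_left_mono) (use assms in simp)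
          then have "exp (2 * c) * exp (- c * (d\<^sup>2 / t)) \<ge> 1" by (simp add: exp_add[symmetric])
          then have "t powr (- 1) * 1 \<le> t powr (- 1) * (exp (2 * c) * exp (- c * (d\<^sup>2 / t)))"
            by (rule mult_left_mono) simp
          moreover have sp: "\<sigma> - 3 / 2 = - 1" using 2 by simp
          ultimately show "t powr (- 1) \<le> exp (2 * c) * (t powr (\<sigma> - 3 / 2) * exp (- c * (d\<^sup>2 / t)))"
            unfolding sp by (simp only: mult_ac mult_1_right)
        next
          show "{d\<^sup>2 / 2..a\<^sup>2} \<subseteq> {0<..a\<^sup>2}" using less_le_trans[OF dd(1)] by auto
        qed auto
      qed simp
      also have "\<dots> = ennreal C * gauss_power_integral c \<sigma> a d"
        using l2 by (simp add: C_def mult.assoc[symmetric] ennreal_mult'[symmetric])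
      finally have "ennreal (1 + l) \<le> ennreal C * gauss_power_integral c \<sigma> a d" .
      moreover have "ennreal (a powr (2 * \<sigma> - 1)) * profile \<sigma> (d / a) = ennreal (1 + l)"
        using a d0 l by (simp add: profile_def l_def max_def 2 del: ennreal_plus)
      ultimately show "ennreal (a powr (2 * \<sigma> - 1)) * profile \<sigma> (d / a) \<le> ennreal C * gauss_power_integral c \<sigma> a d"
        by simp
    qed
  qed
qed

lemma profile_unbounded:
  assumes "\<sigma> \<le> 1 / 2"
  shows "\<exists>r>0. r \<le> 1 \<and> of_nat n \<le> profile \<sigma> r"
proof (cases "\<sigma> = 1 / 2")
  case True
  show ?thesis
    by (rule exI[of _ "exp (- real n)"])
      (use True in \<open>auto simp: profile_def ln_div ennreal_of_nat_eq_real_of_nat intro!: ennreal_leI\<close>)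
next
  case False
  define q where "q = 1 / (2 * \<sigma> - 1)"
  have q: "q < 0" "q * (2 * \<sigma> - 1) = 1" using False assms by (auto simp: q_def)
  have "(real n + 1) powr q \<le> 1 powr q" by (rule powr_mono2') (use q in auto)
  then show ?thesis
    by (intro exI[of _ "(real n + 1) powr q"])
      (use False assms q in \<open>auto simp: profile_def powr_powr ennreal_of_nat_eq_real_of_nat intro!: ennreal_leI\<close>)
qed

text \<open>At \<open>d = 0\<close> and \<open>\<sigma> \<le> 1/2\<close> the integral must be shown to be infinite. It dominates the integral for
  every \<open>d > 0\<close>, to which the previous bound applies, and the profile is unbounded near \<open>0\<close>.\<close>
lemma gauss_power_integral_lower:
  fixes c \<sigma> :: real
  assumes "c > 0" "\<sigma> > 0"
  shows "\<exists>C>0. \<forall>a>0. \<forall>d. 0 \<le> d \<longrightarrow> d \<le> a \<longrightarrow>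
           ennreal (a powr (2 * \<sigma> - 1)) * profile \<sigma> (d / a) \<le> ennreal C * gauss_power_integral c \<sigma> a d"
proof -
  obtain C where C: "C > 0" and
    low: "\<And>a d. a > 0 \<Longrightarrow> 0 \<le> d \<Longrightarrow> d \<le> a \<Longrightarrow> d > 0 \<or> \<sigma> > 1 / 2 \<Longrightarrow>
           ennreal (a powr (2 * \<sigma> - 1)) * profile \<sigma> (d / a) \<le> ennreal C * gauss_power_integral c \<sigma> a d"
    using gauss_power_integral_lower_pos[OF assms] by blast
  show ?thesis
  proof (intro exI[of _ C] conjI allI impI C)
    fix a d :: real assume a: "a > 0" and d: "0 \<le> d" "d \<le> a"
    show "ennreal (a powr (2 * \<sigma> - 1)) * profile \<sigma> (d / a) \<le> ennreal C * gauss_power_integral c \<sigma> a d"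
    proof (cases "d > 0 \<or> \<sigma> > 1 / 2")
      case True
      then show ?thesis using low a d by blast
    next
      case False
      then have d0: "d = 0" and s: "\<sigma> \<le> 1 / 2" using d by auto
      have "ennreal (a powr (2 * \<sigma> - 1)) * of_nat n \<le> ennreal C * gauss_power_integral c \<sigma> a d" for n
      proof -
        obtain r where r: "r > 0" "r \<le> 1" "of_nat n \<le> profile \<sigma> r"
          using profile_unbounded[OF s] by blast
        have "ennreal (a powr (2 * \<sigma> - 1)) * of_nat n \<le> ennreal (a powr (2 * \<sigma> - 1)) * profile \<sigma> (a * r / a)"
          using r a by (intro mult_left_mono) auto
        also have "\<dots> \<le> ennreal C * gauss_power_integral c \<sigma> a (a * r)"
          by (rule low) (use a r in \<open>auto simp: mult_left_le\<close>)
        also have "\<dots> \<le> ennreal C * gauss_power_integral c \<sigma> a d"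
          by (intro mult_left_mono gauss_power_integral_antimono) (use assms d0 a r in auto)
        finally show ?thesis .
      qed
      then have "(SUP n. ennreal (a powr (2 * \<sigma> - 1)) * of_nat n) \<le> ennreal C * gauss_power_integral c \<sigma> a d"
        by (intro SUP_least)
      moreover have "(SUP n. ennreal (a powr (2 * \<sigma> - 1)) * of_nat n) = ennreal (a powr (2 * \<sigma> - 1)) * (SUP n::nat. of_nat n)"
        by (simp add: SUP_mult_left_ennreal)
      moreover have "ennreal (a powr (2 * \<sigma> - 1)) * (SUP n::nat. of_nat n) = top"
        using a by (simp add: ennreal_SUP_of_nat_eq_top ennreal_mult_top)
      ultimately show ?thesis by (simp add: top_unique)
    qed
  qed
qed

section \<open>Pointwise bounds for the integrand of the potential kernel\<close>

definition kernel_integral :: "real \<Rightarrow> real \<Rightarrow> real \<Rightarrow> real \<Rightarrow> ennreal" where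
  "kernel_integral \<alpha> \<sigma> x y =
     (\<integral>\<^sup>+ t \<in> {0<..}. ennreal (laguerre_heat_kernel \<alpha> t x y * t powr (\<sigma> - 1)) \<partial>lborel)"

text \<open>The part of the estimate for \<open>A = x + y \<le> 1\<close> that comes from \<open>t \<ge> A\<^sup>2\<close> and is not already dominated by
  \<open>A powr (2\<sigma> - 2\<alpha> - 2)\<close>, the contribution of \<open>t\<close> near \<open>A\<^sup>2\<close>.\<close>
definition large_time_term :: "real \<Rightarrow> real \<Rightarrow> real \<Rightarrow> real" where
  "large_time_term \<alpha> \<sigma> A = of_bool (\<sigma> > \<alpha> + 1) + of_bool (\<sigma> = \<alpha> + 1) * ln (1 / A)"

lemma large_time_term_nonneg: "0 < A \<Longrightarrow> A \<le> 1 \<Longrightarrow> 0 \<le> large_time_term \<alpha> \<sigma> A"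
  by (auto simp: large_time_term_def intro!: ln_ge_zero)

lemma one_le_large_time_term_add:
  assumes "0 < A" "A \<le> 1"
  shows "1 \<le> large_time_term \<alpha> \<sigma> A + A powr (2 * \<sigma> - 2 * \<alpha> - 2)"
proof (cases "\<sigma> > \<alpha> + 1")
  case True
  then show ?thesis by (simp add: large_time_term_def)
next
  case False
  have "1 powr (2 * \<sigma> - 2 * \<alpha> - 2) \<le> A powr (2 * \<sigma> - 2 * \<alpha> - 2)"
    by (rule powr_mono2') (use assms False in auto)
  then show ?thesis using large_time_term_nonneg[OF assms, of \<alpha> \<sigma>] by simp
qed

lemma middle_time_integral_upper:
  fixes \<alpha> \<sigma> :: real
  shows "\<exists>C>0. \<forall>A>0. A \<le> 1 \<longrightarrow> (\<integral>\<^sup>+t\<in>{A\<^sup>2..1}. ennreal (t powr (\<sigma> - \<alpha> - 2)) \<partial>lborel)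
           \<le> ennreal (C * (large_time_term \<alpha> \<sigma> A + A powr (2 * \<sigma> - 2 * \<alpha> - 2)))"
proof -
  define q where "q = \<sigma> - \<alpha> - 1"
  define C where "C = (if q = 0 then 2 else 1 / \<bar>q\<bar>)"
  have C: "C > 0" by (simp add: C_def)
  show ?thesis
  proof (intro exI[of _ C] conjI allI impI C)
    fix A :: real assume A: "A > 0" "A \<le> 1"
    let ?J = "large_time_term \<alpha> \<sigma> A + A powr (2 * \<sigma> - 2 * \<alpha> - 2)"
    have J: "1 \<le> ?J" by (rule one_le_large_time_term_add[OF A])
    have T: "0 \<le> large_time_term \<alpha> \<sigma> A" by (rule large_time_term_nonneg[OF A])
    have A2: "0 < A\<^sup>2" "A\<^sup>2 \<le> 1" using A power_le_one[of A 2] by auto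
    have e: "\<sigma> - \<alpha> - 2 = q - 1" by (simp add: q_def)
    consider "q > 0" | "q = 0" | "q < 0" by linarith
    then show "(\<integral>\<^sup>+t\<in>{A\<^sup>2..1}. ennreal (t powr (\<sigma> - \<alpha> - 2)) \<partial>lborel) \<le> ennreal (C * ?J)"
    proof cases
      case 1
      have "(\<integral>\<^sup>+t\<in>{A\<^sup>2..1}. ennreal (t powr (q - 1)) \<partial>lborel) \<le> (\<integral>\<^sup>+t\<in>{0<..1}. ennreal (t powr (q - 1)) \<partial>lborel)"
        by (rule set_nn_integral_mono_set) (use less_le_trans[OF A2(1)] in auto)
      also have "\<dots> \<le> ennreal (1 powr (q - 1 + 1) / (q - 1 + 1))"
        by (rule set_nn_integral_powr_from_0) (use 1 in auto)
      also have "\<dots> \<le> ennreal (C * ?J)"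
        using mult_left_mono[OF J, of C] C 1 by (intro ennreal_leI) (simp add: C_def)
      finally show ?thesis unfolding e .
    next
      case 2
      have "(\<integral>\<^sup>+t\<in>{A\<^sup>2..1}. ennreal (t powr (- 1)) \<partial>lborel) = ennreal (ln (1 / A\<^sup>2))"
        by (rule set_nn_integral_powr_minus_one[OF A2])
      also have "ln (1 / A\<^sup>2) = 2 * ln (1 / A)"
        using A by (simp add: ln_div ln_realpow)
      also have "\<dots> \<le> C * ?J"
        using 2 by (simp add: C_def large_time_term_def q_def)
      finally show ?thesis unfolding e using 2 by (simp add: ennreal_leI)
    next
      case 3
      have "(\<integral>\<^sup>+t\<in>{A\<^sup>2..1}. ennreal (t powr (q - 1)) \<partial>lborel) \<le> ennreal ((A\<^sup>2) powr (q - 1 + 1) / (- (q - 1) - 1))"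
        by (rule set_nn_integral_powr_to_inf) (use 3 A2 in auto)
      also have "(A\<^sup>2) powr (q - 1 + 1) / (- (q - 1) - 1) = C * A powr (2 * \<sigma> - 2 * \<alpha> - 2)"
        using A 3 by (simp add: power2_powr C_def q_def algebra_simps)
      also have "\<dots> \<le> C * ?J" using T C by (intro mult_left_mono) auto
      finally show ?thesis unfolding e by (simp add: ennreal_leI)
    qed
  qed
qed

text \<open>The freedom to choose \<open>u\<close> comparable to \<open>t + (x + y)\<^sup>2\<close> and \<open>w\<close> above the exponent serves the various
  ranges of \<open>t\<close>: \<open>u\<close> is taken to be the larger of \<open>t\<close> and \<open>(x + y)\<^sup>2\<close>, up to a constant.\<close>
lemma small_time_lower_pointwise:
  fixes \<alpha> :: real
  assumes "\<alpha> > -1"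
  shows "\<exists>C>0. \<forall>k t x y u \<sigma> w. 0 < t \<longrightarrow> t \<le> 1 \<longrightarrow> 0 < x \<longrightarrow> 0 < y \<longrightarrow> 0 < u \<longrightarrow> 1 \<le> k \<longrightarrow>
     u \<le> k * (t + (x + y)\<^sup>2) \<longrightarrow> t + (x + y)\<^sup>2 \<le> k * u \<longrightarrow> (x + y)\<^sup>2 * t + (x - y)\<^sup>2 / t \<le> w \<longrightarrow>
     t powr (\<sigma> - 3 / 2) * u powr (- \<alpha> - 1 / 2) * exp (- w)
       \<le> C * k powr \<bar>\<alpha> + 1 / 2\<bar> * (laguerre_heat_kernel \<alpha> t x y * t powr (\<sigma> - 1))"
proof -
  obtain C where C: "C > 0" and
    K: "\<And>t x y. 0 < t \<Longrightarrow> t \<le> 1 \<Longrightarrow> 0 < x \<Longrightarrow> 0 < y \<Longrightarrow>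
     t powr (- 1 / 2) * (t + (x + y)\<^sup>2) powr (- \<alpha> - 1 / 2) * exp (- ((x + y)\<^sup>2 * t + (x - y)\<^sup>2 / t))
       \<le> C * laguerre_heat_kernel \<alpha> t x y"
    using heat_kernel_small_time[OF assms] by blast
  show ?thesis
  proof (intro exI[of _ C] conjI allI impI C)
    fix k t x y u \<sigma> w :: real
    assume t: "0 < t" "t \<le> 1" and xy: "0 < x" "0 < y" and u: "0 < u" and k: "1 \<le> k"
      and c: "u \<le> k * (t + (x + y)\<^sup>2)" "t + (x + y)\<^sup>2 \<le> k * u"
      and w: "(x + y)\<^sup>2 * t + (x - y)\<^sup>2 / t \<le> w"
    define Q where "Q = (x + y)\<^sup>2 * t + (x - y)\<^sup>2 / t"
    have "u powr (- \<alpha> - 1 / 2) \<le> k powr \<bar>- \<alpha> - 1 / 2\<bar> * (t + (x + y)\<^sup>2) powr (- \<alpha> - 1 / 2)"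
      by (rule powr_comparable[OF _ _ _ c]) (use u k t in \<open>auto intro: add_pos_nonneg\<close>)
    then have "u powr (- \<alpha> - 1 / 2) * exp (- w)
        \<le> (k powr \<bar>- \<alpha> - 1 / 2\<bar> * (t + (x + y)\<^sup>2) powr (- \<alpha> - 1 / 2)) * exp (- Q)"
      using w by (intro mult_mono) (auto simp: Q_def)
    then have "t powr (\<sigma> - 3 / 2) * (u powr (- \<alpha> - 1 / 2) * exp (- w))
        \<le> t powr (\<sigma> - 3 / 2) * ((k powr \<bar>- \<alpha> - 1 / 2\<bar> * (t + (x + y)\<^sup>2) powr (- \<alpha> - 1 / 2)) * exp (- Q))"
      by (rule mult_left_mono) simp
    also have "t powr (\<sigma> - 3 / 2) = t powr (- 1 / 2) * t powr (\<sigma> - 1)"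
      by (simp only: powr_add[symmetric]) (simp add: algebra_simps)
    also have "t powr (- 1 / 2) * t powr (\<sigma> - 1) * ((k powr \<bar>- \<alpha> - 1 / 2\<bar> * (t + (x + y)\<^sup>2) powr (- \<alpha> - 1 / 2)) * exp (- Q))
       = (k powr \<bar>- \<alpha> - 1 / 2\<bar> * t powr (\<sigma> - 1)) * (t powr (- 1 / 2) * (t + (x + y)\<^sup>2) powr (- \<alpha> - 1 / 2) * exp (- Q))"
      by (simp only: mult_ac)
    also have "\<dots> \<le> (k powr \<bar>- \<alpha> - 1 / 2\<bar> * t powr (\<sigma> - 1)) * (C * laguerre_heat_kernel \<alpha> t x y)"
      unfolding Q_def by (rule mult_left_mono[OF K[OF t xy]]) simp
    also have "\<bar>- \<alpha> - 1 / 2\<bar> = \<bar>\<alpha> + 1 / 2\<bar>" by (simp add: abs_if)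
    also have "k powr \<bar>\<alpha> + 1 / 2\<bar> * t powr (\<sigma> - 1) * (C * laguerre_heat_kernel \<alpha> t x y)
       = C * k powr \<bar>\<alpha> + 1 / 2\<bar> * (laguerre_heat_kernel \<alpha> t x y * t powr (\<sigma> - 1))"
      by (simp only: mult_ac)
    finally show "t powr (\<sigma> - 3 / 2) * u powr (- \<alpha> - 1 / 2) * exp (- w)
       \<le> C * k powr \<bar>\<alpha> + 1 / 2\<bar> * (laguerre_heat_kernel \<alpha> t x y * t powr (\<sigma> - 1))"
      unfolding \<open>t powr (\<sigma> - 3 / 2) = t powr (- 1 / 2) * t powr (\<sigma> - 1)\<close> by (simp only: mult.assoc)
  qed
qed

lemma small_time_upper_pointwise:
  fixes \<alpha> :: real
  assumes "\<alpha> > -1"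
  shows "\<exists>C>0. \<forall>k t x y u \<sigma> w. 0 < t \<longrightarrow> t \<le> 1 \<longrightarrow> 0 < x \<longrightarrow> 0 < y \<longrightarrow> 0 < u \<longrightarrow> 1 \<le> k \<longrightarrow>
     u \<le> k * (t + (x + y)\<^sup>2) \<longrightarrow> t + (x + y)\<^sup>2 \<le> k * u \<longrightarrow>
     w \<le> 1 / 16 * ((x + y)\<^sup>2 * t + (x - y)\<^sup>2 / t) \<longrightarrow>
     laguerre_heat_kernel \<alpha> t x y * t powr (\<sigma> - 1)
       \<le> C * k powr \<bar>\<alpha> + 1 / 2\<bar> * (t powr (\<sigma> - 3 / 2) * u powr (- \<alpha> - 1 / 2) * exp (- w))"
proof -
  obtain C where C: "C > 0" and
    K: "\<And>t x y. 0 < t \<Longrightarrow> t \<le> 1 \<Longrightarrow> 0 < x \<Longrightarrow> 0 < y \<Longrightarrow>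
     laguerre_heat_kernel \<alpha> t x y \<le> C * (t powr (- 1 / 2) * (t + (x + y)\<^sup>2) powr (- \<alpha> - 1 / 2)
              * exp (- (1 / 16) * ((x + y)\<^sup>2 * t + (x - y)\<^sup>2 / t)))"
    using heat_kernel_small_time[OF assms] by blast
  show ?thesis
  proof (intro exI[of _ C] conjI allI impI C)
    fix k t x y u \<sigma> w :: real
    assume t: "0 < t" "t \<le> 1" and xy: "0 < x" "0 < y" and u: "0 < u" and k: "1 \<le> k"
      and c: "u \<le> k * (t + (x + y)\<^sup>2)" "t + (x + y)\<^sup>2 \<le> k * u"
      and w: "w \<le> 1 / 16 * ((x + y)\<^sup>2 * t + (x - y)\<^sup>2 / t)"
    define Q where "Q = 1 / 16 * ((x + y)\<^sup>2 * t + (x - y)\<^sup>2 / t)"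
    have s: "t powr (- 1 / 2) * t powr (\<sigma> - 1) = t powr (\<sigma> - 3 / 2)"
      by (simp only: powr_add[symmetric]) (simp add: algebra_simps)
    have "(t + (x + y)\<^sup>2) powr (- \<alpha> - 1 / 2) \<le> k powr \<bar>- \<alpha> - 1 / 2\<bar> * u powr (- \<alpha> - 1 / 2)"
      by (rule powr_comparable[OF _ _ _ c(2,1)]) (use u k t in \<open>auto intro: add_pos_nonneg\<close>)
    moreover have "\<bar>- \<alpha> - 1 / 2\<bar> = \<bar>\<alpha> + 1 / 2\<bar>" by (simp add: abs_if)
    ultimately have "(t + (x + y)\<^sup>2) powr (- \<alpha> - 1 / 2) * exp (- Q)
        \<le> (k powr \<bar>\<alpha> + 1 / 2\<bar> * u powr (- \<alpha> - 1 / 2)) * exp (- w)"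
      using w by (intro mult_mono) (auto simp: Q_def)
    then have le: "t powr (- 1 / 2) * ((t + (x + y)\<^sup>2) powr (- \<alpha> - 1 / 2) * exp (- Q))
        \<le> t powr (- 1 / 2) * ((k powr \<bar>\<alpha> + 1 / 2\<bar> * u powr (- \<alpha> - 1 / 2)) * exp (- w))"
      by (rule mult_left_mono) simp
    have "laguerre_heat_kernel \<alpha> t x y \<le> C * (t powr (- 1 / 2) * ((t + (x + y)\<^sup>2) powr (- \<alpha> - 1 / 2) * exp (- Q)))"
      using K[OF t xy] by (simp add: Q_def mult.assoc)
    also have "\<dots> \<le> C * (t powr (- 1 / 2) * ((k powr \<bar>\<alpha> + 1 / 2\<bar> * u powr (- \<alpha> - 1 / 2)) * exp (- w)))"
      by (rule mult_left_mono[OF le]) (use C in simp)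
    finally have "laguerre_heat_kernel \<alpha> t x y * t powr (\<sigma> - 1)
      \<le> C * (t powr (- 1 / 2) * ((k powr \<bar>\<alpha> + 1 / 2\<bar> * u powr (- \<alpha> - 1 / 2)) * exp (- w))) * t powr (\<sigma> - 1)"
      by (rule mult_right_mono) simp
    then show "laguerre_heat_kernel \<alpha> t x y * t powr (\<sigma> - 1)
       \<le> C * k powr \<bar>\<alpha> + 1 / 2\<bar> * (t powr (\<sigma> - 3 / 2) * u powr (- \<alpha> - 1 / 2) * exp (- w))"
      unfolding s[symmetric] by (simp only: mult_ac)
  qed
qed

lemma large_time_upper_pointwise:
  fixes \<alpha> :: real
  assumes "\<alpha> > -1"
  shows "\<exists>C>0. \<forall>t x y \<sigma>. 1 \<le> t \<longrightarrow> 0 < x \<longrightarrow> 0 < y \<longrightarrow>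
     laguerre_heat_kernel \<alpha> t x y * t powr (\<sigma> - 1)
       \<le> C * exp (- (1 / 16) * (x + y)\<^sup>2) * (t powr (\<sigma> - 1) * exp (- (2 * (\<alpha> + 1)) * t))"
proof -
  obtain C where C: "C > 0" and
    K: "\<And>t x y. 1 \<le> t \<Longrightarrow> 0 < x \<Longrightarrow> 0 < y \<Longrightarrow>
     laguerre_heat_kernel \<alpha> t x y \<le> C * (exp (- (2 * (\<alpha> + 1)) * t) * exp (- (1 / 16) * (x + y)\<^sup>2))"
    using heat_kernel_large_time[OF assms] by blast
  show ?thesis
  proof (intro exI[of _ C] conjI allI impI C)
    fix t x y \<sigma> :: real assume "1 \<le> t" "0 < x" "0 < y"
    from mult_right_mono[OF K[OF this], of "t powr (\<sigma> - 1)"]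
    show "laguerre_heat_kernel \<alpha> t x y * t powr (\<sigma> - 1)
       \<le> C * exp (- (1 / 16) * (x + y)\<^sup>2) * (t powr (\<sigma> - 1) * exp (- (2 * (\<alpha> + 1)) * t))"
      by (simp only: mult_ac powr_ge_zero simp_thms True_implies_equals)
  qed
qed

lemma ennreal_cmult_le:
  assumes "X \<le> ennreal b * Y" "a \<ge> 0"
  shows "ennreal a * X \<le> ennreal (a * b) * Y"
  using mult_left_mono[OF assms(1), of "ennreal a"] assms(2) by (simp add: ennreal_mult' mult.assoc)

section \<open>Estimates near the origin\<close>

text \<open>The times are split at \<open>A\<^sup>2\<close>, where \<open>t + A\<^sup>2\<close> changes from \<open>A\<^sup>2\<close> to \<open>t\<close>, and at \<open>1\<close>. The bounded
  contribution of \<open>t \<ge> 1\<close> is absorbed because one of the terms on the right is always at least \<open>1\<close>.\<close>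
lemma kernel_integral_upper_small:
  fixes \<alpha> \<sigma> :: real
  assumes "\<alpha> > -1" "\<sigma> > 0"
  shows "\<exists>C>0. \<forall>x>0. \<forall>y>0. x + y \<le> 1 \<longrightarrow> kernel_integral \<alpha> \<sigma> x y
     \<le> ennreal C * (ennreal (large_time_term \<alpha> \<sigma> (x + y))
         + ennreal ((x + y) powr (2 * \<sigma> - 2 * \<alpha> - 2)) * profile \<sigma> (\<bar>x - y\<bar> / (x + y)))"
proof -
  define \<beta> where "\<beta> = - \<alpha> - 1 / 2"
  obtain C1 where C1: "C1 > 0" and
    K1: "\<And>k t x y u \<sigma> w. 0 < t \<Longrightarrow> t \<le> 1 \<Longrightarrow> 0 < x \<Longrightarrow> 0 < y \<Longrightarrow> 0 < u \<Longrightarrow> 1 \<le> k \<Longrightarrow>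
     u \<le> k * (t + (x + y)\<^sup>2) \<Longrightarrow> t + (x + y)\<^sup>2 \<le> k * u \<Longrightarrow>
     w \<le> 1 / 16 * ((x + y)\<^sup>2 * t + (x - y)\<^sup>2 / t) \<Longrightarrow>
     laguerre_heat_kernel \<alpha> t x y * t powr (\<sigma> - 1)
       \<le> C1 * k powr \<bar>\<alpha> + 1 / 2\<bar> * (t powr (\<sigma> - 3 / 2) * u powr \<beta> * exp (- w))"
    using small_time_upper_pointwise[OF assms(1)] unfolding \<beta>_def by blast
  obtain C2 where C2: "C2 > 0" and
    K2: "\<And>t x y \<sigma>. 1 \<le> t \<Longrightarrow> 0 < x \<Longrightarrow> 0 < y \<Longrightarrow>
     laguerre_heat_kernel \<alpha> t x y * t powr (\<sigma> - 1)
       \<le> C2 * exp (- (1 / 16) * (x + y)\<^sup>2) * (t powr (\<sigma> - 1) * exp (- (2 * (\<alpha> + 1)) * t))"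
    using large_time_upper_pointwise[OF assms(1)] by blast
  obtain C3 where C3: "C3 > 0" and
    K3: "\<And>a d. a > 0 \<Longrightarrow> d \<ge> 0 \<Longrightarrow> gauss_power_integral (1 / 16) \<sigma> a d
           \<le> ennreal (C3 * a powr (2 * \<sigma> - 1)) * profile \<sigma> (min 1 (d / a))"
    using gauss_power_integral_upper[of "1 / 16" \<sigma>] assms by auto
  obtain C4 where C4: "C4 > 0" and
    K4: "\<And>A. 0 < A \<Longrightarrow> A \<le> 1 \<Longrightarrow> (\<integral>\<^sup>+t\<in>{A\<^sup>2..1}. ennreal (t powr (\<sigma> - \<alpha> - 2)) \<partial>lborel)
           \<le> ennreal (C4 * (large_time_term \<alpha> \<sigma> A + A powr (2 * \<sigma> - 2 * \<alpha> - 2)))"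
    using middle_time_integral_upper[of \<sigma> \<alpha>] by blast
  obtain C5 where C5: "C5 > 0" and
    K5: "(\<integral>\<^sup>+t\<in>{1..}. ennreal (t powr (\<sigma> - 1) * exp (- (2 * (\<alpha> + 1)) * t)) \<partial>lborel) \<le> ennreal C5"
    using set_nn_integral_powr_exp_finite[of "2 * (\<alpha> + 1)" "\<sigma> - 1"] assms by auto
  define B where "B = C1 * 2 powr \<bar>\<alpha> + 1 / 2\<bar>"
  have B: "B > 0" using C1 by (simp add: B_def)
  define C where "C = B * C3 + B * C4 + C2 * C5"
  have C: "C > 0" using B C2 C3 C4 C5 by (simp add: C_def add_pos_pos)
  show ?thesis
  proof (intro exI[of _ C] conjI allI impI C)
    fix x y :: real assume x: "x > 0" and y: "y > 0" and xy: "x + y \<le> 1"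
    define A d where "A = x + y" and "d = \<bar>x - y\<bar>"
    have A: "0 < A" "A \<le> 1" using x y xy by (auto simp: A_def)
    have d: "0 \<le> d" "d \<le> A" "d\<^sup>2 = (x - y)\<^sup>2" using x y by (auto simp: A_def d_def)
    have A2: "0 < A\<^sup>2" "A\<^sup>2 \<le> 1" using A power_le_one[of A 2] by auto
    define T where "T = large_time_term \<alpha> \<sigma> A"
    have T: "T \<ge> 0" unfolding T_def by (rule large_time_term_nonneg[OF A])
    define J where "J = A powr (2 * \<sigma> - 2 * \<alpha> - 2)"
    define P where "P = profile \<sigma> (d / A)"
    define Y where "Y = ennreal T + ennreal J * P"
    have P1: "1 \<le> P" unfolding P_def by (rule profile_ge_1) (use A d in auto)
    have J0: "J \<ge> 0" by (simp add: J_def)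
    have JY: "ennreal (T + J) \<le> Y"
      unfolding Y_def using T J0 mult_left_mono[OF P1, of "ennreal J"] by (simp add: add_left_mono)
    have "1 \<le> T + J" unfolding T_def J_def by (rule one_le_large_time_term_add[OF A])
    then have "ennreal 1 \<le> ennreal (T + J)" by (rule ennreal_leI)
    then have oneY: "ennreal 1 \<le> Y" using JY by (rule order_trans)
    have mn: "min 1 (d / A) = d / A" using A d by (simp add: min_absorb2)
    have "kernel_integral \<alpha> \<sigma> x y \<le>
        ennreal (B * (A\<^sup>2) powr \<beta>) * (\<integral>\<^sup>+t\<in>{0<..A\<^sup>2}. ennreal (t powr (\<sigma> - 3 / 2) * exp (- (1 / 16) * (d\<^sup>2 / t))) \<partial>lborel)
      + ennreal B * (\<integral>\<^sup>+t\<in>{A\<^sup>2..1}. ennreal (t powr (\<sigma> - \<alpha> - 2)) \<partial>lborel)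
      + ennreal C2 * (\<integral>\<^sup>+t\<in>{1..}. ennreal (t powr (\<sigma> - 1) * exp (- (2 * (\<alpha> + 1)) * t)) \<partial>lborel)"
      unfolding kernel_integral_def
    proof (rule set_nn_integral_le_cover)
      fix t :: real assume t0: "t \<in> {0<..}"
      { assume t: "t \<in> {0<..A\<^sup>2}"
        have "laguerre_heat_kernel \<alpha> t x y * t powr (\<sigma> - 1)
          \<le> C1 * 2 powr \<bar>\<alpha> + 1 / 2\<bar> * (t powr (\<sigma> - 3 / 2) * (A\<^sup>2) powr \<beta> * exp (- (1 / 16 * (d\<^sup>2 / t))))"
        proof (rule K1)
          show "t \<le> 1" using t A2 by auto
          show "1 / 16 * (d\<^sup>2 / t) \<le> 1 / 16 * ((x + y)\<^sup>2 * t + (x - y)\<^sup>2 / t)"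
            using t d by (intro mult_left_mono) auto
        qed (use t x y A2 in \<open>auto simp: A_def\<close>)
        then show "laguerre_heat_kernel \<alpha> t x y * t powr (\<sigma> - 1)
          \<le> B * (A\<^sup>2) powr \<beta> * (t powr (\<sigma> - 3 / 2) * exp (- (1 / 16) * (d\<^sup>2 / t)))"
          by (simp add: B_def mult_ac) }
      { assume t: "t \<in> {A\<^sup>2..1}"
        have "laguerre_heat_kernel \<alpha> t x y * t powr (\<sigma> - 1)
          \<le> C1 * 2 powr \<bar>\<alpha> + 1 / 2\<bar> * (t powr (\<sigma> - 3 / 2) * t powr \<beta> * exp (- 0))"
          by (rule K1) (use t t0 x y A2 in \<open>auto simp: A_def\<close>)
        also have "t powr (\<sigma> - 3 / 2) * t powr \<beta> = t powr (\<sigma> - \<alpha> - 2)"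
          by (simp only: powr_add[symmetric]) (simp add: \<beta>_def algebra_simps)
        finally show "laguerre_heat_kernel \<alpha> t x y * t powr (\<sigma> - 1) \<le> B * t powr (\<sigma> - \<alpha> - 2)"
          by (simp add: B_def) }
      { assume t: "t \<in> {1..}"
        have "laguerre_heat_kernel \<alpha> t x y * t powr (\<sigma> - 1)
          \<le> C2 * exp (- (1 / 16) * (x + y)\<^sup>2) * (t powr (\<sigma> - 1) * exp (- (2 * (\<alpha> + 1)) * t))"
          by (rule K2) (use t x y in auto)
        also have "\<dots> \<le> C2 * 1 * (t powr (\<sigma> - 1) * exp (- (2 * (\<alpha> + 1)) * t))"
          using C2 by (intro mult_right_mono mult_left_mono) auto
        finally show "laguerre_heat_kernel \<alpha> t x y * t powr (\<sigma> - 1)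
          \<le> C2 * (t powr (\<sigma> - 1) * exp (- (2 * (\<alpha> + 1)) * t))" by simp }
    qed (use B C2 in auto)
    also have "\<dots> \<le> ennreal (B * C3) * Y + ennreal (B * C4) * Y + ennreal (C2 * C5) * Y"
    proof (intro add_mono)
      have "ennreal (B * (A\<^sup>2) powr \<beta>) * gauss_power_integral (1 / 16) \<sigma> A d
         \<le> ennreal (B * (A\<^sup>2) powr \<beta> * (C3 * A powr (2 * \<sigma> - 1))) * P"
        using K3[OF A(1) d(1)] B unfolding P_def mn by (intro ennreal_cmult_le) auto
      also have "B * (A\<^sup>2) powr \<beta> * (C3 * A powr (2 * \<sigma> - 1)) = B * C3 * ((A\<^sup>2) powr \<beta> * A powr (2 * \<sigma> - 1))"
        by (simp only: mult_ac)
      also have "(A\<^sup>2) powr \<beta> * A powr (2 * \<sigma> - 1) = J"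
        using A by (simp add: power2_powr powr_add[symmetric] \<beta>_def J_def algebra_simps)
      also have "ennreal (B * C3 * J) * P = ennreal (B * C3) * (ennreal J * P)"
        using B C3 by (simp add: ennreal_mult' mult.assoc)
      also have "\<dots> \<le> ennreal (B * C3) * Y"
        unfolding Y_def by (intro mult_left_mono) auto
      finally show "ennreal (B * (A\<^sup>2) powr \<beta>) * (\<integral>\<^sup>+t\<in>{0<..A\<^sup>2}. ennreal (t powr (\<sigma> - 3 / 2) * exp (- (1 / 16) * (d\<^sup>2 / t))) \<partial>lborel)
        \<le> ennreal (B * C3) * Y" unfolding gauss_power_integral_def .
      have "(\<integral>\<^sup>+t\<in>{A\<^sup>2..1}. ennreal (t powr (\<sigma> - \<alpha> - 2)) \<partial>lborel) \<le> ennreal (C4 * (T + J))"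
        using K4[OF A] by (simp add: T_def J_def)
      also have "\<dots> = ennreal C4 * ennreal (T + J)" using C4 by (intro ennreal_mult') simp
      also have "\<dots> \<le> ennreal C4 * Y" by (rule mult_left_mono[OF JY]) simp
      finally show "ennreal B * (\<integral>\<^sup>+t\<in>{A\<^sup>2..1}. ennreal (t powr (\<sigma> - \<alpha> - 2)) \<partial>lborel) \<le> ennreal (B * C4) * Y"
        using B by (intro ennreal_cmult_le) auto
      have "ennreal C5 \<le> ennreal C5 * Y" using mult_left_mono[OF oneY, of "ennreal C5"] by simp
      then have "(\<integral>\<^sup>+t\<in>{1..}. ennreal (t powr (\<sigma> - 1) * exp (- (2 * (\<alpha> + 1)) * t)) \<partial>lborel) \<le> ennreal C5 * Y"
        using K5 by (rule order_trans[rotated])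
      then show "ennreal C2 * (\<integral>\<^sup>+t\<in>{1..}. ennreal (t powr (\<sigma> - 1) * exp (- (2 * (\<alpha> + 1)) * t)) \<partial>lborel) \<le> ennreal (C2 * C5) * Y"
        using C2 by (intro ennreal_cmult_le) auto
    qed
    also have "\<dots> = ennreal C * Y"
      using B C2 C3 C4 C5 by (simp add: C_def distrib_right)
    finally show "kernel_integral \<alpha> \<sigma> x y \<le> ennreal C * (ennreal (large_time_term \<alpha> \<sigma> (x + y))
         + ennreal ((x + y) powr (2 * \<sigma> - 2 * \<alpha> - 2)) * profile \<sigma> (\<bar>x - y\<bar> / (x + y)))"
      unfolding Y_def T_def J_def P_def A_def d_def .
  qed
qed

text \<open>The restrictions on \<open>a\<close> say that for \<open>t \<le> a\<^sup>2\<close> the quantity \<open>t + A\<^sup>2\<close> is of order \<open>A\<^sup>2\<close> and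
  \<open>A\<^sup>2 t \<le> 1\<close>. They hold for \<open>a = A\<close> if \<open>A \<le> 1\<close> and for \<open>a = 1/A\<close> if \<open>A > 1\<close>, so the lemma serves both
  cases.\<close>
lemma gauss_power_integral_le_kernel_integral:
  fixes \<alpha> \<sigma> :: real
  assumes "\<alpha> > -1"
  shows "\<exists>C>0. \<forall>x>0. \<forall>y>0. \<forall>a>0. a \<le> 1 \<longrightarrow> a \<le> x + y \<longrightarrow> a * (x + y) \<le> 1 \<longrightarrow>
     ennreal ((x + y) powr (- 2 * \<alpha> - 1)) * gauss_power_integral 1 \<sigma> a \<bar>x - y\<bar>
       \<le> ennreal C * kernel_integral \<alpha> \<sigma> x y"
proof -
  define \<beta> where "\<beta> = - \<alpha> - 1 / 2"
  obtain C1 where C1: "C1 > 0" and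
    K1: "\<And>k t x y u \<sigma> w. 0 < t \<Longrightarrow> t \<le> 1 \<Longrightarrow> 0 < x \<Longrightarrow> 0 < y \<Longrightarrow> 0 < u \<Longrightarrow> 1 \<le> k \<Longrightarrow>
     u \<le> k * (t + (x + y)\<^sup>2) \<Longrightarrow> t + (x + y)\<^sup>2 \<le> k * u \<Longrightarrow> (x + y)\<^sup>2 * t + (x - y)\<^sup>2 / t \<le> w \<Longrightarrow>
     t powr (\<sigma> - 3 / 2) * u powr \<beta> * exp (- w)
       \<le> C1 * k powr \<bar>\<alpha> + 1 / 2\<bar> * (laguerre_heat_kernel \<alpha> t x y * t powr (\<sigma> - 1))"
    using small_time_lower_pointwise[OF assms(1)] unfolding \<beta>_def by blast
  define B where "B = C1 * 2 powr \<bar>\<alpha> + 1 / 2\<bar> * exp 1"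
  have B: "B > 0" using C1 by (simp add: B_def)
  show ?thesis
  proof (intro exI[of _ B] conjI allI impI B)
    fix x y a :: real assume x: "x > 0" and y: "y > 0" and a: "a > 0" "a \<le> 1" "a \<le> x + y" "a * (x + y) \<le> 1"
    define A where "A = x + y"
    have A: "0 < A" using x y by (simp add: A_def)
    have aA: "a\<^sup>2 \<le> A\<^sup>2" using a by (intro power_mono) (auto simp: A_def)
    have a1: "a\<^sup>2 \<le> 1" using a by (simp add: power_le_one)
    have aA1: "A\<^sup>2 * a\<^sup>2 \<le> 1"
      using power_mono[of "a * A" 1 2] a A by (simp add: A_def power_mult_distrib mult.commute)
    have W: "(A\<^sup>2) powr \<beta> = A powr (- 2 * \<alpha> - 1)"
      using A by (simp add: power2_powr \<beta>_def algebra_simps)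
    have "ennreal (A powr (- 2 * \<alpha> - 1)) * gauss_power_integral 1 \<sigma> a \<bar>x - y\<bar>
       = (\<integral>\<^sup>+t\<in>{0<..a\<^sup>2}. ennreal ((A\<^sup>2) powr \<beta> * (t powr (\<sigma> - 3 / 2) * exp (- 1 * (\<bar>x - y\<bar>\<^sup>2 / t)))) \<partial>lborel)"
      unfolding gauss_power_integral_def W by (rule set_nn_integral_cmult[symmetric]) auto
    also have "\<dots> \<le> ennreal B * kernel_integral \<alpha> \<sigma> x y"
      unfolding kernel_integral_def
    proof (rule set_nn_integral_le_cmult)
      fix t assume t: "t \<in> {0<..a\<^sup>2}"
      have At: "A\<^sup>2 * t \<le> 1"
        using t mult_left_mono[of t "a\<^sup>2" "A\<^sup>2"] aA1 by auto
      have "t powr (\<sigma> - 3 / 2) * (A\<^sup>2) powr \<beta> * exp (- (1 + \<bar>x - y\<bar>\<^sup>2 / t))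
         \<le> C1 * 2 powr \<bar>\<alpha> + 1 / 2\<bar> * (laguerre_heat_kernel \<alpha> t x y * t powr (\<sigma> - 1))"
        by (rule K1) (use t x y A a1 aA At in \<open>auto simp: A_def\<close>)
      then have "exp 1 * (t powr (\<sigma> - 3 / 2) * (A\<^sup>2) powr \<beta> * exp (- (1 + \<bar>x - y\<bar>\<^sup>2 / t)))
         \<le> exp 1 * (C1 * 2 powr \<bar>\<alpha> + 1 / 2\<bar> * (laguerre_heat_kernel \<alpha> t x y * t powr (\<sigma> - 1)))"
        by (rule mult_left_mono) simp
      also have "exp 1 * (t powr (\<sigma> - 3 / 2) * (A\<^sup>2) powr \<beta> * exp (- (1 + \<bar>x - y\<bar>\<^sup>2 / t)))
         = (A\<^sup>2) powr \<beta> * (t powr (\<sigma> - 3 / 2) * (exp 1 * exp (- (1 + \<bar>x - y\<bar>\<^sup>2 / t))))"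
        by (simp only: mult_ac)
      also have "exp 1 * exp (- (1 + \<bar>x - y\<bar>\<^sup>2 / t)) = exp (- 1 * (\<bar>x - y\<bar>\<^sup>2 / t))"
        by (simp only: exp_add[symmetric]) simp
      finally show "(A\<^sup>2) powr \<beta> * (t powr (\<sigma> - 3 / 2) * exp (- 1 * (\<bar>x - y\<bar>\<^sup>2 / t)))
         \<le> B * (laguerre_heat_kernel \<alpha> t x y * t powr (\<sigma> - 1))"
        unfolding B_def by (simp only: mult_ac)
    qed (use B in auto)
    finally show "ennreal ((x + y) powr (- 2 * \<alpha> - 1)) * gauss_power_integral 1 \<sigma> a \<bar>x - y\<bar>
       \<le> ennreal B * kernel_integral \<alpha> \<sigma> x y" unfolding A_def .
  qed
qed

text \<open>If \<open>2t \<ge> A\<^sup>2\<close> and \<open>t \<le> 1\<close>, the exponent is bounded and the integrand is at least a multiple of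
  \<open>t powr (\<sigma> - \<alpha> - 2)\<close>. The interval \<open>[1/2, 1]\<close> gives the constant term and \<open>[A\<^sup>2, 1]\<close> the logarithm.\<close>
lemma large_time_term_le_kernel_integral:
  fixes \<alpha> \<sigma> :: real
  assumes "\<alpha> > -1"
  shows "\<exists>C>0. \<forall>x>0. \<forall>y>0. x + y \<le> 1 \<longrightarrow>
     ennreal (large_time_term \<alpha> \<sigma> (x + y)) \<le> ennreal C * kernel_integral \<alpha> \<sigma> x y"
proof -
  define \<beta> where "\<beta> = - \<alpha> - 1 / 2"
  obtain C1 where C1: "C1 > 0" and
    K1: "\<And>k t x y u \<sigma> w. 0 < t \<Longrightarrow> t \<le> 1 \<Longrightarrow> 0 < x \<Longrightarrow> 0 < y \<Longrightarrow> 0 < u \<Longrightarrow> 1 \<le> k \<Longrightarrow>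
     u \<le> k * (t + (x + y)\<^sup>2) \<Longrightarrow> t + (x + y)\<^sup>2 \<le> k * u \<Longrightarrow> (x + y)\<^sup>2 * t + (x - y)\<^sup>2 / t \<le> w \<Longrightarrow>
     t powr (\<sigma> - 3 / 2) * u powr \<beta> * exp (- w)
       \<le> C1 * k powr \<bar>\<alpha> + 1 / 2\<bar> * (laguerre_heat_kernel \<alpha> t x y * t powr (\<sigma> - 1))"
    using small_time_lower_pointwise[OF assms(1)] unfolding \<beta>_def by blast
  define B where "B = C1 * 3 powr \<bar>\<alpha> + 1 / 2\<bar> * exp 3"
  have B: "B > 0" using C1 by (simp add: B_def)
  define p where "p = \<sigma> - \<alpha> - 2"
  have low: "t powr p \<le> B * (laguerre_heat_kernel \<alpha> t x y * t powr (\<sigma> - 1))"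
    if t: "0 < t" "t \<le> 1" and xy: "0 < x" "0 < y" "(x + y)\<^sup>2 \<le> 2 * t" "x + y \<le> 1" for t x y
  proof -
    have "(x - y)\<^sup>2 \<le> (x + y)\<^sup>2" using xy by (intro power2_le_iff_abs_le[THEN iffD2]) auto
    then have "(x - y)\<^sup>2 / t \<le> 2" using t xy by (simp add: divide_le_eq)
    moreover have "(x + y)\<^sup>2 * t \<le> 1"
      using t xy by (intro mult_le_one) (auto simp: power_le_one)
    ultimately have w: "(x + y)\<^sup>2 * t + (x - y)\<^sup>2 / t \<le> 3" by linarith
    have "t powr (\<sigma> - 3 / 2) * t powr \<beta> * exp (- 3)
       \<le> C1 * 3 powr \<bar>\<alpha> + 1 / 2\<bar> * (laguerre_heat_kernel \<alpha> t x y * t powr (\<sigma> - 1))"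
      by (rule K1) (use t xy w in auto)
    also have "t powr (\<sigma> - 3 / 2) * t powr \<beta> = t powr p"
      by (simp only: powr_add[symmetric]) (simp add: \<beta>_def p_def algebra_simps)
    finally have "exp 3 * (t powr p * exp (- 3)) \<le> exp 3 * (C1 * 3 powr \<bar>\<alpha> + 1 / 2\<bar> * (laguerre_heat_kernel \<alpha> t x y * t powr (\<sigma> - 1)))"
      by (rule mult_left_mono) simp
    also have "exp 3 * (t powr p * exp (- 3)) = t powr p" by (simp add: exp_minus)
    finally show ?thesis unfolding B_def by (simp only: mult_ac)
  qed
  define m where "m = 2 powr (- \<bar>p\<bar>) * (1 / 2)"
  have m: "m > 0" by (simp add: m_def)
  define C where "C = B + B / m"
  have C: "C > 0" using B m by (simp add: C_def add_pos_pos)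
  show ?thesis
  proof (intro exI[of _ C] conjI allI impI C)
    fix x y :: real assume x: "x > 0" and y: "y > 0" and xy: "x + y \<le> 1"
    define A where "A = x + y"
    have A: "0 < A" "A \<le> 1" using x y xy by (auto simp: A_def)
    have A2: "0 < A\<^sup>2" "A\<^sup>2 \<le> 1" using A power_le_one[of A 2] by auto
    have B_le: "ennreal B * kernel_integral \<alpha> \<sigma> x y \<le> ennreal C * kernel_integral \<alpha> \<sigma> x y"
      using B m by (intro mult_right_mono ennreal_leI) (auto simp: C_def)
    have Bm_le: "ennreal (B / m) * kernel_integral \<alpha> \<sigma> x y \<le> ennreal C * kernel_integral \<alpha> \<sigma> x y"
      using B m by (intro mult_right_mono ennreal_leI) (auto simp: C_def)
    consider "\<sigma> > \<alpha> + 1" | "\<sigma> = \<alpha> + 1" | "\<sigma> < \<alpha> + 1" by linarith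
    then show "ennreal (large_time_term \<alpha> \<sigma> (x + y)) \<le> ennreal C * kernel_integral \<alpha> \<sigma> x y"
    proof cases
      case 1
      have "ennreal (2 powr (- \<bar>p\<bar>) * (1 - 1 / 2)) \<le> (\<integral>\<^sup>+t\<in>{1 / 2..1}. ennreal (t powr p) \<partial>lborel)"
        by (rule set_nn_integral_ge_const) (use powr_half_interval[of 1 _ p] in auto)
      also have "\<dots> \<le> ennreal B * kernel_integral \<alpha> \<sigma> x y"
        unfolding kernel_integral_def
        by (rule set_nn_integral_le_cmult) (use low x y A2 xy B in \<open>auto simp: A_def\<close>)
      finally have "ennreal m \<le> ennreal B * kernel_integral \<alpha> \<sigma> x y" by (simp add: m_def)
      then have "ennreal (1 / m) * ennreal m \<le> ennreal (1 / m * B) * kernel_integral \<alpha> \<sigma> x y"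
        by (rule ennreal_cmult_le) (use m in simp)
      moreover have "ennreal (1 / m) * ennreal m = 1"
        using m by (simp add: ennreal_mult'[symmetric])
      ultimately show ?thesis using 1 Bm_le by (simp add: large_time_term_def)
    next
      case 2
      have p: "p = - 1" using 2 by (simp add: p_def)
      have l: "0 \<le> ln (1 / A)" using A by (intro ln_ge_zero) auto
      have "ln (1 / A\<^sup>2) = 2 * ln (1 / A)" using A by (simp add: ln_div ln_realpow)
      then have "ln (1 / A) \<le> ln (1 / A\<^sup>2)" using l by linarith
      then have "ennreal (ln (1 / A)) \<le> (\<integral>\<^sup>+t\<in>{A\<^sup>2..1}. ennreal (t powr p) \<partial>lborel)"
        unfolding p set_nn_integral_powr_minus_one[OF A2] by (rule ennreal_leI)
      also have "\<dots> \<le> ennreal B * kernel_integral \<alpha> \<sigma> x y"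
        unfolding kernel_integral_def
      proof (rule set_nn_integral_le_cmult)
        fix t assume t: "t \<in> {A\<^sup>2..1}"
        then have "0 < t" using A2 by (simp only: atLeastAtMost_iff) linarith
        then show "t powr p \<le> B * (laguerre_heat_kernel \<alpha> t x y * t powr (\<sigma> - 1))"
          using t x y xy by (intro low) (auto simp: A_def)
      next
        show "{A\<^sup>2..1} \<subseteq> {0<..}" using less_le_trans[OF A2(1)] by auto
      qed (use B in auto)
      finally show ?thesis using 2 B_le by (simp add: large_time_term_def A_def)
    next
      case 3
      then show ?thesis by (simp add: large_time_term_def)
    qed
  qed
qed

lemma kernel_integral_lower_small:
  fixes \<alpha> \<sigma> :: real
  assumes "\<alpha> > -1" "\<sigma> > 0"
  shows "\<exists>C>0. \<forall>x>0. \<forall>y>0. x + y \<le> 1 \<longrightarrow> ennreal (large_time_term \<alpha> \<sigma> (x + y))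
         + ennreal ((x + y) powr (2 * \<sigma> - 2 * \<alpha> - 2)) * profile \<sigma> (\<bar>x - y\<bar> / (x + y))
     \<le> ennreal C * kernel_integral \<alpha> \<sigma> x y"
proof -
  obtain C1 where C1: "C1 > 0" and
    K1: "\<And>x y a. 0 < x \<Longrightarrow> 0 < y \<Longrightarrow> 0 < a \<Longrightarrow> a \<le> 1 \<Longrightarrow> a \<le> x + y \<Longrightarrow> a * (x + y) \<le> 1 \<Longrightarrow>
     ennreal ((x + y) powr (- 2 * \<alpha> - 1)) * gauss_power_integral 1 \<sigma> a \<bar>x - y\<bar>
       \<le> ennreal C1 * kernel_integral \<alpha> \<sigma> x y"
    using gauss_power_integral_le_kernel_integral[OF assms(1), of \<sigma>] by blast
  obtain C2 where C2: "C2 > 0" and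
    K2: "\<And>x y. 0 < x \<Longrightarrow> 0 < y \<Longrightarrow> x + y \<le> 1 \<Longrightarrow>
     ennreal (large_time_term \<alpha> \<sigma> (x + y)) \<le> ennreal C2 * kernel_integral \<alpha> \<sigma> x y"
    using large_time_term_le_kernel_integral[OF assms(1), of \<sigma>] by blast
  obtain C3 where C3: "C3 > 0" and
    K3: "\<And>a d. 0 < a \<Longrightarrow> 0 \<le> d \<Longrightarrow> d \<le> a \<Longrightarrow>
      ennreal (a powr (2 * \<sigma> - 1)) * profile \<sigma> (d / a) \<le> ennreal C3 * gauss_power_integral 1 \<sigma> a d"
    using gauss_power_integral_lower[of 1 \<sigma>] assms(2) by auto
  show ?thesis
  proof (intro exI[of _ "C2 + C3 * C1"] conjI allI impI)
    show "C2 + C3 * C1 > 0" using C1 C2 C3 by (simp add: add_pos_pos)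
    fix x y :: real assume x: "x > 0" and y: "y > 0" and xy: "x + y \<le> 1"
    define A d where "A = x + y" and "d = \<bar>x - y\<bar>"
    have A: "0 < A" "A \<le> 1" using x y xy by (auto simp: A_def)
    have d: "0 \<le> d" "d \<le> A" using x y by (auto simp: A_def d_def)
    have "A * A \<le> 1" using A by (intro mult_le_one) auto
    have "A powr (2 * \<sigma> - 2 * \<alpha> - 2) = A powr (- 2 * \<alpha> - 1) * A powr (2 * \<sigma> - 1)"
      by (simp add: powr_add[symmetric] algebra_simps)
    then have "ennreal (A powr (2 * \<sigma> - 2 * \<alpha> - 2)) * profile \<sigma> (d / A)
       = ennreal (A powr (- 2 * \<alpha> - 1)) * (ennreal (A powr (2 * \<sigma> - 1)) * profile \<sigma> (d / A))"
      by (simp add: ennreal_mult' mult.assoc)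
    also have "\<dots> \<le> ennreal (A powr (- 2 * \<alpha> - 1)) * (ennreal C3 * gauss_power_integral 1 \<sigma> A d)"
      by (intro mult_left_mono K3 A d) simp
    also have "\<dots> = ennreal C3 * (ennreal (A powr (- 2 * \<alpha> - 1)) * gauss_power_integral 1 \<sigma> A d)"
      by (simp only: mult_ac)
    also have "\<dots> \<le> ennreal (C3 * C1) * kernel_integral \<alpha> \<sigma> x y"
    proof (rule ennreal_cmult_le)
      show "ennreal (A powr (- 2 * \<alpha> - 1)) * gauss_power_integral 1 \<sigma> A d \<le> ennreal C1 * kernel_integral \<alpha> \<sigma> x y"
        unfolding A_def d_def by (rule K1) (use x y xy \<open>A * A \<le> 1\<close> in \<open>auto simp: A_def\<close>)
    qed (use C3 in simp)
    finally have "ennreal (large_time_term \<alpha> \<sigma> A) + ennreal (A powr (2 * \<sigma> - 2 * \<alpha> - 2)) * profile \<sigma> (d / A)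
       \<le> ennreal C2 * kernel_integral \<alpha> \<sigma> x y + ennreal (C3 * C1) * kernel_integral \<alpha> \<sigma> x y"
      using K2[OF x y xy] unfolding A_def by (intro add_mono)
    also have "\<dots> = ennreal (C2 + C3 * C1) * kernel_integral \<alpha> \<sigma> x y"
      using C1 C2 C3 by (simp add: distrib_right)
    finally show "ennreal (large_time_term \<alpha> \<sigma> (x + y))
         + ennreal ((x + y) powr (2 * \<sigma> - 2 * \<alpha> - 2)) * profile \<sigma> (\<bar>x - y\<bar> / (x + y))
     \<le> ennreal (C2 + C3 * C1) * kernel_integral \<alpha> \<sigma> x y" unfolding A_def d_def .
  qed
qed

section \<open>Estimates away from the origin\<close>

text \<open>The block with \<open>a = 1/A\<close> only sees \<open>min 1 \<rho>\<close> for \<open>\<rho> = A d\<close>, whereas the stated bound has the profile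
  at \<open>\<rho>\<close> itself. Beyond \<open>1\<close> they differ by at most a factor \<open>\<rho>\<close>, which costs a part of the exponential.\<close>
lemma profile_min_exp_le:
  fixes \<sigma> \<epsilon> \<rho> :: real
  assumes "\<sigma> > 0" "\<epsilon> > 0" "\<epsilon> \<le> 1" "\<rho> \<ge> 0"
  shows "ennreal (exp (- \<epsilon> * \<rho>)) * profile \<sigma> (min 1 \<rho>) \<le> ennreal (1 / \<epsilon>) * profile \<sigma> \<rho>"
proof (cases "\<rho> \<le> 1")
  case True
  have "exp (- \<epsilon> * \<rho>) \<le> 1" using assms by simp
  also have "1 \<le> 1 / \<epsilon>" using assms by simp
  finally show ?thesis using True by (intro mult_mono) (auto simp: min_absorb2 intro: ennreal_leI)
next
  case False
  have P: "profile \<sigma> 1 = 1" by (simp add: profile_def)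
  have "exp (- (\<epsilon> * \<rho>)) \<le> 1 / (\<epsilon> * \<rho>)" by (rule exp_minus_le_inverse) (use assms False in auto)
  also have "\<dots> = 1 / \<epsilon> * (1 / max 1 \<rho>)" using False by (simp add: max_absorb2)
  finally have "ennreal (exp (- \<epsilon> * \<rho>)) \<le> ennreal (1 / \<epsilon> * (1 / max 1 \<rho>))" by (intro ennreal_leI) simp
  also have "\<dots> = ennreal (1 / \<epsilon>) * ennreal (1 / max 1 \<rho>)" using assms by (intro ennreal_mult') simp
  also have "\<dots> \<le> ennreal (1 / \<epsilon>) * profile \<sigma> \<rho>"
    by (intro mult_left_mono profile_ge_inverse) (use assms in auto)
  finally show ?thesis using False by (simp add: min_absorb1 P)
qed

text \<open>This disposes of the times \<open>t \<ge> 1\<close>. Since \<open>d \<le> A\<close>, \<open>\<rho> = A d\<close> is at most \<open>A\<^sup>2\<close>: half of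
  \<open>exp (-A\<^sup>2 / 16)\<close> bounds \<open>exp (-\<rho> / 32)\<close> and the other half beats all powers of \<open>A\<close>.\<close>
lemma exp_square_le_profile:
  fixes \<sigma> s :: real
  assumes "\<sigma> > 0"
  shows "\<exists>C>0. \<forall>A\<ge>1. \<forall>\<rho>. 0 \<le> \<rho> \<longrightarrow> \<rho> \<le> A\<^sup>2 \<longrightarrow>
     ennreal (exp (- (1 / 16) * A\<^sup>2)) \<le> ennreal (C * A powr s) * profile \<sigma> \<rho> * ennreal (exp (- (1 / 32) * \<rho>))"
proof -
  define q where "q = \<bar>s - 2\<bar> / 2"
  obtain C where C: "C > 0" "\<And>v. v \<ge> 0 \<Longrightarrow> (1 + v) powr q \<le> C * exp (1 / 32 * v)"
    using powr_le_exp[of "1 / 32" q] by auto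
  show ?thesis
  proof (intro exI[of _ C] conjI allI impI C)
    fix A \<rho> :: real assume A: "A \<ge> 1" and r: "0 \<le> \<rho>" "\<rho> \<le> A\<^sup>2"
    have A1: "1 \<le> A\<^sup>2" using A by (rule one_le_power)
    have "A powr (- (s - 2)) \<le> A powr (2 * q)" using A by (intro powr_mono) (auto simp: q_def)
    also have "\<dots> = (A\<^sup>2) powr q" using A by (simp add: power2_powr)
    also have "\<dots> \<le> (1 + A\<^sup>2) powr q" by (intro powr_mono2) (auto simp: q_def)
    also have "\<dots> \<le> C * exp (1 / 32 * A\<^sup>2)" by (rule C) simp
    finally have "A powr (- (s - 2)) \<le> C * exp (1 / 32 * A\<^sup>2)" .
    then have "A powr (s - 2) * A powr (- (s - 2)) * exp (- (1 / 32) * A\<^sup>2) \<le> A powr (s - 2) * (C * exp (1 / 32 * A\<^sup>2)) * exp (- (1 / 32) * A\<^sup>2)"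
      by (intro mult_right_mono mult_left_mono) auto
    also have "A powr (s - 2) * A powr (- (s - 2)) = 1"
      by (simp only: powr_add[symmetric]) (use A in simp)
    also have "A powr (s - 2) * (C * exp (1 / 32 * A\<^sup>2)) * exp (- (1 / 32) * A\<^sup>2) = C * A powr (s - 2)"
      by (simp add: exp_minus)
    finally have "exp (- (1 / 32) * A\<^sup>2) \<le> C * A powr (s - 2)" by simp
    also have "A powr (s - 2) = A powr s * (1 / A\<^sup>2)"
      using A by (simp add: powr_diff)
    also have "C * (A powr s * (1 / A\<^sup>2)) \<le> C * (A powr s * (1 / max 1 \<rho>))"
      using C A A1 r by (intro mult_left_mono divide_left_mono) (auto intro!: mult_pos_pos)
    finally have 1: "exp (- (1 / 32) * A\<^sup>2) \<le> C * A powr s * (1 / max 1 \<rho>)" by (simp add: mult.assoc)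
    have "exp (- (1 / 16) * A\<^sup>2) = exp (- (1 / 32) * A\<^sup>2) * exp (- (1 / 32) * A\<^sup>2)"
      by (simp add: exp_add[symmetric])
    also have "\<dots> \<le> (C * A powr s * (1 / max 1 \<rho>)) * exp (- (1 / 32) * \<rho>)"
      using 1 r C(1) by (intro mult_mono) (auto intro!: divide_nonneg_nonneg)
    finally have "ennreal (exp (- (1 / 16) * A\<^sup>2)) \<le> ennreal ((C * A powr s * (1 / max 1 \<rho>)) * exp (- (1 / 32) * \<rho>))"
      by (rule ennreal_leI)
    also have "\<dots> = ennreal (C * A powr s) * ennreal (1 / max 1 \<rho>) * ennreal (exp (- (1 / 32) * \<rho>))"
      using C by (simp only: ennreal_mult' ennreal_mult'' zero_le_divide_1_iff exp_ge_zero mult_nonneg_nonneg powr_ge_zero less_imp_le)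
    also have "\<dots> \<le> ennreal (C * A powr s) * profile \<sigma> \<rho> * ennreal (exp (- (1 / 32) * \<rho>))"
      by (intro mult_right_mono mult_left_mono profile_ge_inverse) (use assms r in auto)
    finally show "ennreal (exp (- (1 / 16) * A\<^sup>2)) \<le> ennreal (C * A powr s) * profile \<sigma> \<rho> * ennreal (exp (- (1 / 32) * \<rho>))" .
  qed
qed

text \<open>The times are split at \<open>1/A\<^sup>2\<close> and \<open>1\<close>. Half of the exponent is spent on \<open>exp (-\<rho> / 16)\<close> with
  \<open>\<rho> = A d\<close>; the other half is kept as \<open>exp (-d\<^sup>2 / (32 t))\<close> for short times and as \<open>exp (-A\<^sup>2 t / 32)\<close>
  for intermediate ones.\<close>
lemma kernel_integral_upper_large:
  fixes \<alpha> \<sigma> :: real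
  assumes "\<alpha> > -1" "\<sigma> > 0"
  shows "\<exists>C>0. \<forall>x>0. \<forall>y>0. x + y > 1 \<longrightarrow> kernel_integral \<alpha> \<sigma> x y
     \<le> ennreal C * (ennreal ((x + y) powr (- 2 * \<alpha> - 2 * \<sigma>)) * profile \<sigma> (\<bar>x - y\<bar> * (x + y))
         * ennreal (exp (- (1 / 32) * (\<bar>x - y\<bar> * (x + y)))))"
proof -
  define \<beta> where "\<beta> = - \<alpha> - 1 / 2"
  define s where "s = - 2 * \<alpha> - 2 * \<sigma>"
  obtain C1 where C1: "C1 > 0" and
    K1: "\<And>k t x y u \<sigma> w. 0 < t \<Longrightarrow> t \<le> 1 \<Longrightarrow> 0 < x \<Longrightarrow> 0 < y \<Longrightarrow> 0 < u \<Longrightarrow> 1 \<le> k \<Longrightarrow>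
     u \<le> k * (t + (x + y)\<^sup>2) \<Longrightarrow> t + (x + y)\<^sup>2 \<le> k * u \<Longrightarrow>
     w \<le> 1 / 16 * ((x + y)\<^sup>2 * t + (x - y)\<^sup>2 / t) \<Longrightarrow>
     laguerre_heat_kernel \<alpha> t x y * t powr (\<sigma> - 1)
       \<le> C1 * k powr \<bar>\<alpha> + 1 / 2\<bar> * (t powr (\<sigma> - 3 / 2) * u powr \<beta> * exp (- w))"
    using small_time_upper_pointwise[OF assms(1)] unfolding \<beta>_def by blast
  obtain C2 where C2: "C2 > 0" and
    K2: "\<And>t x y \<sigma>. 1 \<le> t \<Longrightarrow> 0 < x \<Longrightarrow> 0 < y \<Longrightarrow>
     laguerre_heat_kernel \<alpha> t x y * t powr (\<sigma> - 1)
       \<le> C2 * exp (- (1 / 16) * (x + y)\<^sup>2) * (t powr (\<sigma> - 1) * exp (- (2 * (\<alpha> + 1)) * t))"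
    using large_time_upper_pointwise[OF assms(1)] by blast
  obtain C3 where C3: "C3 > 0" and
    K3: "\<And>a d. a > 0 \<Longrightarrow> d \<ge> 0 \<Longrightarrow> gauss_power_integral (1 / 32) \<sigma> a d
           \<le> ennreal (C3 * a powr (2 * \<sigma> - 1)) * profile \<sigma> (min 1 (d / a))"
    using gauss_power_integral_upper[of "1 / 32" \<sigma>] assms by auto
  obtain C4 where C4: "C4 > 0" and
    K4: "\<And>v. v \<ge> 0 \<Longrightarrow> (1 + v) powr (\<sigma> + 1 / 2) \<le> C4 * exp (1 / 32 * v)"
    using powr_le_exp[of "1 / 32" "\<sigma> + 1 / 2"] by auto
  obtain C5 where C5: "C5 > 0" and
    K5: "(\<integral>\<^sup>+t\<in>{1..}. ennreal (t powr (\<sigma> - 1) * exp (- (2 * (\<alpha> + 1)) * t)) \<partial>lborel) \<le> ennreal C5"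
    using set_nn_integral_powr_exp_finite[of "2 * (\<alpha> + 1)" "\<sigma> - 1"] assms by auto
  obtain C6 where C6: "C6 > 0" and
    K6: "\<And>A \<rho>. A \<ge> 1 \<Longrightarrow> 0 \<le> \<rho> \<Longrightarrow> \<rho> \<le> A\<^sup>2 \<Longrightarrow>
     ennreal (exp (- (1 / 16) * A\<^sup>2)) \<le> ennreal (C6 * A powr s) * profile \<sigma> \<rho> * ennreal (exp (- (1 / 32) * \<rho>))"
    using exp_square_le_profile[OF assms(2), of s] by blast
  define B where "B = C1 * 2 powr \<bar>\<alpha> + 1 / 2\<bar>"
  have B: "B > 0" using C1 by (simp add: B_def)
  define C where "C = B * C3 * 32 + B * C4 * 32 + C2 * C5 * C6"
  have C: "C > 0" using B C2 C3 C4 C5 C6 by (simp add: C_def add_pos_pos)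
  show ?thesis
  proof (intro exI[of _ C] conjI allI impI C)
    fix x y :: real assume x: "x > 0" and y: "y > 0" and xy: "x + y > 1"
    define A d \<rho> where "A = x + y" and "d = \<bar>x - y\<bar>" and "\<rho> = \<bar>x - y\<bar> * (x + y)"
    have A: "0 < A" "1 \<le> A" using xy by (auto simp: A_def)
    have d: "0 \<le> d" "d \<le> A" "d\<^sup>2 = (x - y)\<^sup>2" using x y by (auto simp: A_def d_def)
    have \<rho>: "\<rho> = d * A" by (simp add: \<rho>_def d_def A_def)
    have r: "0 \<le> \<rho>" "\<rho> \<le> A\<^sup>2"
      using A d mult_right_mono[of d A A] by (auto simp: \<rho> power2_eq_square)
    have A2: "1 \<le> A\<^sup>2" using A by (intro one_le_power)
    define a where "a = 1 / A"
    have a: "0 < a" "a \<le> 1" "0 < a\<^sup>2" "a\<^sup>2 \<le> 1" "A\<^sup>2 * a\<^sup>2 = 1"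
      using A A2 by (auto simp: a_def power_one_over)
    define E where "E = exp (- (1 / 32) * \<rho>)"
    define P where "P = profile \<sigma> (min 1 \<rho>)"
    define Y where "Y = ennreal (A powr s) * profile \<sigma> \<rho> * ennreal E"
    have P1: "1 \<le> P" unfolding P_def by (rule profile_ge_1) (use r in auto)
    have PY: "ennreal (A powr s * exp (- (1 / 16) * \<rho>)) * P \<le> ennreal 32 * Y"
    proof -
      have "exp (- (1 / 16) * \<rho>) = E * exp (- (1 / 32) * \<rho>)" by (simp add: E_def exp_add[symmetric])
      then have "ennreal (A powr s * exp (- (1 / 16) * \<rho>)) * P
         = ennreal (A powr s) * ennreal E * (ennreal (exp (- (1 / 32) * \<rho>)) * P)"
        by (simp add: ennreal_mult' E_def mult_ac)
      also have "\<dots> \<le> ennreal (A powr s) * ennreal E * (ennreal (1 / (1 / 32)) * profile \<sigma> \<rho>)"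
        unfolding P_def by (intro mult_left_mono profile_min_exp_le) (use assms r in auto)
      also have "\<dots> = ennreal 32 * Y" by (simp add: Y_def mult_ac)
      finally show ?thesis .
    qed
    \<comment> \<open>one half of the exponent is at least \<open>\<rho> / 16\<close> by \<open>2 A d \<le> A\<^sup>2 t + d\<^sup>2 / t\<close>\<close>
    have amgm: "1 / 16 * \<rho> + 1 / 32 * (A\<^sup>2 * t + d\<^sup>2 / t) \<le> 1 / 16 * ((x + y)\<^sup>2 * t + (x - y)\<^sup>2 / t)" if t: "t > 0" for t
    proof -
      have "2 * (A * t) * d \<le> (A * t)\<^sup>2 + d\<^sup>2" by (rule sum_squares_bound)
      then have "(2 * (A * t) * d) / t \<le> ((A * t)\<^sup>2 + d\<^sup>2) / t" using t by (intro divide_right_mono) auto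
      also have "(2 * (A * t) * d) / t = 2 * \<rho>" using t by (simp add: \<rho>)
      also have "((A * t)\<^sup>2 + d\<^sup>2) / t = A\<^sup>2 * t + d\<^sup>2 / t" using t by (simp add: power2_eq_square add_divide_distrib)
      finally have le: "2 * \<rho> \<le> A\<^sup>2 * t + d\<^sup>2 / t" .
      have "1 / 16 * \<rho> + 1 / 32 * q \<le> 1 / 16 * q" if "2 * \<rho> \<le> q" for q using that by simp
      from this[OF le] show ?thesis unfolding A_def[symmetric] d(3)[symmetric] .
    qed
    define k where "k = B * (A\<^sup>2) powr \<beta> * exp (- (1 / 16) * \<rho>)"
    have k: "k > 0" using B A by (simp add: k_def)
    have small: "laguerre_heat_kernel \<alpha> t x y * t powr (\<sigma> - 1)
       \<le> k * (t powr (\<sigma> - 3 / 2) * exp (- (1 / 32 * (A\<^sup>2 * t + d\<^sup>2 / t))))" if t: "0 < t" "t \<le> 1" for t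
    proof -
      have "laguerre_heat_kernel \<alpha> t x y * t powr (\<sigma> - 1)
        \<le> C1 * 2 powr \<bar>\<alpha> + 1 / 2\<bar> * (t powr (\<sigma> - 3 / 2) * (A\<^sup>2) powr \<beta> * exp (- (1 / 16 * \<rho> + 1 / 32 * (A\<^sup>2 * t + d\<^sup>2 / t))))"
        by (rule K1[OF t x y _ _ _ _ amgm[OF t(1)]]) (use t A order_trans[OF t(2) A2] in \<open>auto simp: A_def[symmetric]\<close>)
      also have "exp (- (1 / 16 * \<rho> + 1 / 32 * (A\<^sup>2 * t + d\<^sup>2 / t))) = exp (- (1 / 16) * \<rho>) * exp (- (1 / 32 * (A\<^sup>2 * t + d\<^sup>2 / t)))"
        by (simp only: exp_add[symmetric]) simp
      finally show ?thesis unfolding k_def B_def by (simp only: mult_ac)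
    qed
    \<comment> \<open>for \<open>v = A\<^sup>2 t \<ge> 1\<close>, \<open>exp (-v / 32)\<close> is traded for \<open>v powr (-\<sigma> - 1/2)\<close>, an exponent chosen to leave exactly \<open>t powr (-2)\<close>\<close>
    define l where "l = k * (C4 * A powr (- 2 * \<sigma> - 1))"
    have l: "l > 0" using k C4 A by (simp add: l_def)
    have "kernel_integral \<alpha> \<sigma> x y \<le>
        ennreal k * (\<integral>\<^sup>+t\<in>{0<..a\<^sup>2}. ennreal (t powr (\<sigma> - 3 / 2) * exp (- (1 / 32) * (d\<^sup>2 / t))) \<partial>lborel)
      + ennreal l * (\<integral>\<^sup>+t\<in>{a\<^sup>2..1}. ennreal (t powr (- 2)) \<partial>lborel)
      + ennreal (C2 * exp (- (1 / 16) * A\<^sup>2)) * (\<integral>\<^sup>+t\<in>{1..}. ennreal (t powr (\<sigma> - 1) * exp (- (2 * (\<alpha> + 1)) * t)) \<partial>lborel)"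
      unfolding kernel_integral_def
    proof (rule set_nn_integral_le_cover)
      fix t :: real assume "t \<in> {0<..}"
      then have t0: "t > 0" by simp
      { assume t: "t \<in> {0<..a\<^sup>2}"
        have "laguerre_heat_kernel \<alpha> t x y * t powr (\<sigma> - 1)
          \<le> k * (t powr (\<sigma> - 3 / 2) * exp (- (1 / 32 * (A\<^sup>2 * t + d\<^sup>2 / t))))"
          by (rule small) (use t a in auto)
        also have "\<dots> \<le> k * (t powr (\<sigma> - 3 / 2) * exp (- (1 / 32) * (d\<^sup>2 / t)))"
          using k t0 by (intro mult_left_mono) auto
        finally show "laguerre_heat_kernel \<alpha> t x y * t powr (\<sigma> - 1)
          \<le> k * (t powr (\<sigma> - 3 / 2) * exp (- (1 / 32) * (d\<^sup>2 / t)))" . }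
      { assume t: "t \<in> {a\<^sup>2..1}"
        define v where "v = A\<^sup>2 * t"
        have v: "v > 0" using t0 A by (simp add: v_def)
        have "v powr (\<sigma> + 1 / 2) \<le> (1 + v) powr (\<sigma> + 1 / 2)"
          using v assms by (intro powr_mono2) auto
        also have "\<dots> \<le> C4 * exp (1 / 32 * v)" using v by (intro K4) simp
        finally have "v powr (- (\<sigma> + 1 / 2)) * (v powr (\<sigma> + 1 / 2)) * exp (- (1 / 32) * v)
           \<le> v powr (- (\<sigma> + 1 / 2)) * (C4 * exp (1 / 32 * v)) * exp (- (1 / 32) * v)"
          by (intro mult_right_mono mult_left_mono) auto
        also have "v powr (- (\<sigma> + 1 / 2)) * (v powr (\<sigma> + 1 / 2)) = 1"
          using v by (simp only: powr_add[symmetric]) simp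
        also have "v powr (- (\<sigma> + 1 / 2)) * (C4 * exp (1 / 32 * v)) * exp (- (1 / 32) * v)
           = C4 * v powr (- (\<sigma> + 1 / 2))" by (simp add: exp_minus)
        finally have ev: "exp (- (1 / 32) * v) \<le> C4 * v powr (- (\<sigma> + 1 / 2))" by simp
        have "exp (- (1 / 32 * (A\<^sup>2 * t + d\<^sup>2 / t))) \<le> exp (- (1 / 32) * v)"
          using t0 by (simp add: v_def)
        also note ev
        also have "v powr (- (\<sigma> + 1 / 2)) = A powr (- 2 * \<sigma> - 1) * t powr (- (\<sigma> + 1 / 2))"
          using A by (simp add: v_def powr_mult power2_powr algebra_simps)
        finally have "k * (t powr (\<sigma> - 3 / 2) * exp (- (1 / 32 * (A\<^sup>2 * t + d\<^sup>2 / t))))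
            \<le> k * (t powr (\<sigma> - 3 / 2) * (C4 * (A powr (- 2 * \<sigma> - 1) * t powr (- (\<sigma> + 1 / 2)))))"
          using k by (intro mult_left_mono) auto
        also have "\<dots> = l * (t powr (\<sigma> - 3 / 2) * t powr (- (\<sigma> + 1 / 2)))" by (simp only: l_def mult_ac)
        also have "t powr (\<sigma> - 3 / 2) * t powr (- (\<sigma> + 1 / 2)) = t powr (- 2)"
          by (simp only: powr_add[symmetric]) simp
        finally show "laguerre_heat_kernel \<alpha> t x y * t powr (\<sigma> - 1) \<le> l * t powr (- 2)"
          using small[of t] t t0 by (intro order_trans[OF small]) auto }
      { assume t: "t \<in> {1..}"
        show "laguerre_heat_kernel \<alpha> t x y * t powr (\<sigma> - 1)
          \<le> C2 * exp (- (1 / 16) * A\<^sup>2) * (t powr (\<sigma> - 1) * exp (- (2 * (\<alpha> + 1)) * t))"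
          unfolding A_def by (rule K2) (use t x y in auto) }
    qed (use k l C2 in auto)
    also have "\<dots> \<le> ennreal (B * C3 * 32) * Y + ennreal (B * C4 * 32) * Y + ennreal (C2 * C5 * C6) * Y"
    proof (intro add_mono)
      have s1: "(A\<^sup>2) powr \<beta> * a powr (2 * \<sigma> - 1) = A powr s"
      proof -
        have "a powr (2 * \<sigma> - 1) = A powr (- (2 * \<sigma> - 1))"
          unfolding a_def powr_minus_divide using A by (simp add: powr_divide)
        then show ?thesis using A
          by (simp add: power2_powr powr_add[symmetric] \<beta>_def s_def)
      qed
      have s2: "(A\<^sup>2) powr \<beta> * (A powr (- 2 * \<sigma> - 1) * A\<^sup>2) = A powr s"
      proof -
        have "A powr (- 2 * \<sigma> - 1) * A\<^sup>2 = A powr (1 - 2 * \<sigma>)"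
          using A powr_add[of A "- 2 * \<sigma> - 1" 2] by simp
        moreover have "(A\<^sup>2) powr \<beta> = A powr (2 * \<beta>)" using A by (simp add: power2_powr)
        ultimately show ?thesis
          by (simp add: powr_add[symmetric] \<beta>_def s_def)
      qed
      have "ennreal k * gauss_power_integral (1 / 32) \<sigma> a d \<le> ennreal (k * (C3 * a powr (2 * \<sigma> - 1))) * P"
      proof (rule ennreal_cmult_le)
        have "d / a = \<rho>" by (simp add: a_def \<rho>)
        then show "gauss_power_integral (1 / 32) \<sigma> a d \<le> ennreal (C3 * a powr (2 * \<sigma> - 1)) * P"
          using K3[OF a(1) d(1)] by (simp add: P_def)
      qed (use k in simp)
      also have "k * (C3 * a powr (2 * \<sigma> - 1)) = B * C3 * (((A\<^sup>2) powr \<beta> * a powr (2 * \<sigma> - 1)) * exp (- (1 / 16) * \<rho>))"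
        unfolding k_def by (simp only: mult_ac)
      also have "ennreal \<dots> * P = ennreal (B * C3) * (ennreal (A powr s * exp (- (1 / 16) * \<rho>)) * P)"
        unfolding s1 using B C3 by (simp only: ennreal_mult' mult.assoc mult_nonneg_nonneg less_imp_le)
      also have "\<dots> \<le> ennreal (B * C3 * 32) * Y"
        by (rule ennreal_cmult_le[OF PY]) (use B C3 in simp)
      finally show "ennreal k * (\<integral>\<^sup>+t\<in>{0<..a\<^sup>2}. ennreal (t powr (\<sigma> - 3 / 2) * exp (- (1 / 32) * (d\<^sup>2 / t))) \<partial>lborel)
         \<le> ennreal (B * C3 * 32) * Y" unfolding gauss_power_integral_def .
      have "(\<integral>\<^sup>+t\<in>{a\<^sup>2..1}. ennreal (t powr (- 2)) \<partial>lborel) \<le> ennreal ((a\<^sup>2) powr (- 2 + 1) / (- (- 2) - 1))"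
        by (rule set_nn_integral_powr_to_inf) (use a in auto)
      also have "(a\<^sup>2) powr (- 2 + 1) / (- (- 2) - 1) = A\<^sup>2"
        using a A by (simp add: powr_minus a_def power_one_over)
      finally have "ennreal l * (\<integral>\<^sup>+t\<in>{a\<^sup>2..1}. ennreal (t powr (- 2)) \<partial>lborel) \<le> ennreal l * ennreal (A\<^sup>2)"
        by (rule mult_left_mono) simp
      also have "\<dots> = ennreal (l * A\<^sup>2)" using l by (simp add: ennreal_mult')
      also have "l * A\<^sup>2 = B * C4 * (((A\<^sup>2) powr \<beta> * (A powr (- 2 * \<sigma> - 1) * A\<^sup>2)) * exp (- (1 / 16) * \<rho>))"
        unfolding l_def k_def by (simp only: mult_ac)
      also have "ennreal \<dots> = ennreal (B * C4) * (ennreal (A powr s * exp (- (1 / 16) * \<rho>)) * 1)"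
        unfolding s2 using B C4 by (simp only: ennreal_mult' mult.assoc mult_nonneg_nonneg less_imp_le mult_1_right)
      also have "\<dots> \<le> ennreal (B * C4) * (ennreal (A powr s * exp (- (1 / 16) * \<rho>)) * P)"
        by (intro mult_left_mono P1) auto
      also have "\<dots> \<le> ennreal (B * C4 * 32) * Y"
        by (rule ennreal_cmult_le[OF PY]) (use B C4 in simp)
      finally show "ennreal l * (\<integral>\<^sup>+t\<in>{a\<^sup>2..1}. ennreal (t powr (- 2)) \<partial>lborel) \<le> ennreal (B * C4 * 32) * Y" .
      have "ennreal (C2 * exp (- (1 / 16) * A\<^sup>2)) * (\<integral>\<^sup>+t\<in>{1..}. ennreal (t powr (\<sigma> - 1) * exp (- (2 * (\<alpha> + 1)) * t)) \<partial>lborel)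
         \<le> ennreal (C2 * exp (- (1 / 16) * A\<^sup>2)) * ennreal C5"
        by (rule mult_left_mono[OF K5]) simp
      also have "\<dots> = ennreal (C2 * C5) * ennreal (exp (- (1 / 16) * A\<^sup>2))"
        using C2 C5 by (simp add: ennreal_mult' mult_ac)
      also have "\<dots> \<le> ennreal (C2 * C5) * (ennreal (C6 * A powr s) * profile \<sigma> \<rho> * ennreal (exp (- (1 / 32) * \<rho>)))"
        by (intro mult_left_mono K6) (use A r in auto)
      also have "\<dots> = ennreal (C2 * C5 * C6) * Y"
        using C2 C5 C6 by (simp add: ennreal_mult' Y_def E_def mult.assoc)
      finally show "ennreal (C2 * exp (- (1 / 16) * A\<^sup>2)) * (\<integral>\<^sup>+t\<in>{1..}. ennreal (t powr (\<sigma> - 1) * exp (- (2 * (\<alpha> + 1)) * t)) \<partial>lborel)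
         \<le> ennreal (C2 * C5 * C6) * Y" .
    qed
    also have "\<dots> = ennreal C * Y"
      unfolding C_def using B C2 C3 C4 C5 C6
      by (simp only: distrib_right[symmetric] ennreal_plus[symmetric] mult_nonneg_nonneg add_nonneg_nonneg less_imp_le zero_le_numeral)
    finally show "kernel_integral \<alpha> \<sigma> x y
     \<le> ennreal C * (ennreal ((x + y) powr (- 2 * \<alpha> - 2 * \<sigma>)) * profile \<sigma> (\<bar>x - y\<bar> * (x + y))
         * ennreal (exp (- (1 / 32) * (\<bar>x - y\<bar> * (x + y)))))"
      unfolding Y_def E_def \<rho>_def A_def s_def .
  qed
qed

lemma profile_le_1:
  assumes "r > 1"
  shows "profile \<sigma> r \<le> 1"
proof -
  have "r powr (2 * \<sigma> - 1) \<le> 1 powr (2 * \<sigma> - 1)" if "\<sigma> < 1 / 2"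
    by (rule powr_mono2') (use assms that in auto)
  moreover have "ln (1 / r) \<le> 0" using assms by (simp add: ln_div)
  ultimately show ?thesis using assms by (auto simp: profile_def max_absorb1)
qed

text \<open>The exponent \<open>A\<^sup>2 t + d\<^sup>2 / t\<close> is least at \<open>t = d / A\<close>, so the dyadic block below this point is
  integrated, where the exponent is at most \<open>3 A d\<close>. It lies in \<open>(0, 1]\<close> because \<open>d \<le> A\<close>.\<close>
lemma kernel_integral_lower_far:
  fixes \<alpha> \<sigma> :: real
  assumes "\<alpha> > -1" "\<sigma> > 0"
  shows "\<exists>C>0. \<forall>x>0. \<forall>y>0. x + y > 1 \<longrightarrow> \<bar>x - y\<bar> * (x + y) > 1 \<longrightarrow>
     ennreal ((x + y) powr (- 2 * \<alpha> - 2 * \<sigma>) * exp (- 4 * (\<bar>x - y\<bar> * (x + y))))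
     \<le> ennreal C * kernel_integral \<alpha> \<sigma> x y"
proof -
  define \<beta> where "\<beta> = - \<alpha> - 1 / 2"
  define p where "p = \<sigma> - 3 / 2"
  obtain C1 where C1: "C1 > 0" and
    K1: "\<And>k t x y u \<sigma> w. 0 < t \<Longrightarrow> t \<le> 1 \<Longrightarrow> 0 < x \<Longrightarrow> 0 < y \<Longrightarrow> 0 < u \<Longrightarrow> 1 \<le> k \<Longrightarrow>
     u \<le> k * (t + (x + y)\<^sup>2) \<Longrightarrow> t + (x + y)\<^sup>2 \<le> k * u \<Longrightarrow> (x + y)\<^sup>2 * t + (x - y)\<^sup>2 / t \<le> w \<Longrightarrow>
     t powr (\<sigma> - 3 / 2) * u powr \<beta> * exp (- w)
       \<le> C1 * k powr \<bar>\<alpha> + 1 / 2\<bar> * (laguerre_heat_kernel \<alpha> t x y * t powr (\<sigma> - 1))"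
    using small_time_lower_pointwise[OF assms(1)] unfolding \<beta>_def by blast
  define B where "B = C1 * 2 powr \<bar>\<alpha> + 1 / 2\<bar>"
  have B: "B > 0" using C1 by (simp add: B_def)
  define n where "n = 2 powr (- \<bar>p\<bar>) / 2"
  have n: "n > 0" by (simp add: n_def)
  show ?thesis
  proof (intro exI[of _ "1 / n * B"] conjI allI impI)
    show "1 / n * B > 0" using B n by simp
    fix x y :: real assume x: "x > 0" and y: "y > 0" and xy: "x + y > 1" and r1: "\<bar>x - y\<bar> * (x + y) > 1"
    define A d \<rho> where "A = x + y" and "d = \<bar>x - y\<bar>" and "\<rho> = \<bar>x - y\<bar> * (x + y)"
    have A: "0 < A" "1 \<le> A" using xy by (auto simp: A_def)
    have d: "0 \<le> d" "d \<le> A" "d\<^sup>2 = (x - y)\<^sup>2" using x y by (auto simp: A_def d_def)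
    have \<rho>: "\<rho> = d * A" by (simp add: \<rho>_def d_def A_def)
    have r: "1 < \<rho>" using r1 by (simp add: \<rho>_def)
    have d0: "d > 0" using r d by (cases "d = 0") (auto simp: \<rho>)
    have A2: "1 \<le> A\<^sup>2" using A by (intro one_le_power)
    define u where "u = d / A"
    have u: "0 < u" "u \<le> 1" using d0 d A by (auto simp: u_def)
    define E where "E = exp (- (3 * \<rho>))"
    have low: "(A\<^sup>2) powr \<beta> * E * (2 powr (- \<bar>p\<bar>) * u powr p)
        \<le> B * (laguerre_heat_kernel \<alpha> t x y * t powr (\<sigma> - 1))" if t: "t \<in> {u / 2..u}" for t
    proof -
      have t0: "0 < t" "t \<le> 1" using t u by auto
      have "A\<^sup>2 * t \<le> A\<^sup>2 * u" using t by (intro mult_left_mono) auto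
      also have "\<dots> = \<rho>" using A by (simp add: u_def \<rho> power2_eq_square)
      finally have 1: "A\<^sup>2 * t \<le> \<rho>" .
      have "d\<^sup>2 / t \<le> d\<^sup>2 / (u / 2)" using t u t0 by (intro divide_left_mono) auto
      also have "\<dots> = 2 * \<rho>" using A d0 by (simp add: u_def \<rho> power2_eq_square)
      finally have w: "(x + y)\<^sup>2 * t + (x - y)\<^sup>2 / t \<le> 3 * \<rho>" using 1 by (simp add: A_def d(3))
      have "2 powr (- \<bar>p\<bar>) * u powr p \<le> t powr p"
        by (rule powr_half_interval) (use t u in auto)
      then have "(A\<^sup>2) powr \<beta> * E * (2 powr (- \<bar>p\<bar>) * u powr p) \<le> (A\<^sup>2) powr \<beta> * E * t powr p"
        by (rule mult_left_mono) (simp add: E_def)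
      also have "\<dots> = t powr (\<sigma> - 3 / 2) * (A\<^sup>2) powr \<beta> * exp (- (3 * \<rho>))"
        by (simp only: E_def p_def mult_ac)
      also have "\<dots> \<le> B * (laguerre_heat_kernel \<alpha> t x y * t powr (\<sigma> - 1))"
        unfolding B_def by (rule K1[OF t0 x y _ _ _ _ w]) (use t0 A order_trans[OF t0(2) A2] in \<open>auto simp: A_def[symmetric]\<close>)
      finally show ?thesis .
    qed
    have "ennreal ((A\<^sup>2) powr \<beta> * E * (2 powr (- \<bar>p\<bar>) * u powr p) * (u - u / 2))
       \<le> (\<integral>\<^sup>+t\<in>{u / 2..u}. ennreal ((A\<^sup>2) powr \<beta> * E * (2 powr (- \<bar>p\<bar>) * u powr p)) \<partial>lborel)"
      by (rule set_nn_integral_ge_const) (use u in \<open>auto simp: E_def\<close>)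
    also have "\<dots> \<le> ennreal B * kernel_integral \<alpha> \<sigma> x y"
      unfolding kernel_integral_def
      by (rule set_nn_integral_le_cmult) (use low u B in auto)
    also have "(A\<^sup>2) powr \<beta> * E * (2 powr (- \<bar>p\<bar>) * u powr p) * (u - u / 2)
       = n * ((A\<^sup>2) powr \<beta> * (u powr p * u powr 1) * E)"
      using u by (simp add: n_def)
    also have "u powr p * u powr 1 = u powr (\<sigma> - 1 / 2)"
      by (simp only: powr_add[symmetric]) (simp add: p_def)
    finally have "ennreal (1 / n) * ennreal (n * ((A\<^sup>2) powr \<beta> * u powr (\<sigma> - 1 / 2) * E)) \<le> ennreal (1 / n * B) * kernel_integral \<alpha> \<sigma> x y"
      by (rule ennreal_cmult_le) (use n in simp)
    moreover have "ennreal (1 / n) * ennreal (n * ((A\<^sup>2) powr \<beta> * u powr (\<sigma> - 1 / 2) * E)) = ennreal ((A\<^sup>2) powr \<beta> * u powr (\<sigma> - 1 / 2) * E)"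
      using n by (simp add: ennreal_mult'[symmetric])
    moreover have "A powr (- 2 * \<alpha> - 2 * \<sigma>) * exp (- 4 * \<rho>) \<le> (A\<^sup>2) powr \<beta> * u powr (\<sigma> - 1 / 2) * E"
    proof -
      have uA: "u = \<rho> * A powr (- 2)" using A by (simp add: u_def \<rho> powr_minus_divide power2_eq_square)
      have "exp (- \<rho>) \<le> 1 / \<rho>" by (rule exp_minus_le_inverse) (use r in simp)
      also have "\<dots> = \<rho> powr (- 1)" using r by (simp add: powr_minus_divide)
      also have "\<dots> \<le> \<rho> powr (\<sigma> - 1 / 2)" using r assms by (intro powr_mono) auto
      finally have "A powr (- 2 * \<alpha> - 2 * \<sigma>) * exp (- \<rho>) * E \<le> A powr (- 2 * \<alpha> - 2 * \<sigma>) * \<rho> powr (\<sigma> - 1 / 2) * E"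
        by (intro mult_right_mono mult_left_mono) (auto simp: E_def)
      also have "A powr (- 2 * \<alpha> - 2 * \<sigma>) = (A\<^sup>2) powr \<beta> * (A powr (- 2)) powr (\<sigma> - 1 / 2)"
        using A by (simp add: power2_powr powr_powr powr_add[symmetric] \<beta>_def algebra_simps)
      also have "(A\<^sup>2) powr \<beta> * (A powr (- 2)) powr (\<sigma> - 1 / 2) * \<rho> powr (\<sigma> - 1 / 2) * E
         = (A\<^sup>2) powr \<beta> * u powr (\<sigma> - 1 / 2) * E"
        unfolding uA powr_mult by (simp only: mult_ac)
      finally show ?thesis
        unfolding \<open>A powr (- 2 * \<alpha> - 2 * \<sigma>) = (A\<^sup>2) powr \<beta> * (A powr (- 2)) powr (\<sigma> - 1 / 2)\<close>
        by (simp add: E_def mult.assoc exp_add[symmetric])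
    qed
    ultimately have "ennreal (A powr (- 2 * \<alpha> - 2 * \<sigma>) * exp (- 4 * \<rho>)) \<le> ennreal (1 / n * B) * kernel_integral \<alpha> \<sigma> x y"
      using order_trans[OF ennreal_leI] by simp
    then show "ennreal ((x + y) powr (- 2 * \<alpha> - 2 * \<sigma>) * exp (- 4 * (\<bar>x - y\<bar> * (x + y))))
     \<le> ennreal (1 / n * B) * kernel_integral \<alpha> \<sigma> x y" unfolding A_def \<rho>_def .
  qed
qed

text \<open>If \<open>A d > 1\<close>, the profile is at most \<open>1\<close> and the previous lemma applies; otherwise \<open>d \<le> 1/A\<close> and the block
  with \<open>a = 1/A\<close> suffices.\<close>
lemma kernel_integral_lower_large:
  fixes \<alpha> \<sigma> :: real
  assumes "\<alpha> > -1" "\<sigma> > 0"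
  shows "\<exists>C>0. \<forall>x>0. \<forall>y>0. x + y > 1 \<longrightarrow>
     ennreal ((x + y) powr (- 2 * \<alpha> - 2 * \<sigma>)) * profile \<sigma> (\<bar>x - y\<bar> * (x + y))
       * ennreal (exp (- 4 * (\<bar>x - y\<bar> * (x + y)))) \<le> ennreal C * kernel_integral \<alpha> \<sigma> x y"
proof -
  obtain C1 where C1: "C1 > 0" and
    K1: "\<And>x y a. 0 < x \<Longrightarrow> 0 < y \<Longrightarrow> 0 < a \<Longrightarrow> a \<le> 1 \<Longrightarrow> a \<le> x + y \<Longrightarrow> a * (x + y) \<le> 1 \<Longrightarrow>
     ennreal ((x + y) powr (- 2 * \<alpha> - 1)) * gauss_power_integral 1 \<sigma> a \<bar>x - y\<bar>
       \<le> ennreal C1 * kernel_integral \<alpha> \<sigma> x y"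
    using gauss_power_integral_le_kernel_integral[OF assms(1), of \<sigma>] by blast
  obtain C2 where C2: "C2 > 0" and
    K2: "\<And>x y. 0 < x \<Longrightarrow> 0 < y \<Longrightarrow> x + y > 1 \<Longrightarrow> \<bar>x - y\<bar> * (x + y) > 1 \<Longrightarrow>
     ennreal ((x + y) powr (- 2 * \<alpha> - 2 * \<sigma>) * exp (- 4 * (\<bar>x - y\<bar> * (x + y))))
     \<le> ennreal C2 * kernel_integral \<alpha> \<sigma> x y"
    using kernel_integral_lower_far[OF assms] by blast
  obtain C3 where C3: "C3 > 0" and
    K3: "\<And>a d. 0 < a \<Longrightarrow> 0 \<le> d \<Longrightarrow> d \<le> a \<Longrightarrow>
      ennreal (a powr (2 * \<sigma> - 1)) * profile \<sigma> (d / a) \<le> ennreal C3 * gauss_power_integral 1 \<sigma> a d"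
    using gauss_power_integral_lower[of 1 \<sigma>] assms(2) by auto
  show ?thesis
  proof (intro exI[of _ "C2 + C3 * C1"] conjI allI impI)
    show "C2 + C3 * C1 > 0" using C1 C2 C3 by (simp add: add_pos_pos)
    fix x y :: real assume x: "x > 0" and y: "y > 0" and xy: "x + y > 1"
    define A d \<rho> where "A = x + y" and "d = \<bar>x - y\<bar>" and "\<rho> = \<bar>x - y\<bar> * (x + y)"
    have A: "0 < A" "1 \<le> A" using xy by (auto simp: A_def)
    have d: "0 \<le> d" by (auto simp: d_def)
    have \<rho>: "\<rho> = d * A" by (simp add: \<rho>_def d_def A_def)
    have r0: "0 \<le> \<rho>" using A d by (simp add: \<rho>)
    have "ennreal (A powr (- 2 * \<alpha> - 2 * \<sigma>)) * profile \<sigma> \<rho> * ennreal (exp (- 4 * \<rho>)) \<le> ennreal (C2 + C3 * C1) * kernel_integral \<alpha> \<sigma> x y"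
    proof (cases "\<rho> > 1")
      case True
      have "ennreal (A powr (- 2 * \<alpha> - 2 * \<sigma>)) * profile \<sigma> \<rho> * ennreal (exp (- 4 * \<rho>))
          \<le> ennreal (A powr (- 2 * \<alpha> - 2 * \<sigma>)) * 1 * ennreal (exp (- 4 * \<rho>))"
        by (intro mult_right_mono mult_left_mono profile_le_1 True) auto
      also have "\<dots> = ennreal (A powr (- 2 * \<alpha> - 2 * \<sigma>) * exp (- 4 * \<rho>))"
        by (simp add: ennreal_mult')
      also have "\<dots> \<le> ennreal C2 * kernel_integral \<alpha> \<sigma> x y"
        unfolding A_def \<rho>_def by (rule K2) (use x y xy True in \<open>auto simp: \<rho>_def\<close>)
      also have "\<dots> \<le> ennreal (C2 + C3 * C1) * kernel_integral \<alpha> \<sigma> x y"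
        using C1 C3 by (intro mult_right_mono ennreal_leI) auto
      finally show ?thesis .
    next
      case False
      define a where "a = 1 / A"
      have a1: "0 < a" "a \<le> 1" "a * A \<le> 1" using A by (auto simp: a_def)
      have "d \<le> a" using A False by (simp add: a_def \<rho> pos_le_divide_eq)
      then have a: "0 < a" "a \<le> 1" "a \<le> A" "a * A \<le> 1" "d \<le> a"
        using a1 A by linarith+
      have da: "d / a = \<rho>" by (simp add: a_def \<rho>)
      have s: "A powr (- 2 * \<alpha> - 2 * \<sigma>) = A powr (- 2 * \<alpha> - 1) * a powr (2 * \<sigma> - 1)"
      proof -
        have "a powr (2 * \<sigma> - 1) = A powr (- (2 * \<sigma> - 1))"
          unfolding a_def powr_minus_divide using A by (simp add: powr_divide)
        then show ?thesis by (simp add: powr_add[symmetric])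
      qed
      have "ennreal (A powr (- 2 * \<alpha> - 2 * \<sigma>)) * profile \<sigma> \<rho> * ennreal (exp (- 4 * \<rho>))
         \<le> ennreal (A powr (- 2 * \<alpha> - 2 * \<sigma>)) * profile \<sigma> \<rho> * ennreal 1"
        using r0 by (intro mult_left_mono ennreal_leI) auto
      also have "\<dots> = ennreal (A powr (- 2 * \<alpha> - 1)) * (ennreal (a powr (2 * \<sigma> - 1)) * profile \<sigma> (d / a))"
        unfolding s da by (simp add: ennreal_mult' mult.assoc)
      also have "\<dots> \<le> ennreal (A powr (- 2 * \<alpha> - 1)) * (ennreal C3 * gauss_power_integral 1 \<sigma> a d)"
        by (intro mult_left_mono K3 a d) simp
      also have "\<dots> = ennreal C3 * (ennreal (A powr (- 2 * \<alpha> - 1)) * gauss_power_integral 1 \<sigma> a d)"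
        by (simp only: mult_ac)
      also have "\<dots> \<le> ennreal (C3 * C1) * kernel_integral \<alpha> \<sigma> x y"
      proof (rule ennreal_cmult_le)
        show "ennreal (A powr (- 2 * \<alpha> - 1)) * gauss_power_integral 1 \<sigma> a d \<le> ennreal C1 * kernel_integral \<alpha> \<sigma> x y"
          unfolding A_def d_def by (rule K1) (use x y a in \<open>auto simp: A_def\<close>)
      qed (use C3 in simp)
      also have "\<dots> \<le> ennreal (C2 + C3 * C1) * kernel_integral \<alpha> \<sigma> x y"
        using C2 by (intro mult_right_mono ennreal_leI) auto
      finally show ?thesis .
    qed
    then show "ennreal ((x + y) powr (- 2 * \<alpha> - 2 * \<sigma>)) * profile \<sigma> (\<bar>x - y\<bar> * (x + y))
       * ennreal (exp (- 4 * (\<bar>x - y\<bar> * (x + y)))) \<le> ennreal (C2 + C3 * C1) * kernel_integral \<alpha> \<sigma> x y"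
      unfolding A_def \<rho>_def .
  qed
qed

section \<open>The potential kernel\<close>

lemma comparable_on_enn2ereal:
  fixes X Y :: "'a \<Rightarrow> ennreal"
  assumes C: "C > 0" "D > 0"
    and lower: "\<And>p. p \<in> S \<Longrightarrow> Y p \<le> ennreal C * X p"
    and upper: "\<And>p. p \<in> S \<Longrightarrow> X p \<le> ennreal D * Y p"
  shows "comparable_on S (\<lambda>p. enn2ereal (X p)) (\<lambda>p. enn2ereal (Y p))"
  unfolding comparable_on_def
proof (intro exI[of _ "max C D"] conjI ballI)
  define M where "M = max C D"
  have M: "M > 0" "C \<le> M" "D \<le> M" using C by (auto simp: M_def)
  fix p assume p: "p \<in> S"
  have "Y p \<le> ennreal M * X p"
    using lower[OF p] by (rule order_trans) (intro mult_right_mono ennreal_leI, use M in auto)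
  then have "ennreal (inverse M) * Y p \<le> ennreal (inverse M * M) * X p"
    by (rule ennreal_cmult_le) (use M in simp)
  then have "ennreal (inverse M) * Y p \<le> X p" using M by simp
  then have "enn2ereal (ennreal (inverse M) * Y p) \<le> enn2ereal (X p)" by (simp add: less_eq_ennreal.rep_eq)
  then show "ereal (inverse (max C D)) * enn2ereal (Y p) \<le> enn2ereal (X p)"
    using M by (simp add: times_ennreal.rep_eq enn2ereal_ennreal M_def[symmetric])
  have "X p \<le> ennreal M * Y p"
    using upper[OF p] by (rule order_trans) (intro mult_right_mono ennreal_leI, use M in auto)
  then have "enn2ereal (X p) \<le> enn2ereal (ennreal M * Y p)" by (simp add: less_eq_ennreal.rep_eq)
  then show "enn2ereal (X p) \<le> ereal (max C D) * enn2ereal (Y p)"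
    using M by (simp add: times_ennreal.rep_eq enn2ereal_ennreal M_def[symmetric])
qed (use C in auto)

lemma exp_comparable_on_enn2ereal:
  fixes X Y :: "'a \<Rightarrow> ennreal" and Z :: "'a \<Rightarrow> real"
  assumes C: "C > 0" "D > 0" "c1 > 0" "c2 > 0"
    and lower: "\<And>p. p \<in> S \<Longrightarrow> Y p * ennreal (exp (- c1 * Z p)) \<le> ennreal C * X p"
    and upper: "\<And>p. p \<in> S \<Longrightarrow> X p \<le> ennreal D * (Y p * ennreal (exp (- c2 * Z p)))"
  shows "exp_comparable_on S (\<lambda>p. enn2ereal (X p)) (\<lambda>p. enn2ereal (Y p)) Z"
proof -
  define M where "M = max C D"
  have M: "M > 0" "C \<le> M" "D \<le> M" using C by (auto simp: M_def)
  show ?thesis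
    unfolding exp_comparable_on_def
  proof (rule exI[of _ M], rule exI[of _ c1], rule exI[of _ c2], intro conjI ballI M C)
    fix p assume p: "p \<in> S"
    have "Y p * ennreal (exp (- c1 * Z p)) \<le> ennreal M * X p"
      using lower[OF p] by (rule order_trans) (intro mult_right_mono ennreal_leI, use M in auto)
    then have "ennreal (inverse M) * (Y p * ennreal (exp (- c1 * Z p))) \<le> ennreal (inverse M * M) * X p"
      by (rule ennreal_cmult_le) (use M in simp)
    then have "ennreal (inverse M) * Y p * ennreal (exp (- c1 * Z p)) \<le> X p" using M by (simp add: mult.assoc)
    then have "enn2ereal (ennreal (inverse M) * Y p * ennreal (exp (- c1 * Z p))) \<le> enn2ereal (X p)"
      by (simp add: less_eq_ennreal.rep_eq)
    then show "ereal (inverse M) * enn2ereal (Y p) * ereal (exp (- c1 * Z p)) \<le> enn2ereal (X p)"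
      using M by (simp add: times_ennreal.rep_eq enn2ereal_ennreal)
    have "X p \<le> ennreal M * (Y p * ennreal (exp (- c2 * Z p)))"
      using upper[OF p] by (rule order_trans) (intro mult_right_mono ennreal_leI, use M in auto)
    then have "enn2ereal (X p) \<le> enn2ereal (ennreal M * Y p * ennreal (exp (- c2 * Z p)))"
      by (simp add: less_eq_ennreal.rep_eq mult.assoc)
    then show "enn2ereal (X p) \<le> ereal M * enn2ereal (Y p) * ereal (exp (- c2 * Z p))"
      using M by (simp add: times_ennreal.rep_eq enn2ereal_ennreal)
  qed
qed

lemma potential_kernel_eq:
  "potential_kernel \<alpha> \<sigma> x y = enn2ereal (ennreal (1 / Gamma \<sigma>) * kernel_integral \<alpha> \<sigma> x y)"
  by (simp add: potential_kernel_def kernel_integral_def)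

lemma enn2ereal_profile_near_origin:
  assumes A: "0 < A" and d: "0 \<le> d" "d \<le> A"
  shows "enn2ereal (ennreal (A powr (2 * \<sigma> - 2 * \<alpha> - 2)) * profile \<sigma> (d / A)) =
     ereal (A powr (- 2 * \<alpha> - 1)) *
       (if \<sigma> < 1 / 2 then epowr d (2 * \<sigma> - 1)
        else if \<sigma> = 1 / 2 then 1 + eln (ereal A / ereal d)
        else ereal (A powr (2 * \<sigma> - 1)))"
proof -
  have s: "A powr (2 * \<sigma> - 2 * \<alpha> - 2) = A powr (- 2 * \<alpha> - 1) * A powr (2 * \<sigma> - 1)"
    by (simp add: powr_add[symmetric] algebra_simps)
  have pos: "A powr q > 0" for q using A by simp
  consider "\<sigma> < 1 / 2" "d = 0" | "\<sigma> < 1 / 2" "d > 0" | "\<sigma> = 1 / 2" "d = 0" | "\<sigma> = 1 / 2" "d > 0" | "\<sigma> > 1 / 2"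
    using d by linarith
  then show ?thesis
  proof cases
    case 1
    then show ?thesis using pos by (simp add: profile_def epowr_def ennreal_mult_top)
  next
    case 2
    have "A powr (2 * \<sigma> - 1) * (d / A) powr (2 * \<sigma> - 1) = d powr (2 * \<sigma> - 1)"
      using A 2 by (simp add: powr_divide)
    then show ?thesis using 2 A
      by (simp add: profile_def epowr_def ennreal_mult'[symmetric] s mult.assoc enn2ereal_ennreal)
  next
    case 3
    then show ?thesis using pos A by (simp add: profile_def eln_def ennreal_mult_top)
  next
    case 4
    have "0 \<le> ln (A / d)" using 4 d by (intro ln_ge_zero) simp
    moreover have "0 < A / d" using 4 A by simp
    ultimately show ?thesis unfolding s using 4(2) A
      by (simp add: 4(1) profile_def eln_def not_le ennreal_mult'[symmetric] max_def enn2ereal_ennreal one_ereal_def del: ennreal_plus)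
  next
    case 5
    then show ?thesis unfolding s by (simp add: profile_def enn2ereal_ennreal)
  qed
qed

lemma enn2ereal_large_time_term:
  assumes "0 < A" "A \<le> 1"
  shows "enn2ereal (ennreal (large_time_term \<alpha> \<sigma> A)) =
     of_bool (\<sigma> > \<alpha> + 1) + of_bool (\<sigma> = \<alpha> + 1) * eln (1 / ereal A)"
proof -
  have "1 / ereal A = ereal (1 / A)" using assms by (simp add: one_ereal_def)
  then have "eln (1 / ereal A) = ereal (ln (1 / A))" using assms by (simp add: eln_def)
  then show ?thesis
    using large_time_term_nonneg[OF assms, of \<alpha> \<sigma>]
    by (auto simp: large_time_term_def enn2ereal_ennreal one_ennreal.rep_eq)
qed

lemma enn2ereal_profile_far:
  assumes A: "1 < A" and d: "0 \<le> d"
  shows "enn2ereal (ennreal (A powr (- 2 * \<alpha> - 2 * \<sigma>)) * profile \<sigma> (d * A)) =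
     ereal (A powr (- 2 * \<alpha> - 1)) *
       (if \<sigma> < 1 / 2 then epowr d (2 * \<sigma> - 1)
        else if \<sigma> = 1 / 2 then 1 + eln_plus (1 / ereal (d * A))
        else ereal (A powr (1 - 2 * \<sigma>)))"
proof -
  have s: "A powr (- 2 * \<alpha> - 2 * \<sigma>) = A powr (- 2 * \<alpha> - 1) * A powr (1 - 2 * \<sigma>)"
    by (simp add: powr_add[symmetric] algebra_simps)
  have pos: "A powr q > 0" for q using A by simp
  consider "\<sigma> < 1 / 2" "d = 0" | "\<sigma> < 1 / 2" "d > 0" | "\<sigma> = 1 / 2" "d = 0" | "\<sigma> = 1 / 2" "d > 0" | "\<sigma> > 1 / 2"
    using d by linarith
  then show ?thesis
  proof cases
    case 1
    then show ?thesis using pos by (simp add: profile_def epowr_def ennreal_mult_top)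
  next
    case 2
    have "A powr (1 - 2 * \<sigma>) * A powr (2 * \<sigma> - 1) = 1"
      by (simp only: powr_add[symmetric]) (use A in simp)
    then have "A powr (1 - 2 * \<sigma>) * (d * A) powr (2 * \<sigma> - 1) = d powr (2 * \<sigma> - 1)"
      by (simp add: powr_mult mult.left_commute)
    then show ?thesis unfolding s using 2 A
      by (simp add: profile_def epowr_def ennreal_mult'[symmetric] mult.assoc enn2ereal_ennreal)
  next
    case 3
    moreover have "eln_plus (1 / ereal 0) = \<infinity>"
      by (simp add: eln_plus_def eln_def divide_ereal_def)
    ultimately show ?thesis using pos A by (simp add: profile_def ennreal_mult_top)
  next
    case 4
    have "0 < d * A" using 4 A by simp
    then show ?thesis unfolding s using 4(2) A
      by (simp add: 4(1) not_le profile_def eln_plus_def eln_def ennreal_mult'[symmetric] enn2ereal_ennreal one_ereal_def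
          ereal_max[symmetric] zero_ereal_def max.commute del: ennreal_plus ereal_max)
  next
    case 5
    then show ?thesis unfolding s by (simp add: profile_def enn2ereal_ennreal)
  qed
qed

theorem theorem2p1:
  fixes \<alpha> \<sigma> :: real
  assumes "\<alpha> > -1" and "\<sigma> > 0"
  shows "comparable_on {(x, y). x > 0 \<and> y > 0 \<and> x + y \<le> 1}
           (\<lambda>(x, y). potential_kernel \<alpha> \<sigma> x y)
           (\<lambda>(x, y).
              of_bool (\<sigma> > \<alpha> + 1)
              + of_bool (\<sigma> = \<alpha> + 1) * eln (1 / ereal (x + y))
              + ereal ((x + y) powr (- 2 * \<alpha> - 1)) *
                (if \<sigma> < 1 / 2 then epowr \<bar>x - y\<bar> (2 * \<sigma> - 1)
                 else if \<sigma> = 1 / 2 then 1 + eln (ereal (x + y) / ereal \<bar>x - y\<bar>)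
                 else ereal ((x + y) powr (2 * \<sigma> - 1))))
       \<and> exp_comparable_on {(x, y). x > 0 \<and> y > 0 \<and> x + y > 1}
           (\<lambda>(x, y). potential_kernel \<alpha> \<sigma> x y)
           (\<lambda>(x, y).
              ereal ((x + y) powr (- 2 * \<alpha> - 1)) *
                (if \<sigma> < 1 / 2 then epowr \<bar>x - y\<bar> (2 * \<sigma> - 1)
                 else if \<sigma> = 1 / 2 then 1 + eln_plus (1 / ereal (\<bar>x - y\<bar> * (x + y)))
                 else ereal ((x + y) powr (1 - 2 * \<sigma>))))
           (\<lambda>(x, y). \<bar>x - y\<bar> * (x + y))"
    (is "comparable_on ?S ?K ?Y \<and> exp_comparable_on ?S' ?K ?Y' ?Z")
proof
  define g where "g = Gamma \<sigma>"
  have g: "g > 0" using assms(2) by (simp add: g_def Gamma_real_pos)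
  define X where "X = (\<lambda>p. ennreal (1 / g) * kernel_integral \<alpha> \<sigma> (fst p) (snd p))"
  have K: "?K = (\<lambda>p. enn2ereal (X p))"
    by (simp add: X_def g_def potential_kernel_eq case_prod_unfold)
  have scale: "kernel_integral \<alpha> \<sigma> (fst p) (snd p) = ennreal g * X p" for p
    using g by (simp add: X_def mult.assoc[symmetric] ennreal_mult'[symmetric])

  define Y where "Y = (\<lambda>p. ennreal (large_time_term \<alpha> \<sigma> (fst p + snd p))
         + ennreal ((fst p + snd p) powr (2 * \<sigma> - 2 * \<alpha> - 2)) * profile \<sigma> (\<bar>fst p - snd p\<bar> / (fst p + snd p)))"
  obtain C where C: "C > 0" and low: "\<And>x y. x > 0 \<Longrightarrow> y > 0 \<Longrightarrow> x + y \<le> 1 \<Longrightarrow> Y (x, y) \<le> ennreal C * kernel_integral \<alpha> \<sigma> x y"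
    using kernel_integral_lower_small[OF assms] by (auto simp: Y_def)
  obtain D where D: "D > 0" and up: "\<And>x y. x > 0 \<Longrightarrow> y > 0 \<Longrightarrow> x + y \<le> 1 \<Longrightarrow> kernel_integral \<alpha> \<sigma> x y \<le> ennreal D * Y (x, y)"
    using kernel_integral_upper_small[OF assms] by (auto simp: Y_def)
  have "comparable_on ?S (\<lambda>p. enn2ereal (X p)) (\<lambda>p. enn2ereal (Y p))"
  proof (rule comparable_on_enn2ereal)
    fix p assume "p \<in> ?S"
    then have p: "fst p > 0" "snd p > 0" "fst p + snd p \<le> 1" by auto
    show "Y p \<le> ennreal (C * g) * X p"
      using low[OF p] C unfolding scale by (simp add: ennreal_mult' mult.assoc)
    show "X p \<le> ennreal (1 / g * D) * Y p"
      unfolding X_def by (rule ennreal_cmult_le) (use up[OF p] g in auto)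
  qed (use C D g in auto)
  moreover have "enn2ereal (Y p) = ?Y p" if "p \<in> ?S" for p
    using that enn2ereal_profile_near_origin[of "fst p + snd p" "\<bar>fst p - snd p\<bar>" \<sigma> \<alpha>]
      enn2ereal_large_time_term[of "fst p + snd p" \<alpha> \<sigma>]
    by (simp add: Y_def plus_ennreal.rep_eq case_prod_unfold abs_if)
  ultimately show "comparable_on ?S ?K ?Y"
    unfolding K comparable_on_def by (metis (no_types, lifting))

  define Y' where "Y' = (\<lambda>p. ennreal ((fst p + snd p) powr (- 2 * \<alpha> - 2 * \<sigma>)) * profile \<sigma> (\<bar>fst p - snd p\<bar> * (fst p + snd p)))"
  obtain C' where C': "C' > 0" and low': "\<And>x y. x > 0 \<Longrightarrow> y > 0 \<Longrightarrow> x + y > 1 \<Longrightarrow>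
      Y' (x, y) * ennreal (exp (- 4 * (\<bar>x - y\<bar> * (x + y)))) \<le> ennreal C' * kernel_integral \<alpha> \<sigma> x y"
    using kernel_integral_lower_large[OF assms] by (auto simp: Y'_def)
  obtain D' where D': "D' > 0" and up': "\<And>x y. x > 0 \<Longrightarrow> y > 0 \<Longrightarrow> x + y > 1 \<Longrightarrow>
      kernel_integral \<alpha> \<sigma> x y \<le> ennreal D' * (Y' (x, y) * ennreal (exp (- (1 / 32) * (\<bar>x - y\<bar> * (x + y)))))"
    using kernel_integral_upper_large[OF assms] by (auto simp: Y'_def)
  have "exp_comparable_on ?S' (\<lambda>p. enn2ereal (X p)) (\<lambda>p. enn2ereal (Y' p)) ?Z"
  proof (rule exp_comparable_on_enn2ereal[where ?c1.0 = 4 and ?c2.0 = "1 / 32"])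
    fix p assume "p \<in> ?S'"
    then have p: "fst p > 0" "snd p > 0" "fst p + snd p > 1" by auto
    show "Y' p * ennreal (exp (- 4 * ?Z p)) \<le> ennreal (C' * g) * X p"
      using low'[OF p] C' unfolding scale by (simp add: ennreal_mult' mult.assoc case_prod_unfold)
    show "X p \<le> ennreal (1 / g * D') * (Y' p * ennreal (exp (- (1 / 32) * ?Z p)))"
      unfolding X_def by (rule ennreal_cmult_le) (use up'[OF p] g in \<open>auto simp: case_prod_unfold\<close>)
  qed (use C' D' g in auto)
  moreover have "enn2ereal (Y' p) = ?Y' p" if "p \<in> ?S'" for p
    using that enn2ereal_profile_far[of "fst p + snd p" "\<bar>fst p - snd p\<bar>" \<alpha> \<sigma>]
    by (simp add: Y'_def case_prod_unfold)
  ultimately show "exp_comparable_on ?S' ?K ?Y' ?Z"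
    unfolding K exp_comparable_on_def by (metis (no_types, lifting))
qed

end
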